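(* Let $1\le p<q<\infty$, $\varphi\in\mathcal{G}^{\rm dec}$ and $\rho:(0,\infty)\to(0,\infty)$. Assume that $\int_0^1\frac{\rho(t)}t\,dt<\infty$ and that there exist positive constants $C,K_1,K_2$ with $K_1<K_2$ such that $\sup_{r\le t\le2r}\rho(t)\le C\int_{K_1r}^{K_2r}\frac{\rho(t)}t\,dt$ for all $r>0$. (i) Assume that $\lim_{r\to0}\varphi(r)=\infty$ and $\lim_{r\to\infty}\varphi(r)=0$, and that there exists a positive constant $A$ such that, for all $r\in(0,\infty)$, $$\int_0^r\frac{\rho(t)}t\,dt\,\varphi(r)^{1/p}+\int_r^\infty\frac{\rho(t)\varphi(t)^{1/p}}t\,dt\le A\,\varphi(r)^{1/q}.\qquad( * )$$ Then there exists a positive constant $C$ such that, for all $f\in L^{(p,\varphi)}(\mathbb{R}^n)$, $$|I_\rho f(x)|\le C\,Mf(x)^{p/q}\left(\|f\|_{L^{(p,\varphi)}}\right)^{1-p/q},\quad x\in\mathbb{R}^n.$$ Consequently, $I_\rho$ is bounded from $L^{(p,\varphi)}(\mathbb{R}^n)$ to $\mathrm{w}L^{(q,\varphi)}(\mathbb{R}^n)$. Moreover, if $p>1$, then, for all $f\in\mathrm{w}L^{(p,\varphi)}(\mathbb{R}^n)$, $$|I_\rho f(x)|\le C\,Mf(x)^{p/q}\left(\|f\|_{\mathrm{w}L^{(p,\varphi)}}\right)^{1-p/q},\quad x\in\mathbb{R}^n.$$ Consequently, if $p>1$, then $I_\rho$ is bounded from $L^{(p,\varphi)}(\mathbb{R}^n)$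 to $L^{(q,\varphi)}(\mathbb{R}^n)$ and from $\mathrm{w}L^{(p,\varphi)}(\mathbb{R}^n)$ to $\mathrm{w}L^{(q,\varphi)}(\mathbb{R}^n)$. (ii) If $I_\rho$ is bounded from $L^{(p,\varphi)}(\mathbb{R}^n)$ to $\mathrm{w}L^{(q,\varphi)}(\mathbb{R}^n)$, then there exists a positive constant $A'$ such that, for all $r\in(0,\infty)$, $$\int_0^r\frac{\rho(t)}t\,dt\,\varphi(r)^{1/p}\le A'\,\varphi(r)^{1/q}.\qquad( ** )$$ Moreover, under the assumption that there exists a positive constant $C$ such that $\int_0^r\varphi(t)t^{n-1}\,dt\le C\varphi(r)r^n$ for all $r\in(0,\infty)$, if $I_\rho$ is bounded from $L^{(p,\varphi)}(\mathbb{R}^n)$ to $\mathrm{w}L^{(q,\varphi)}(\mathbb{R}^n)$, then $( * )$ holds for some $A\in(0,\infty)$ and for all $r\in(0,\infty)$. (iii) In part (ii), the boundedness from $L^{(p,\varphi)}(\mathbb{R}^n)$ to $\mathrm{w}L^{(q,\varphi)}(\mathbb{R}^n)$ can be replaced by the boundedness from $L^{(p,\varphi)}(\mathbb{R}^n)$ to $L^{(1,\varphi^{1/q})}(\mathbb{R}^n)$; that is, if $I_\rho$ is bounded from $L^{(p,\varphi)}(\mathbb{R}^n)$ to $L^{(1,\varphi^{1/q})}(\mathbb{R}^n)$, then $( ** )$ holds for some $A'\in(0,\infty)$ and all $r\in(0,\infty)$, and if in addition there is $C>0$ with $\int_0^r\varphi(t)t^{n-1}\,dt\le C\varphi(r)r^n$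 for all $r\in(0,\infty)$, then $( * )$ holds for some $A\in(0,\infty)$ and all $r\in(0,\infty)$.
   Context: $|G|$ is the Lebesgue measure of $G\subset\mathbb{R}^n$; $B(a,r)$ is the open ball with center $a$ and radius $r$; $m(G,f,t)=|\{x\in G:|f(x)|>t\}|$. Functions appearing under integral signs are understood to be measurable. The generalized fractional integral operator is $I_\rho f(x)=\int_{\mathbb{R}^n}\frac{\rho(|x-y|)}{|x-y|^n}f(y)\,dy$. $M$ is the Hardy-Littlewood maximal operator, $Mf(x)=\sup_{B\ni x}\frac1{|B|}\int_B|f(y)|\,dy$, supremum over all balls $B$ containing $x$. An operator $T$ is bounded from $X$ to $Y$ if there is a constant $C>0$ with $\|Tf\|_Y\le C\|f\|_X$ for all $f\in X$. $\mathcal{G}^{\rm dec}$ is the set of all $\varphi:(0,\infty)\to(0,\infty)$ for which there is $C>0$ such that $C\varphi(r)\ge\varphi(s)$ and $\varphi(r)r^n\le C\varphi(s)s^n$ whenever $0<r<s<\infty$. For $1\le p<\infty$ and $\varphi:(0,\infty)\to(0,\infty)$, the generalized Morrey space $L^{(p,\varphi)}(\mathbb{R}^n)$ and generalized weak Morrey space $\mathrm{w}L^{(p,\varphi)}(\mathbb{R}^n)$ are the sets of measurable $f$ on $\mathbb{R}^n$ for which, respectively, $$\|f\|_{L^{(p,\varphi)}}=\sup_{B=B(a,r)}\Big(\frac1{\varphi(r)|B|}\int_B|f(x)|^p\,dx\Big)^{1/p},\quad \|f\|_{\mathrm{w}L^{(p,\varphi)}}=\sup_{B=B(a,r)}\ \sup_{t\in(0,\infty)}\Big(\frac{t^p\,m(B,f,t)}{\varphi(r)|B|}\Big)^{1/p}$$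 is finite, suprema over all balls. $\varphi^{1/q}$ denotes $r\mapsto\varphi(r)^{1/q}$. *)

theory Defs
  imports "HOL-Analysis.Analysis"
begin

text \<open>
  Measurability and integration are with respect to Lebesgue measure on a Euclidean space
  of dimension \<open>n = DIM('a)\<close>.  Functions take values in a normed space; the intended
  instances are \<open>real\<close> and \<open>complex\<close>.  Functions \<open>\<phi>\<close> and \<open>\<rho>\<close> on \<open>(0,\<infinity>)\<close> are functions on
  \<open>real\<close> of which only the values at positive arguments are used.  All (quasi-)norms, the
  maximal function and the integrals of nonnegative functions have values in \<open>[0,\<infinity>]\<close>.
\<close>

text \<open>The library has no real powers on \<^typ>\<open>ennreal\<close>; this one is used with \<open>a > 0\<close> only.\<close>

definition enn_powr :: "ennreal \<Rightarrow> real \<Rightarrow> ennreal" where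
  "enn_powr x a = (if x = \<infinity> then \<infinity> else ennreal (enn2real x powr a))"

definition G_dec :: "nat \<Rightarrow> (real \<Rightarrow> real) set" where
  "G_dec n = {\<phi>. (\<forall>r>0. 0 < \<phi> r) \<and>
     (\<exists>C>0. \<forall>r s. 0 < r \<and> r < s \<longrightarrow> C * \<phi> r \<ge> \<phi> s \<and> \<phi> r * r ^ n \<le> C * (\<phi> s * s ^ n))}"

definition morrey_norm ::
  "real \<Rightarrow> (real \<Rightarrow> real) \<Rightarrow> ('a::euclidean_space \<Rightarrow> 'b::real_normed_vector) \<Rightarrow> ennreal" where
  "morrey_norm p \<phi> f =
     (SUP a. SUP r\<in>{0<..}.
        enn_powr ((\<integral>\<^sup>+x\<in>ball a r. ennreal (norm (f x) powr p) \<partial>lebesgue)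
                    / (ennreal (\<phi> r) * emeasure lebesgue (ball a r))) (1 / p))"

definition distr_fun ::
  "'a::euclidean_space set \<Rightarrow> ('a \<Rightarrow> 'b::real_normed_vector) \<Rightarrow> real \<Rightarrow> ennreal" where
  "distr_fun G f t = emeasure lebesgue {x\<in>G. norm (f x) > t}"

definition weak_morrey_norm ::
  "real \<Rightarrow> (real \<Rightarrow> real) \<Rightarrow> ('a::euclidean_space \<Rightarrow> 'b::real_normed_vector) \<Rightarrow> ennreal" where
  "weak_morrey_norm p \<phi> f =
     (SUP a. SUP r\<in>{0<..}. SUP t\<in>{0<..}.
        enn_powr (ennreal (t powr p) * distr_fun (ball a r) f t
                    / (ennreal (\<phi> r) * emeasure lebesgue (ball a r))) (1 / p))"

text \<open>The measurable functions on which a given (quasi-)norm is finite.\<close>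

definition norm_space ::
  "(('a::euclidean_space \<Rightarrow> 'b::real_normed_vector) \<Rightarrow> ennreal) \<Rightarrow> ('a \<Rightarrow> 'b) set" where
  "norm_space N = {f \<in> borel_measurable lebesgue. N f < \<infinity>}"

definition morrey ::
  "real \<Rightarrow> (real \<Rightarrow> real) \<Rightarrow> ('a::euclidean_space \<Rightarrow> 'b::real_normed_vector) set" where
  "morrey p \<phi> = norm_space (morrey_norm p \<phi>)"

definition weak_morrey ::
  "real \<Rightarrow> (real \<Rightarrow> real) \<Rightarrow> ('a::euclidean_space \<Rightarrow> 'b::real_normed_vector) set" where
  "weak_morrey p \<phi> = norm_space (weak_morrey_norm p \<phi>)"

definition maximal_fun ::
  "('a::euclidean_space \<Rightarrow> 'b::real_normed_vector) \<Rightarrow> 'a \<Rightarrow> ennreal" where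
  "maximal_fun f x =
     (SUP (a, r)\<in>{(a, r). 0 < r \<and> x \<in> ball a r}.
        (\<integral>\<^sup>+y\<in>ball a r. ennreal (norm (f y)) \<partial>lebesgue) / emeasure lebesgue (ball a r))"

definition frac_integrand ::
  "(real \<Rightarrow> real) \<Rightarrow> ('a::euclidean_space \<Rightarrow> 'b::real_normed_vector) \<Rightarrow> 'a \<Rightarrow> 'a \<Rightarrow> 'b" where
  "frac_integrand \<rho> f x y = (\<rho> (norm (x - y)) / norm (x - y) ^ DIM('a)) *\<^sub>R f y"

definition frac_integral ::
  "(real \<Rightarrow> real) \<Rightarrow> ('a::euclidean_space \<Rightarrow> 'b::{banach, second_countable_topology})
     \<Rightarrow> 'a \<Rightarrow> 'b" where
  "frac_integral \<rho> f x = (\<integral>y. frac_integrand \<rho> f x y \<partial>lebesgue)"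

text \<open>
  The Bochner integral of a non-integrable function is 0 by convention, so absolute
  convergence of the integral defining the operator at \<open>x\<close> has to be stated separately.
\<close>

definition frac_integral_defined ::
  "(real \<Rightarrow> real) \<Rightarrow> ('a::euclidean_space \<Rightarrow> 'b::{banach, second_countable_topology})
     \<Rightarrow> 'a \<Rightarrow> bool" where
  "frac_integral_defined \<rho> f x \<longleftrightarrow> integrable lebesgue (frac_integrand \<rho> f x)"

text \<open>
  The pointwise inequality \<open>|I\<^sub>\<rho> f(x)| \<le> R\<close> with \<open>R \<in> [0,\<infinity>]\<close>; for finite \<open>R\<close> it
  includes the convergence of the integral.
\<close>

definition frac_integral_le ::
  "(real \<Rightarrow> real) \<Rightarrow> ('a::euclidean_space \<Rightarrow> 'b::{banach, second_countable_topology})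
     \<Rightarrow> 'a \<Rightarrow> ennreal \<Rightarrow> bool" where
  "frac_integral_le \<rho> f x R \<longleftrightarrow>
     (R < \<infinity> \<longrightarrow> frac_integral_defined \<rho> f x) \<and> ennreal (norm (frac_integral \<rho> f x)) \<le> R"

text \<open>
  Boundedness of \<open>I\<^sub>\<rho>\<close> from the space with norm \<open>NX\<close> to the space with norm \<open>NY\<close>.  It includes
  that \<open>I\<^sub>\<rho> f\<close> is given by a convergent integral almost everywhere.
\<close>

definition frac_integral_bounded ::
  "(real \<Rightarrow> real)
     \<Rightarrow> (('a::euclidean_space \<Rightarrow> 'b::{banach, second_countable_topology}) \<Rightarrow> ennreal)
     \<Rightarrow> (('a \<Rightarrow> 'b) \<Rightarrow> ennreal) \<Rightarrow> bool" where
  "frac_integral_bounded \<rho> NX NY \<longleftrightarrow>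
     (\<exists>C>0. \<forall>f\<in>norm_space NX.
        (AE x in lebesgue. frac_integral_defined \<rho> f x) \<and>
        frac_integral \<rho> f \<in> norm_space NY \<and>
        NY (frac_integral \<rho> f) \<le> ennreal C * NX f)"

definition full_cond ::
  "(real \<Rightarrow> real) \<Rightarrow> (real \<Rightarrow> real) \<Rightarrow> real \<Rightarrow> real \<Rightarrow> real \<Rightarrow> bool" where
  "full_cond \<rho> \<phi> p q A \<longleftrightarrow>
     (\<forall>r>0. (\<integral>\<^sup>+t\<in>{0<..<r}. ennreal (\<rho> t / t) \<partial>lebesgue) * ennreal (\<phi> r powr (1 / p))
            + (\<integral>\<^sup>+t\<in>{r<..}. ennreal (\<rho> t * \<phi> t powr (1 / p) / t) \<partial>lebesgue)
          \<le> ennreal (A * \<phi> r powr (1 / q)))"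

definition local_cond ::
  "(real \<Rightarrow> real) \<Rightarrow> (real \<Rightarrow> real) \<Rightarrow> real \<Rightarrow> real \<Rightarrow> real \<Rightarrow> bool" where
  "local_cond \<rho> \<phi> p q A \<longleftrightarrow>
     (\<forall>r>0. (\<integral>\<^sup>+t\<in>{0<..<r}. ennreal (\<rho> t / t) \<partial>lebesgue) * ennreal (\<phi> r powr (1 / p))
          \<le> ennreal (A * \<phi> r powr (1 / q)))"

definition radial_cond :: "nat \<Rightarrow> (real \<Rightarrow> real) \<Rightarrow> bool" where
  "radial_cond n \<phi> \<longleftrightarrow>
     (\<exists>C>0. \<forall>r>0. (\<integral>\<^sup>+t\<in>{0<..<r}. ennreal (\<phi> t * t ^ (n - 1)) \<partial>lebesgue)
                     \<le> ennreal (C * (\<phi> r * r ^ n)))"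

end

theory Submission
  imports Defs
begin

text \<open>
  For (i), the growth condition gives \<open>\<rho>(s) \<le> C \<integral>\<rho>(t)/t dt\<close> over \<open>(K\<^sub>1s, K\<^sub>2s)\<close>, so Tonelli's theorem
  bounds \<open>I\<^sub>\<rho>|f|(x)\<close> by the integral of \<open>\<rho>(t)/t\<close> against the mean of \<open>|f|\<close> over the ball with
  centre \<open>x\<close> and radius \<open>t/K\<^sub>1\<close>; no dyadic annuli are needed.  This mean is at most \<open>Mf(x)\<close> (used
  for \<open>t < r\<close>) and at most a multiple of \<open>\<phi>(t)^(1/p) \<parallel>f\<parallel>\<close> (used for \<open>t > r\<close>).  The integral
  condition and a choice of \<open>r\<close> for which \<open>\<phi>(r)\<close> is comparable to \<open>(Mf(x)/\<parallel>f\<parallel>)^p\<close> give Hedberg's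
  inequality.  Boundedness follows from the bounds for \<open>M\<close> on Morrey spaces: on a ball \<open>B\<close> with
  radius \<open>r\<close>, above a multiple of the level \<open>\<phi>(r)^(1/p) \<parallel>f\<parallel>\<close>, \<open>M\<close> only sees \<open>f\<close> on \<open>2B\<close>, where the
  weak type \<open>(1,1)\<close> covering argument applies.

  For (ii) and (iii), the indicator function of a ball with radius \<open>2r\<close> yields the local condition,
  and the function \<open>\<phi>(|y|)^(1/p)\<close>, which lies in the Morrey space by the radial condition, yields
  the bound for the integral over \<open>(r,\<infinity>)\<close>.
\<close>

section \<open>Borel representatives and polar coordinates\<close>

text \<open>\<open>\<phi>\<close> and \<open>\<rho>\<close> are only Lebesgue measurable on the
  half-line, and Lebesgue measurability is not in general preserved under composition with a
  continuous map. Polar coordinates remove this obstacle: null sets of radii pull back to null sets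
  of points, so Borel versions can be used inside the kernel wherever Tonelli's theorem or joint
  measurability is required.

  \<open>\<phi>\<close> need not be continuous or monotone, so each comparison of its values costs a
  constant: almost monotonicity of \<open>\<phi> r\<close> and \<open>\<phi> r * r ^ n\<close> gives
  the dilation estimate \<open>G_dec_dilate\<close>, and a prescribed level is met only up to such a
  constant.

  All constants must be uniform in f; hence the form \<exists>K>0 followed by quantifiers over
  functions, bounds and balls. Estimates are first proved for positive real majorants N of the norm
  and m of the maximal function. The exact values in [0,\<infinity>], where 0 * \<infinity> = 0, are
  inserted at the end, with the values 0 and \<infinity> treated separately.\<close>

lemma borel_measurable_lebesgue_cong_AE:
  assumes f: "f \<in> borel_measurable (lebesgue :: 'a::euclidean_space measure)"
    and eq: "AE x in lborel. f x = g x"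
  shows "g \<in> borel_measurable (lebesgue :: 'a measure)"
proof (rule measurableI)
  fix A :: "'b set" assume A: "A \<in> sets borel"
  from eq obtain N where N: "N \<in> null_sets (lborel :: 'a measure)" "{x. f x \<noteq> g x} \<subseteq> N"
    unfolding eventually_ae_filter by auto
  have N': "N \<in> null_sets lebesgue"
    using N(1) by (simp add: null_sets_completionI)
  have "f -` A \<in> sets lebesgue"
    using measurable_sets[OF f A] by simp
  then have "(f -` A - N) \<union> (g -` A \<inter> N) \<in> sets lebesgue"
    using N' null_setsD2[OF null_sets_completion_subset[OF _ N'], of "g -` A \<inter> N"]
    by (auto intro!: sets.Un sets.Diff)
  also have "(f -` A - N) \<union> (g -` A \<inter> N) = g -` A"
  proof -
    have "f x = g x" if "x \<notin> N" for x using N(2) that by blast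
    then show ?thesis by auto
  qed
  finally show "g -` A \<inter> space lebesgue \<in> sets lebesgue" by simp
qed auto

text \<open>The preimage of each member of a countable basis agrees with a Borel set up to a Borel
  null set. The countably many null sets have a null union \<open>Z\<close>, and altering f on
  \<open>Z\<close> alone makes all these preimages Borel at once. No linear structure on the target
  is involved.\<close>

lemma lebesgue_measurable_ex_borel:
  fixes f :: "'a::euclidean_space \<Rightarrow> 'b::second_countable_topology"
  assumes f: "f \<in> borel_measurable lebesgue"
  obtains g where "g \<in> borel_measurable borel" "AE x in lborel. f x = g x"
proof -
  obtain B :: "'b set set" where B: "countable B" "topological_basis B"
    using ex_countable_basis by blast
  have "\<forall>U\<in>B. \<exists>S N. S \<in> sets borel \<and> N \<in> null_sets lborel \<and> S \<subseteq> f -` U \<and> f -` U \<subseteq> S \<union> N"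
  proof
    fix U assume "U \<in> B"
    then have "U \<in> sets borel"
      using B(2) by (intro borel_open topological_basis_open)
    then have "f -` U \<in> sets lebesgue"
      using measurable_sets[OF f] by simp
    then obtain S N N' where "f -` U = S \<union> N" "N \<subseteq> N'" "N' \<in> null_sets lborel" "S \<in> sets lborel"
      by (elim sets_completionE)
    then show "\<exists>S N. S \<in> sets borel \<and> N \<in> null_sets lborel \<and> S \<subseteq> f -` U \<and> f -` U \<subseteq> S \<union> N"
      by (intro exI[of _ S] exI[of _ N']) auto
  qed
  then obtain S N where SN: "\<And>U. U \<in> B \<Longrightarrow> S U \<in> sets borel"
    "\<And>U. U \<in> B \<Longrightarrow> N U \<in> null_sets lborel"
    "\<And>U. U \<in> B \<Longrightarrow> S U \<subseteq> f -` U" "\<And>U. U \<in> B \<Longrightarrow> f -` U \<subseteq> S U \<union> N U"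
    by metis
  define Z where "Z = (\<Union>U\<in>B. N U)"
  have Z: "Z \<in> null_sets lborel"
    unfolding Z_def using B(1) SN(2) by (intro null_sets_UN') auto
  then have Zb: "Z \<in> sets borel" by auto
  \<comment> \<open>Any constant value on \<open>Z\<close> would do: a preimage under g then
    contains either all of \<open>Z\<close> or nothing of it.\<close>
  define g where "g = (\<lambda>x. if x \<in> Z then undefined else f x)"
  have "g \<in> measurable borel (sigma UNIV B)"
  proof (rule measurable_measure_of)
    fix U assume U: "U \<in> B"
    have "g -` U = (if undefined \<in> U then (S U - Z) \<union> Z else S U - Z)"
      using SN(3,4)[OF U] U by (auto simp: g_def Z_def split: if_splits)
    then show "g -` U \<inter> space borel \<in> sets borel"
      using SN(1)[OF U] Zb by auto
  qed auto
  then have "g \<in> borel_measurable borel"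
    using borel_eq_countable_basis[OF B] by simp
  moreover have "AE x in lborel. f x = g x"
    using AE_not_in[OF Z] by eventually_elim (auto simp: g_def)
  ultimately show ?thesis by (rule that)
qed

text \<open>Polar coordinates without a surface measure: both sides give the half-line below a the
  volume of the ball of radius a, finite for every a, and these half-lines form an
  intersection-stable generator of the Borel sets.\<close>

lemma distr_norm_lborel:
  "distr lborel borel (norm :: 'a::euclidean_space \<Rightarrow> real) =
    density lborel (\<lambda>t. ennreal (DIM('a) * unit_ball_vol DIM('a) * t ^ (DIM('a) - 1)) * indicator {0<..} t)"
    (is "?M = ?N")
proof (rule measure_eqI_generator_eq_countable)
  let ?v = "unit_ball_vol DIM('a)"
  let ?E = "range (\<lambda>a::real. {..<a})"
  show "Int_stable ?E"
  proof (rule Int_stableI)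
    fix A B assume "A \<in> ?E" "B \<in> ?E"
    then obtain a b where "A = {..<a}" "B = {..<b}" by auto
    then have "A \<inter> B = {..<min a b}" by auto
    then show "A \<inter> B \<in> ?E" by blast
  qed
  show "?E \<subseteq> Pow UNIV" "sets ?M = sigma_sets UNIV ?E" "sets ?N = sigma_sets UNIV ?E"
    unfolding sets_distr sets_density by (auto simp: borel_Iio)
  have M: "emeasure ?M {..<a} = ennreal (?v * max 0 a ^ DIM('a))" for a
  proof -
    have "emeasure ?M {..<a} = emeasure lborel (ball (0::'a) a)"
      by (subst emeasure_distr) (auto intro!: arg_cong[where f = "emeasure lborel"])
    also have "\<dots> = ennreal (?v * max 0 a ^ DIM('a))"
      by (cases "a \<ge> 0") (auto simp: emeasure_ball ball_empty)
    finally show ?thesis .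
  qed
  show "(\<lambda>k. {..<real k}) ` UNIV \<subseteq> ?E" "countable ((\<lambda>k. {..<real k}) ` UNIV)"
    by auto
  show "(\<Union>k. {..<real k}) = UNIV"
    using reals_Archimedean2 by auto
  show "emeasure ?M a \<noteq> \<infinity>" if "a \<in> (\<lambda>k. {..<real k}) ` UNIV" for a
    using that M by auto
  show "emeasure ?M X = emeasure ?N X" if "X \<in> ?E" for X
  proof -
    from that obtain a where X: "X = {..<a}" by auto
    have "emeasure ?N X = (\<integral>\<^sup>+t. ennreal (DIM('a) * ?v * t ^ (DIM('a) - 1)) * indicator {0..max 0 a} t \<partial>lborel)"
      unfolding X
    proof (subst emeasure_density, measurable, rule nn_integral_cong_AE)
      \<comment> \<open>The endpoints 0 and a are discarded so that the fundamental theorem of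
        calculus applies on a closed interval; \<open>max 0 a\<close> covers negative a, where that
        interval shrinks to a point.\<close>
      have "AE t in lborel. t \<noteq> 0 \<and> t \<noteq> a"
        using AE_lborel_singleton[of "0::real"] AE_lborel_singleton[of a] by eventually_elim auto
      then show "AE t in lborel. ennreal (DIM('a) * ?v * t ^ (DIM('a) - 1)) * indicator {0<..} t *
          indicator {..<a} t = ennreal (DIM('a) * ?v * t ^ (DIM('a) - 1)) * indicator {0..max 0 a} t"
      proof eventually_elim
        case (elim t)
        then have "indicator {0<..} t * indicator {..<a} t = (indicator {0..max 0 a} t :: ennreal)"
          by (auto simp: indicator_def)
        then show ?case by (simp only: mult.assoc)
      qed
    qed
    also have "\<dots> = ennreal (?v * max 0 a ^ DIM('a) - ?v * 0 ^ DIM('a))"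
      by (rule nn_integral_FTC_Icc) (auto intro!: derivative_eq_intros simp: mult_ac)
    also have "\<dots> = emeasure ?M X" by (simp add: X M zero_power)
    finally show ?thesis by simp
  qed
qed

lemma nn_integral_norm_lborel:
  assumes "g \<in> borel_measurable borel"
  shows "(\<integral>\<^sup>+x. g (norm (x::'a::euclidean_space)) \<partial>lborel) =
    ennreal (DIM('a) * unit_ball_vol DIM('a)) *
      (\<integral>\<^sup>+t\<in>{0<..}. g t * ennreal (t ^ (DIM('a) - 1)) \<partial>lborel)"
proof -
  have "(\<integral>\<^sup>+x. g (norm (x::'a)) \<partial>lborel) = (\<integral>\<^sup>+t. g t \<partial>distr lborel borel (norm :: 'a \<Rightarrow> real))"
    using assms by (subst nn_integral_distr) auto
  also have "\<dots> = (\<integral>\<^sup>+t. ennreal (DIM('a) * unit_ball_vol DIM('a)) *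
      (g t * ennreal (t ^ (DIM('a) - 1)) * indicator {0<..} t) \<partial>lborel)"
    unfolding distr_norm_lborel using assms
    by (subst nn_integral_density)
       (auto intro!: nn_integral_cong simp: indicator_def ennreal_mult mult_ac)
  also have "\<dots> = ennreal (DIM('a) * unit_ball_vol DIM('a)) *
      (\<integral>\<^sup>+t\<in>{0<..}. g t * ennreal (t ^ (DIM('a) - 1)) \<partial>lborel)"
    using assms by (intro nn_integral_cmult) auto
  finally show ?thesis .
qed

lemma nn_integral_lborel_reflect:
  fixes x :: "'a::euclidean_space"
  assumes "g \<in> borel_measurable borel"
  shows "(\<integral>\<^sup>+y. g (x - y) \<partial>lborel) = (\<integral>\<^sup>+y. g y \<partial>lborel)"
proof -
  have "distr lborel borel ((-) x) = (lborel :: 'a measure)"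
    using lborel_affine[of "-1" x] by (simp add: density_1)
  then have "(\<integral>\<^sup>+y. g y \<partial>lborel) = (\<integral>\<^sup>+y. g y \<partial>distr lborel borel ((-) x))"
    by simp
  also have "\<dots> = (\<integral>\<^sup>+y. g (x - y) \<partial>lborel)"
    using assms by (intro nn_integral_distr) auto
  finally show ?thesis by simp
qed

lemma AE_lborel_reflect:
  fixes x :: "'a::euclidean_space"
  assumes "AE y in lborel. P y"
  shows "AE y in lborel. P (x - y)"
proof -
  from assms obtain N where N: "N \<in> null_sets (lborel :: 'a measure)" "{y. \<not> P y} \<subseteq> N"
    unfolding eventually_ae_filter by auto
  have [measurable]: "N \<in> sets borel" using N(1) by auto
  have "(\<integral>\<^sup>+y. indicator N (x - y) \<partial>lborel) = (\<integral>\<^sup>+y. indicator N y \<partial>lborel)"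
    by (rule nn_integral_lborel_reflect) auto
  also have "\<dots> = 0" using N(1) by auto
  finally have "AE y in lborel. indicator N (x - y) = (0::ennreal)"
    by (subst (asm) nn_integral_0_iff_AE) auto
  then show ?thesis
    by eventually_elim (use N(2) in \<open>auto simp: indicator_def split: if_splits\<close>)
qed

text \<open>By polar coordinates the points whose distance from x lies in a null set of radii form a
  null set. This permits replacing \<open>\<rho>\<close> and \<open>\<phi>\<close> by Borel versions
  inside radial kernels; the radius 0 corresponds to the single point x.\<close>

lemma AE_lborel_norm_diff:
  fixes x :: "'a::euclidean_space"
  assumes "AE t in lborel. 0 < t \<longrightarrow> P t"
  shows "AE y in lborel. P (norm (x - y))"
proof -
  from assms obtain N where N: "N \<in> null_sets lborel" "{t. \<not> (0 < t \<longrightarrow> P t)} \<subseteq> N"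
    unfolding eventually_ae_filter by auto
  have [measurable]: "N \<in> sets borel" using N(1) by auto
  have "AE t in lborel. indicator N t * ennreal (t ^ (DIM('a) - 1)) * indicator {0<..} t = 0"
    using AE_not_in[OF N(1)] by eventually_elim auto
  then have "(\<integral>\<^sup>+t\<in>{0<..}. indicator N t * ennreal (t ^ (DIM('a) - 1)) \<partial>lborel) = 0"
    by (subst nn_integral_0_iff_AE) auto
  then have "(\<integral>\<^sup>+y. indicator N (norm (y::'a)) \<partial>lborel) = 0"
    by (subst nn_integral_norm_lborel) auto
  then have 1: "AE y in lborel. indicator N (norm (y::'a)) = (0::ennreal)"
    by (subst (asm) nn_integral_0_iff_AE) auto
  have 2: "AE y in lborel. y \<noteq> (0::'a)"
    by (rule AE_lborel_singleton)
  have "AE y in lborel. P (norm (y::'a))"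
    using 1 2
  proof eventually_elim
    case (elim y)
    then have "norm y \<notin> N" "0 < norm y" by (auto simp: indicator_def split: if_splits)
    then show ?case using N(2) by blast
  qed
  then show ?thesis by (rule AE_lborel_reflect)
qed

lemma borel_measurable_Ioi_ex_borel:
  fixes g :: "real \<Rightarrow> real"
  assumes "g \<in> borel_measurable (lebesgue_on {0<..})"
  obtains h where "h \<in> borel_measurable borel" "AE t in lborel. 0 < t \<longrightarrow> g t = h t"
proof -
  have "(\<lambda>t. if t \<in> {0<..} then g t else 0) \<in> borel_measurable lebesgue"
    using assms by (subst borel_measurable_if) auto
  then obtain h where h: "h \<in> borel_measurable borel" "AE t in lborel. (if t \<in> {0<..} then g t else 0) = h t"
    by (rule lebesgue_measurable_ex_borel)
  show ?thesis
  proof (rule that[OF h(1)])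
    show "AE t in lborel. 0 < t \<longrightarrow> g t = h t"
      using h(2) by eventually_elim auto
  qed
qed

section \<open>The Hardy-Littlewood maximal function\<close>

lemma emeasure_lebesgue_ball:
  "0 \<le> r \<Longrightarrow> emeasure lebesgue (ball (a::'a::euclidean_space) r) = ennreal (unit_ball_vol DIM('a) * r ^ DIM('a))"
  by (simp add: emeasure_ball)

lemma emeasure_lebesgue_ball_pos:
  "0 < r \<Longrightarrow> 0 < emeasure lebesgue (ball (a::'a::euclidean_space) r)"
  by (simp add: emeasure_ball)

lemma emeasure_lebesgue_ball_finite: "emeasure lebesgue (ball (a::'a::euclidean_space) r) < \<infinity>"
  using fmeasurableD2[OF lmeasurable_ball[of a r]] by (simp add: less_top)

lemma sets_lebesgue_ball[measurable, simp]: "ball (a::'a::euclidean_space) r \<in> sets lebesgue"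
  by (rule fmeasurableD[OF lmeasurable_ball])

lemma sets_lebesgue_open: "open S \<Longrightarrow> S \<in> sets lebesgue"
  by (intro sets_completionI_sets) simp

lemma divide_le_iff_ennreal:
  "c \<noteq> 0 \<Longrightarrow> c \<noteq> top \<Longrightarrow> a / c \<le> b \<longleftrightarrow> a \<le> b * (c :: ennreal)"
proof
  assume c: "c \<noteq> 0" "c \<noteq> top" and le: "a / c \<le> b"
  have "a = a / c * c" using c by (simp add: ennreal_divide_times less_top)
  then show "a \<le> b * c" using mult_right_mono[OF le, of c] by simp
next
  assume "c \<noteq> 0" "a \<le> b * c"
  then show "a / c \<le> b" by (intro divide_le_posI_ennreal) (auto simp: mult.commute zero_less_iff_neq_zero)
qed

lemma less_divide_iff_ennreal:
  "c \<noteq> 0 \<Longrightarrow> c \<noteq> top \<Longrightarrow> b < a / c \<longleftrightarrow> b * c < (a :: ennreal)"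
  using divide_le_iff_ennreal[of c a b] by (simp add: not_le[symmetric])

text \<open>Vitali covering: disjoint balls are selected whose fivefold enlargements cover the
  union. Enlarging multiplies volume by \<open>5 ^ DIM('a)\<close>, each selected ball has volume
  below 1/t times the integral of h over it, and by disjointness these integrals add up to at most
  the total. The union is open, hence measurable.\<close>

lemma weak_type_covering:
  fixes h :: "'a::euclidean_space \<Rightarrow> ennreal"
  assumes h: "h \<in> borel_measurable lebesgue" and t: "0 < t"
  shows "emeasure lebesgue (\<Union>{ball a r | a r. 0 < r \<and>
            ennreal t * emeasure lebesgue (ball a r) < (\<integral>\<^sup>+y\<in>ball a r. h y \<partial>lebesgue)})
         \<le> ennreal (5 ^ DIM('a) / t) * (\<integral>\<^sup>+y. h y \<partial>lebesgue)"
proof (cases "(\<integral>\<^sup>+y. h y \<partial>lebesgue) = \<infinity>")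
  case True
  then show ?thesis using t by (simp add: ennreal_mult_top)
next
  case False
  then obtain I where I: "(\<integral>\<^sup>+y. h y \<partial>lebesgue) = ennreal I" "0 \<le> I"
    by (cases "\<integral>\<^sup>+y. h y \<partial>lebesgue") auto
  let ?n = "DIM('a)" let ?v = "unit_ball_vol DIM('a)"
  define K where "K = {(a::'a, r). 0 < r \<and>
    ennreal t * emeasure lebesgue (ball a r) < (\<integral>\<^sup>+y\<in>ball a r. h y \<partial>lebesgue)}"
  \<comment> \<open>The covering lemma needs bounded radii. Membership in \<open>K\<close> bounds
    \<open>r ^ n\<close> by I / (t v), and \<open>r \<le> 1 + r ^ n\<close> turns this into a bound
    for r.\<close>
  have bound: "0 < snd i \<and> snd i \<le> 1 + I / (t * ?v)" if i: "i \<in> K" for i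
  proof -
    obtain a r where i_eq: "i = (a, r)" by force
    have r: "0 < r" and lt: "ennreal t * emeasure lebesgue (ball a r) < (\<integral>\<^sup>+y\<in>ball a r. h y \<partial>lebesgue)"
      using i by (auto simp: K_def i_eq)
    note lt
    also have "(\<integral>\<^sup>+y\<in>ball a r. h y \<partial>lebesgue) \<le> ennreal I"
      unfolding I(1)[symmetric] by (intro nn_integral_mono) (auto simp: indicator_def)
    finally have "ennreal (t * (?v * r ^ ?n)) < ennreal I"
      using t r by (simp add: emeasure_ball ennreal_mult)
    then have "t * (?v * r ^ ?n) < I"
      using I(2) by (subst (asm) ennreal_less_iff) (use t r in auto)
    then have "r ^ ?n < I / (t * ?v)"
      using t by (simp add: field_simps)
    moreover have "r \<le> 1 + r ^ ?n"
    proof (cases "r \<le> 1")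
      case False
      then have "r ^ 1 \<le> r ^ ?n" by (intro power_increasing) (auto simp: Suc_leI)
      then show ?thesis by simp
    qed (use r in \<open>simp add: add_increasing2\<close>)
    ultimately show ?thesis using r i_eq by auto
  qed
  obtain C where C: "countable C" "C \<subseteq> K"
    "pairwise (\<lambda>i j. disjnt (ball (fst i) (snd i)) (ball (fst j) (snd j))) C"
    "\<Union>((\<lambda>i. ball (fst i) (snd i)) ` K) \<subseteq> \<Union>((\<lambda>i. ball (fst i) (5 * snd i)) ` C)"
    using Vitali_covering_lemma_balls[where K = K and r = snd and B = "1 + I / (t * ?v)" and a = fst
        and S = "\<Union>((\<lambda>i. ball (fst i) (snd i)) ` K)", OF subset_refl bound] by blast
  let ?B = "\<lambda>i. ball (fst i) (snd i) :: 'a set"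
  let ?B5 = "\<lambda>i. ball (fst i) (5 * snd i) :: 'a set"
  have "\<Union>{ball a r | a r. 0 < r \<and>
      ennreal t * emeasure lebesgue (ball a r) < (\<integral>\<^sup>+y\<in>ball a r. h y \<partial>lebesgue)} = \<Union>(?B ` K)"
    by (force simp: K_def)
  then have "emeasure lebesgue (\<Union>{ball a r | a r. 0 < r \<and>
      ennreal t * emeasure lebesgue (ball a r) < (\<integral>\<^sup>+y\<in>ball a r. h y \<partial>lebesgue)})
      \<le> emeasure lebesgue (\<Union>(?B5 ` C))"
    using C(4) by (intro emeasure_mono sets_lebesgue_open open_Union) auto
  also have "\<dots> = (\<integral>\<^sup>+x. indicator (\<Union>(?B5 ` C)) x \<partial>lebesgue)"
    by (intro nn_integral_indicator[symmetric] sets_lebesgue_open) auto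
  \<comment> \<open>Countable subadditivity, written as an integral over the counting measure on
    \<open>C\<close> so that the two integrations can be exchanged.\<close>
  also have "\<dots> \<le> (\<integral>\<^sup>+x. (\<integral>\<^sup>+i. indicator (?B5 i) x \<partial>count_space C) \<partial>lebesgue)"
  proof (intro nn_integral_mono)
    fix x
    show "indicator (\<Union>(?B5 ` C)) x \<le> (\<integral>\<^sup>+i. indicator (?B5 i) x \<partial>count_space C)"
    proof (cases "x \<in> \<Union>(?B5 ` C)")
      case True
      then obtain i where "i \<in> C" "x \<in> ?B5 i" by auto
      then show ?thesis
        using nn_integral_ge_point[of i C "\<lambda>i. indicator (?B5 i) x"] by (simp add: indicator_def)
    qed auto
  qed
  also have "\<dots> = (\<integral>\<^sup>+i. (\<integral>\<^sup>+x. indicator (?B5 i) x \<partial>lebesgue) \<partial>count_space C)"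
    using C(1) by (intro nn_integral_count_space_nn_integral) auto
  also have "\<dots> \<le> (\<integral>\<^sup>+i. ennreal (5 ^ ?n / t) * emeasure (density lebesgue h) (?B i) \<partial>count_space C)"
  proof (intro nn_integral_mono)
    fix i assume "i \<in> space (count_space C)"
    then have "i \<in> K" using C(2) by auto
    then have i: "0 < snd i" "ennreal t * emeasure lebesgue (?B i) < (\<integral>\<^sup>+y\<in>?B i. h y \<partial>lebesgue)"
      by (auto simp: K_def)
    have "(\<integral>\<^sup>+x. indicator (?B5 i) x \<partial>lebesgue) = emeasure lebesgue (?B5 i)"
      by simp
    also have "\<dots> = ennreal (5 ^ ?n / t) * (ennreal t * emeasure lebesgue (?B i))"
      using i(1) t by (simp add: emeasure_ball ennreal_mult[symmetric] power_mult_distrib)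
    also have "\<dots> \<le> ennreal (5 ^ ?n / t) * (\<integral>\<^sup>+y\<in>?B i. h y \<partial>lebesgue)"
      using i(2) by (intro mult_left_mono) auto
    also have "(\<integral>\<^sup>+y\<in>?B i. h y \<partial>lebesgue) = emeasure (density lebesgue h) (?B i)"
      using h by (subst emeasure_density) auto
    finally show "(\<integral>\<^sup>+x. indicator (?B5 i) x \<partial>lebesgue) \<le>
        ennreal (5 ^ ?n / t) * emeasure (density lebesgue h) (?B i)" .
  qed
  also have "\<dots> = ennreal (5 ^ ?n / t) * (\<integral>\<^sup>+i. emeasure (density lebesgue h) (?B i) \<partial>count_space C)"
    by (intro nn_integral_cmult) auto
  also have "(\<integral>\<^sup>+i. emeasure (density lebesgue h) (?B i) \<partial>count_space C) =
      emeasure (density lebesgue h) (\<Union>(?B ` C))"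
    using C(1,3)
    by (intro emeasure_UN_countable[symmetric])
       (auto simp: disjoint_family_on_def pairwise_def disjnt_def)
  also have "\<dots> \<le> emeasure (density lebesgue h) UNIV"
    by (intro emeasure_mono) auto
  also have "\<dots> = (\<integral>\<^sup>+y. h y \<partial>lebesgue)"
    using h emeasure_density[of h lebesgue UNIV] by simp
  finally show ?thesis by (simp add: mult_left_mono)
qed

text \<open>Balls have positive finite volume, so the quotient can be cleared. Superlevel sets of
  the maximal function thereby become unions of balls, the form required by the covering
  argument.\<close>

lemma less_maximal_fun_iff:
  "c < maximal_fun f x \<longleftrightarrow> (\<exists>a r. 0 < r \<and> x \<in> ball a r \<and>
     c * emeasure lebesgue (ball a r) < (\<integral>\<^sup>+y\<in>ball a r. ennreal (norm (f y)) \<partial>lebesgue))"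
proof -
  have "c < maximal_fun f x \<longleftrightarrow> (\<exists>a r. (0 < r \<and> x \<in> ball a r) \<and>
     c < (\<integral>\<^sup>+y\<in>ball a r. ennreal (norm (f y)) \<partial>lebesgue) / emeasure lebesgue (ball a r))"
    unfolding maximal_fun_def less_SUP_iff by (auto simp del: mem_ball)
  also have "\<dots> \<longleftrightarrow> (\<exists>a r. 0 < r \<and> x \<in> ball a r \<and>
     c * emeasure lebesgue (ball a r) < (\<integral>\<^sup>+y\<in>ball a r. ennreal (norm (f y)) \<partial>lebesgue))"
  proof (intro ex_cong1)
    fix a r
    show "(0 < r \<and> x \<in> ball a r) \<and>
     c < (\<integral>\<^sup>+y\<in>ball a r. ennreal (norm (f y)) \<partial>lebesgue) / emeasure lebesgue (ball a r) \<longleftrightarrow>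
     0 < r \<and> x \<in> ball a r \<and>
     c * emeasure lebesgue (ball a r) < (\<integral>\<^sup>+y\<in>ball a r. ennreal (norm (f y)) \<partial>lebesgue)"
      using emeasure_lebesgue_ball_pos[of r a] emeasure_lebesgue_ball_finite[of a r]
        less_divide_iff_ennreal[of "emeasure lebesgue (ball a r)"]
      by (auto simp del: mem_ball emeasure_completion)
  qed
  finally show ?thesis .
qed

text \<open>Superlevel sets are unions of open balls, since the supremum runs over all balls
  containing the point and not only over centred ones; the maximal function is thus lower
  semicontinuous.\<close>

lemma borel_measurable_maximal_fun: "maximal_fun f \<in> borel_measurable borel"
proof (rule borel_measurableI_greater)
  fix c
  have "{x. c < maximal_fun f x} = (\<Union>{ball a r | a r. 0 < r \<and> c * emeasure lebesgue (ball a r) <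
      (\<integral>\<^sup>+y\<in>ball a r. ennreal (norm (f y)) \<partial>lebesgue)})"
    unfolding less_maximal_fun_iff by blast
  moreover have "open \<dots>" by (intro open_Union) auto
  ultimately show "{x \<in> space borel. c < maximal_fun f x} \<in> sets borel" by simp
qed

lemma lebesgue_measurable_maximal_fun: "maximal_fun f \<in> borel_measurable lebesgue"
  using measurable_completion[of "maximal_fun f" lborel borel] borel_measurable_maximal_fun[of f] by simp

text \<open>
  Balls with radius at most \<open>r/2\<close> that meet the ball with centre \<open>a\<close> and radius \<open>r\<close> lie in its
  double, and larger balls contribute at most \<open>L\<close>.  Cutting off \<open>f\<close> below \<open>t/2\<close> costs half of the
  level \<open>t\<close>.
\<close>

lemma local_maximal_bound:
  fixes f :: "'a::euclidean_space \<Rightarrow> 'b::{real_normed_vector, second_countable_topology}"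
  assumes f[measurable]: "f \<in> borel_measurable lebesgue"
    and L: "\<And>b s. r / 2 < s \<Longrightarrow>
      (\<integral>\<^sup>+y\<in>ball b s. ennreal (norm (f y)) \<partial>lebesgue) \<le> ennreal L * emeasure lebesgue (ball b s)"
    and t: "0 < t" "L \<le> t"
  shows "emeasure lebesgue {x \<in> ball a r. ennreal t < maximal_fun f x} \<le>
    ennreal (2 * 5 ^ DIM('a) / t) *
      (\<integral>\<^sup>+y\<in>{y \<in> ball a (2 * r). t / 2 < norm (f y)}. ennreal (norm (f y)) \<partial>lebesgue)"
proof -
  let ?G = "{y \<in> ball a (2 * r). t / 2 < norm (f y)}"
  have G[measurable]: "?G \<in> sets lebesgue" by measurable
  define h where "h y = ennreal (norm (f y)) * indicator ?G y" for y
  have h[measurable]: "h \<in> borel_measurable lebesgue"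
    unfolding h_def by measurable
  have "{x \<in> ball a r. ennreal t < maximal_fun f x} \<subseteq>
    \<Union>{ball b s | b s. 0 < s \<and>
        ennreal (t / 2) * emeasure lebesgue (ball b s) < (\<integral>\<^sup>+y\<in>ball b s. h y \<partial>lebesgue)}"
  proof
    fix x assume "x \<in> {x \<in> ball a r. ennreal t < maximal_fun f x}"
    then obtain b s where x: "x \<in> ball a r" and s: "0 < s" "x \<in> ball b s"
      and lt: "ennreal t * emeasure lebesgue (ball b s) <
        (\<integral>\<^sup>+y\<in>ball b s. ennreal (norm (f y)) \<partial>lebesgue)"
      unfolding less_maximal_fun_iff by auto
    let ?V = "emeasure lebesgue (ball b s)"
    have "s \<le> r / 2"
    proof (rule ccontr)
      assume "\<not> s \<le> r / 2"
      then have "(\<integral>\<^sup>+y\<in>ball b s. ennreal (norm (f y)) \<partial>lebesgue) \<le> ennreal L * ?V"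
        by (intro L) auto
      also have "\<dots> \<le> ennreal t * ?V"
        using t by (intro mult_right_mono) (auto intro: ennreal_leI)
      finally show False using lt by simp
    qed
    have sub: "y \<in> ball a (2 * r)" if "y \<in> ball b s" for y
    proof -
      have "dist a y \<le> dist a x + (dist b x + dist b y)"
        by (metis add_le_cancel_left dist_triangle order_trans dist_triangle3 dist_commute)
      then show ?thesis using x s(2) that \<open>s \<le> r / 2\<close> by simp
    qed
    have "(\<integral>\<^sup>+y\<in>ball b s. ennreal (norm (f y)) \<partial>lebesgue) \<le>
        (\<integral>\<^sup>+y. h y * indicator (ball b s) y + ennreal (t / 2) * indicator (ball b s) y \<partial>lebesgue)"
    proof (intro nn_integral_mono)
      fix y
      show "ennreal (norm (f y)) * indicator (ball b s) y \<le>
          h y * indicator (ball b s) y + ennreal (t / 2) * indicator (ball b s) y"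
        using sub[of y] by (auto simp: h_def indicator_def not_less simp del: mem_ball intro: ennreal_leI)
    qed
    also have "\<dots> = (\<integral>\<^sup>+y\<in>ball b s. h y \<partial>lebesgue) + ennreal (t / 2) * ?V"
      by (subst nn_integral_add) (auto simp: nn_integral_cmult_indicator)
    finally have "ennreal t * ?V < (\<integral>\<^sup>+y\<in>ball b s. h y \<partial>lebesgue) + ennreal (t / 2) * ?V"
      using lt by simp
    moreover have "ennreal t * ?V = ennreal (t / 2) * ?V + ennreal (t / 2) * ?V"
      using t by (simp add: distrib_right[symmetric] ennreal_plus[symmetric] del: ennreal_plus)
    ultimately have "\<not> (\<integral>\<^sup>+y\<in>ball b s. h y \<partial>lebesgue) \<le> ennreal (t / 2) * ?V"
      using add_right_mono[of "\<integral>\<^sup>+y\<in>ball b s. h y \<partial>lebesgue" "ennreal (t / 2) * ?V" "ennreal (t / 2) * ?V"]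
      by (auto dest: leD)
    then have "ennreal (t / 2) * ?V < (\<integral>\<^sup>+y\<in>ball b s. h y \<partial>lebesgue)"
      by (simp only: not_le)
    then show "x \<in> \<Union>{ball b s | b s. 0 < s \<and>
        ennreal (t / 2) * emeasure lebesgue (ball b s) < (\<integral>\<^sup>+y\<in>ball b s. h y \<partial>lebesgue)}"
      using s by blast
  qed
  then have "emeasure lebesgue {x \<in> ball a r. ennreal t < maximal_fun f x} \<le>
    emeasure lebesgue (\<Union>{ball b s | b s. 0 < s \<and>
        ennreal (t / 2) * emeasure lebesgue (ball b s) < (\<integral>\<^sup>+y\<in>ball b s. h y \<partial>lebesgue)})"
    by (rule emeasure_mono) (rule sets_lebesgue_open, auto intro!: open_Union)
  also have "\<dots> \<le> ennreal (5 ^ DIM('a) / (t / 2)) * (\<integral>\<^sup>+y. h y \<partial>lebesgue)"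
    by (rule weak_type_covering) (use t in auto)
  finally show ?thesis by (simp add: h_def mult.commute)
qed

section \<open>Dyadic sums in place of layer-cake integrals\<close>

lemma dyadic_bracket:
  fixes t u :: real
  assumes "0 < t" "t < u"
  shows "\<exists>k. 2 ^ k * t < u \<and> u \<le> 2 ^ Suc k * t"
proof -
  obtain m where "u / t < 2 ^ m"
    using real_arch_pow[of 2 "u / t"] by auto
  then have ex: "u \<le> 2 ^ m * t" using assms(1) by (simp add: field_simps)
  define j where "j = (LEAST m. u \<le> 2 ^ m * t)"
  have j: "u \<le> 2 ^ j * t" unfolding j_def by (rule LeastI[of "\<lambda>m. u \<le> 2 ^ m * t", OF ex])
  then obtain k where k: "j = Suc k" using assms by (cases j) auto
  have "\<not> u \<le> 2 ^ k * t" using not_less_Least[of k "\<lambda>m. u \<le> 2 ^ m * t"] k by (simp add: j_def)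
  then show ?thesis using j k by (intro exI[of _ k]) auto
qed

text \<open>The single term with \<open>2 ^ k * t < u \<le> 2 ^ Suc k * t\<close> already dominates.
  Summing over all k lets the power of a function be controlled by its dyadic level sets.\<close>

lemma dyadic_majorant:
  assumes "0 < t" "0 < p" "0 \<le> u"
  shows "ennreal (u powr p) * (if t < u then 1 else 0) \<le>
    (\<Sum>k. ennreal ((2 ^ Suc k * t) powr p) * (if 2 ^ k * t < u then 1 else 0))"
proof (cases "t < u")
  case True
  then obtain k where k: "2 ^ k * t < u" "u \<le> 2 ^ Suc k * t"
    using dyadic_bracket assms by blast
  have "ennreal (u powr p) \<le> ennreal ((2 ^ Suc k * t) powr p) * (if 2 ^ k * t < u then 1 else 0)"
    using k assms by (auto intro!: ennreal_leI powr_mono2)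
  also have "\<dots> \<le> (\<Sum>k. ennreal ((2 ^ Suc k * t) powr p) * (if 2 ^ k * t < u then 1 else 0))"
    using sum_le_suminf[of "\<lambda>k. ennreal ((2 ^ Suc k * t) powr p) * (if 2 ^ k * t < u then 1 else 0)" "{k}"]
    by (auto simp: summableI)
  finally show ?thesis using True by simp
qed simp

lemma ennreal_mult_left_assoc:
  "0 \<le> a \<Longrightarrow> ennreal a * (ennreal b * c) = ennreal (a * b) * c"
  by (simp add: ennreal_mult' mult.assoc)

text \<open>Only the terms below u survive. Their ratio \<open>2 powr a\<close> exceeds 1, so the
  sum is at most a constant times its last term, which is at most \<open>u powr a\<close>. This is
  where a positive exponent is indispensable.\<close>

lemma dyadic_geometric:
  assumes "0 < t" "0 < a" "0 \<le> u"
  shows "(\<Sum>k. ennreal ((2 ^ k * t) powr a) * (if 2 ^ k * t < u then 1 else 0)) \<le>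
    ennreal (2 powr a / (2 powr a - 1) * u powr a)"
proof (cases "t < u")
  case True
  then obtain m where m: "2 ^ m * t < u" "u \<le> 2 ^ Suc m * t"
    using dyadic_bracket assms by blast
  have iff: "2 ^ k * t < u \<longleftrightarrow> k < Suc m" for k
  proof
    assume "2 ^ k * t < u"
    then have "2 ^ k * t < 2 ^ Suc m * t" using m(2) by simp
    then show "k < Suc m" using assms(1) by (simp del: power_Suc)
  next
    assume "k < Suc m"
    then have "2 ^ k * t \<le> 2 ^ m * t" using assms(1) by simp
    then show "2 ^ k * t < u" using m(1) by simp
  qed
  define \<theta> where "\<theta> = (2::real) powr a"
  have \<theta>: "1 < \<theta>" using assms(2) by (simp add: \<theta>_def)
  have term_eq: "(2 ^ k * t) powr a = \<theta> ^ k * t powr a" for k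
    using assms(1) by (simp add: \<theta>_def powr_mult powr_power powr_realpow[symmetric] powr_powr mult.commute)
  have "(\<Sum>k. ennreal ((2 ^ k * t) powr a) * (if 2 ^ k * t < u then 1 else 0)) =
      (\<Sum>k<Suc m. ennreal ((2 ^ k * t) powr a))"
    unfolding iff by (subst suminf_finite[of "{..<Suc m}"]) auto
  also have "\<dots> = ennreal (\<Sum>k<Suc m. \<theta> ^ k * t powr a)"
    unfolding term_eq using \<theta> by (subst sum_ennreal) auto
  also have "(\<Sum>k<Suc m. \<theta> ^ k * t powr a) = t powr a * ((\<theta> ^ Suc m - 1) / (\<theta> - 1))"
    using \<theta> geometric_sum[of \<theta> "Suc m"] by (simp add: sum_distrib_right[symmetric] mult.commute)
  also have "\<dots> \<le> t powr a * (\<theta> ^ Suc m / (\<theta> - 1))"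
    using \<theta> by (intro mult_left_mono divide_right_mono) auto
  also have "\<dots> = \<theta> / (\<theta> - 1) * (2 ^ m * t) powr a"
    unfolding term_eq by (simp add: field_simps)
  also have "\<dots> \<le> \<theta> / (\<theta> - 1) * u powr a"
    using m(1) assms \<theta> by (intro mult_left_mono powr_mono2) auto
  finally show ?thesis by (simp add: \<theta>_def ennreal_leI)
next
  case False
  have "t \<le> 2 ^ k * t" for k using assms(1) by simp
  then have "\<not> 2 ^ k * t < u" for k using False by (meson less_le_trans not_less order_trans)
  then show ?thesis by simp
qed

section \<open>The maximal function on Morrey spaces\<close>

text \<open>Enlarging the constant to at least 1 extends both estimates to r = s, which saves a case
  distinction at every use.\<close>

lemma G_decE:
  assumes "\<phi> \<in> G_dec n"
  obtains C where "1 \<le> C" "\<And>r s. 0 < r \<Longrightarrow> r \<le> s \<Longrightarrow> \<phi> s \<le> C * \<phi> r"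
    "\<And>r s. 0 < r \<Longrightarrow> r \<le> s \<Longrightarrow> \<phi> r * r ^ n \<le> C * (\<phi> s * s ^ n)"
proof -
  have pos: "0 < \<phi> r" if "0 < r" for r using assms that by (auto simp: G_dec_def)
  obtain C where C: "0 < C" "\<And>r s. 0 < r \<Longrightarrow> r < s \<Longrightarrow> \<phi> s \<le> C * \<phi> r"
    "\<And>r s. 0 < r \<Longrightarrow> r < s \<Longrightarrow> \<phi> r * r ^ n \<le> C * (\<phi> s * s ^ n)"
    using assms unfolding G_dec_def by blast
  show ?thesis
  proof (rule that[of "max 1 C"])
    fix r s :: real assume rs: "0 < r" "r \<le> s"
    have "C * \<phi> r \<le> max 1 C * \<phi> r" "1 * \<phi> r \<le> max 1 C * \<phi> r"
      using pos[OF rs(1)] by (intro mult_right_mono; simp)+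
    then show "\<phi> s \<le> max 1 C * \<phi> r"
      using C(2)[of r s] rs by (cases "r = s") auto
    have "0 \<le> \<phi> s * s ^ n" using pos[of s] rs by simp
    then have "C * (\<phi> s * s ^ n) \<le> max 1 C * (\<phi> s * s ^ n)"
      "1 * (\<phi> s * s ^ n) \<le> max 1 C * (\<phi> s * s ^ n)"
      by (intro mult_right_mono; simp)+
    then show "\<phi> r * r ^ n \<le> max 1 C * (\<phi> s * s ^ n)"
      using C(3)[of r s] rs by (cases "r = s") auto
  qed auto
qed

lemma G_dec_pos: "\<phi> \<in> G_dec n \<Longrightarrow> 0 < r \<Longrightarrow> 0 < \<phi> r"
  by (simp add: G_dec_def)

text \<open>For c \<ge> 1 this is almost monotonicity of \<open>\<phi>\<close>; for c < 1 it is
  almost monotonicity of \<open>\<phi> r * r ^ n\<close>, at the price of the factor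
  \<open>c ^ n\<close> in the denominator.\<close>

lemma G_dec_dilate:
  assumes \<phi>: "\<phi> \<in> G_dec n" and c: "0 < c"
  obtains D where "1 \<le> D" "\<And>t. 0 < t \<Longrightarrow> \<phi> (c * t) \<le> D * \<phi> t"
proof -
  obtain C where C: "1 \<le> C" "\<And>r s. 0 < r \<Longrightarrow> r \<le> s \<Longrightarrow> \<phi> s \<le> C * \<phi> r"
    "\<And>r s. 0 < r \<Longrightarrow> r \<le> s \<Longrightarrow> \<phi> r * r ^ n \<le> C * (\<phi> s * s ^ n)"
    using G_decE[OF \<phi>] by blast
  show ?thesis
  proof (cases "1 \<le> c")
    case True
    then have "\<phi> (c * t) \<le> C * \<phi> t" if "0 < t" for t
      using C(2)[of t "c * t"] that by simp
    then show ?thesis by (rule that[OF C(1)])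
  next
    case False
    have "\<phi> (c * t) \<le> C / c ^ n * \<phi> t" if t: "0 < t" for t
    proof -
      have "c * t \<le> t" using False t by simp
      then have "\<phi> (c * t) * (c * t) ^ n \<le> C * (\<phi> t * t ^ n)" using C(3)[of "c * t" t] c t by simp
      then have "(\<phi> (c * t) * c ^ n) * t ^ n \<le> (C * \<phi> t) * t ^ n"
        by (simp add: power_mult_distrib mult_ac)
      then have "\<phi> (c * t) * c ^ n \<le> C * \<phi> t" using t by (simp add: mult_le_cancel_right)
      then show ?thesis using c by (simp add: field_simps)
    qed
    moreover have "1 \<le> C / c ^ n"
      using C(1) c False power_le_one[of c n] by (simp add: field_simps)
    ultimately show ?thesis using that by blast
  qed
qed

text \<open>
  The common consequence of strong and, for \<open>p > 1\<close>, weak Morrey bounds from which everything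
  except the strong type estimate is derived.
\<close>

definition tail_bound ::
  "real \<Rightarrow> (real \<Rightarrow> real) \<Rightarrow> ('a::euclidean_space \<Rightarrow> 'b::real_normed_vector) \<Rightarrow> real \<Rightarrow> bool" where
  "tail_bound p \<phi> f N \<longleftrightarrow> (\<forall>a r t. 0 < r \<longrightarrow> 0 < t \<longrightarrow>
     (\<integral>\<^sup>+y\<in>{y \<in> ball a r. t < norm (f y)}. ennreal (norm (f y)) \<partial>lebesgue)
       \<le> ennreal (N powr p * t powr (1 - p) * \<phi> r) * emeasure lebesgue (ball a r))"

lemma tail_boundD:
  "tail_bound p \<phi> f N \<Longrightarrow> 0 < r \<Longrightarrow> 0 < t \<Longrightarrow>
     (\<integral>\<^sup>+y\<in>{y \<in> ball a r. t < norm (f y)}. ennreal (norm (f y)) \<partial>lebesgue)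
       \<le> ennreal (N powr p * t powr (1 - p) * \<phi> r) * emeasure lebesgue (ball a r)"
  unfolding tail_bound_def by blast

lemma tail_bound_mono:
  assumes "tail_bound p \<phi> f N" "0 \<le> N" "N \<le> N'" "0 < p" and \<phi>: "\<And>r. 0 < r \<Longrightarrow> 0 < \<phi> r"
  shows "tail_bound p \<phi> f N'"
  unfolding tail_bound_def
proof (intro allI impI)
  fix a :: 'a and r t :: real assume rt: "0 < r" "0 < t"
  have "N powr p * t powr (1 - p) * \<phi> r \<le> N' powr p * t powr (1 - p) * \<phi> r"
    using assms \<phi>[OF rt(1)] by (intro mult_right_mono powr_mono2) auto
  then show "(\<integral>\<^sup>+y\<in>{y \<in> ball a r. t < norm (f y)}. ennreal (norm (f y)) \<partial>lebesgue)
      \<le> ennreal (N' powr p * t powr (1 - p) * \<phi> r) * emeasure lebesgue (ball a r)"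
    by (rule order_trans[OF tail_boundD[OF assms(1) rt] mult_right_mono[OF ennreal_leI]]) simp
qed

section \<open>Tail bounds and averages from strong and weak norms\<close>

lemma powr_one_minus: "(0::real) < x \<Longrightarrow> x powr (1 - p) * x powr p = x"
  by (simp flip: powr_add)

text \<open>Where |f| > t one has |f| = |f|^(1-p) |f|^p \<le> t^(1-p) |f|^p, because 1 - p \<le>
  0.\<close>

lemma strong_imp_tail_bound:
  fixes f :: "'a::euclidean_space \<Rightarrow> 'b::{real_normed_vector, second_countable_topology}"
  assumes [measurable]: "f \<in> borel_measurable lebesgue" and p: "1 \<le> p"
    and \<phi>: "\<And>r. 0 < r \<Longrightarrow> 0 < \<phi> r"
    and N: "\<And>a r. 0 < r \<Longrightarrow> (\<integral>\<^sup>+x\<in>ball a r. ennreal (norm (f x) powr p) \<partial>lebesgue)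
       \<le> ennreal (N powr p * \<phi> r) * emeasure lebesgue (ball a r)"
  shows "tail_bound p \<phi> f N"
  unfolding tail_bound_def
proof (intro allI impI)
  fix a :: 'a and r t :: real assume r: "0 < r" and t: "0 < t"
  have "(\<integral>\<^sup>+y\<in>{y \<in> ball a r. t < norm (f y)}. ennreal (norm (f y)) \<partial>lebesgue) \<le>
    (\<integral>\<^sup>+y. ennreal (t powr (1 - p)) * (ennreal (norm (f y) powr p) * indicator (ball a r) y) \<partial>lebesgue)"
  proof (intro nn_integral_mono)
    fix y
    show "ennreal (norm (f y)) * indicator {y \<in> ball a r. t < norm (f y)} y \<le>
      ennreal (t powr (1 - p)) * (ennreal (norm (f y) powr p) * indicator (ball a r) y)"
    proof (cases "y \<in> ball a r \<and> t < norm (f y)")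
      case True
      have "norm (f y) = norm (f y) powr (1 - p) * norm (f y) powr p"
        using True t by (intro powr_one_minus[symmetric]) auto
      also have "\<dots> \<le> t powr (1 - p) * norm (f y) powr p"
        using True t p by (intro mult_right_mono powr_mono2') auto
      finally show ?thesis using True by (simp add: ennreal_mult[symmetric] ennreal_leI)
    qed auto
  qed
  also have "\<dots> = ennreal (t powr (1 - p)) * (\<integral>\<^sup>+y\<in>ball a r. ennreal (norm (f y) powr p) \<partial>lebesgue)"
    by (intro nn_integral_cmult) auto
  also have "\<dots> \<le> ennreal (t powr (1 - p)) * (ennreal (N powr p * \<phi> r) * emeasure lebesgue (ball a r))"
    using r by (intro mult_left_mono N) auto
  also have "\<dots> = ennreal (N powr p * t powr (1 - p) * \<phi> r) * emeasure lebesgue (ball a r)"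
    using \<phi>[OF r] by (simp add: ennreal_mult mult_ac)
  finally show "(\<integral>\<^sup>+y\<in>{y \<in> ball a r. t < norm (f y)}. ennreal (norm (f y)) \<partial>lebesgue)
       \<le> ennreal (N powr p * t powr (1 - p) * \<phi> r) * emeasure lebesgue (ball a r)" .
qed

text \<open>Splitting {|f| > t} at the levels 2^k t, the weak bound makes the k-th piece at most a
  multiple of \<open>\<theta> ^ k\<close> with \<theta> = 2^(1-p), which is summable because p > 1.
  The p-th root in the new bound absorbs the factor 2 / (1 - \<theta>) into N.\<close>

lemma weak_imp_tail_bound:
  fixes f :: "'a::euclidean_space \<Rightarrow> 'b::{real_normed_vector, second_countable_topology}"
  assumes [measurable]: "f \<in> borel_measurable lebesgue" and p: "1 < p" and "0 \<le> N"
    and \<phi>: "\<And>r. 0 < r \<Longrightarrow> 0 < \<phi> r"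
    and N: "\<And>a r t. 0 < r \<Longrightarrow> 0 < t \<Longrightarrow> ennreal (t powr p) * distr_fun (ball a r) f t
       \<le> ennreal (N powr p * \<phi> r) * emeasure lebesgue (ball a r)"
  shows "tail_bound p \<phi> f ((2 / (1 - 2 powr (1 - p))) powr (1 / p) * N)"
  unfolding tail_bound_def
proof (intro allI impI)
  fix a :: 'a and r t :: real assume r: "0 < r" and t: "0 < t"
  let ?B = "ball a r" let ?V = "emeasure lebesgue ?B"
  define \<theta> where "\<theta> = (2::real) powr (1 - p)"
  have \<theta>: "0 < \<theta>" "\<theta> < 1" using p by (auto simp: \<theta>_def powr_less_one)
  \<comment> \<open>The bound on the ball is a finite number, so the dyadic terms become a geometric
    series of reals.\<close>
  obtain W where W: "ennreal (N powr p * \<phi> r) * ?V = ennreal W" "0 \<le> W"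
    using emeasure_lebesgue_ball_finite[of a r]
    by (cases "ennreal (N powr p * \<phi> r) * ?V") (auto simp: ennreal_mult_eq_top_iff)
  have level: "ennreal (2 ^ Suc k * t) * emeasure lebesgue {y \<in> ?B. 2 ^ k * t < norm (f y)}
      \<le> ennreal (2 * t powr (1 - p) * W * \<theta> ^ k)" for k
  proof -
    have s: "0 < 2 ^ k * t" using t by simp
    have "ennreal (2 ^ Suc k * t) * emeasure lebesgue {y \<in> ?B. 2 ^ k * t < norm (f y)} =
      ennreal (2 * (2 ^ k * t) powr (1 - p)) * (ennreal ((2 ^ k * t) powr p) * distr_fun ?B f (2 ^ k * t))"
    proof -
      have "2 ^ Suc k * t = 2 * (2 ^ k * t) powr (1 - p) * (2 ^ k * t) powr p"
        using powr_one_minus[OF s, of p] by (simp add: mult_ac)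
      then show ?thesis unfolding distr_fun_def by (simp only: mult.assoc[symmetric]) (simp add: ennreal_mult)
    qed
    also have "\<dots> \<le> ennreal (2 * (2 ^ k * t) powr (1 - p)) * ennreal W"
      unfolding W(1)[symmetric] by (intro mult_left_mono N r s) auto
    also have "\<dots> = ennreal (2 * (2 ^ k * t) powr (1 - p) * W)"
      using W(2) by (simp add: ennreal_mult)
    also have "(2 ^ k * t) powr (1 - p) = \<theta> ^ k * t powr (1 - p)"
      using t by (simp add: \<theta>_def powr_mult powr_power powr_realpow[symmetric] powr_powr mult.commute)
    finally show ?thesis by (simp add: mult_ac)
  qed
  have "(\<integral>\<^sup>+y\<in>{y \<in> ?B. t < norm (f y)}. ennreal (norm (f y)) \<partial>lebesgue) \<le>
    (\<integral>\<^sup>+y. (\<Sum>k. ennreal (2 ^ Suc k * t) * indicator {y \<in> ?B. 2 ^ k * t < norm (f y)} y) \<partial>lebesgue)"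
  proof (intro nn_integral_mono)
    fix y
    show "ennreal (norm (f y)) * indicator {y \<in> ?B. t < norm (f y)} y \<le>
      (\<Sum>k. ennreal (2 ^ Suc k * t) * indicator {y \<in> ?B. 2 ^ k * t < norm (f y)} y)"
    proof (cases "y \<in> ?B")
      case True
      then have "indicator {y \<in> ?B. s < norm (f y)} y = (if s < norm (f y) then 1 else 0 :: ennreal)" for s
        by (simp add: indicator_def)
      then show ?thesis
        using dyadic_majorant[of t 1 "norm (f y)"] t by simp
    qed simp
  qed
  also have "\<dots> = (\<Sum>k. \<integral>\<^sup>+y. ennreal (2 ^ Suc k * t) * indicator {y \<in> ?B. 2 ^ k * t < norm (f y)} y \<partial>lebesgue)"
    by (intro nn_integral_suminf) measurable
  also have "\<dots> = (\<Sum>k. ennreal (2 ^ Suc k * t) * emeasure lebesgue {y \<in> ?B. 2 ^ k * t < norm (f y)})"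
    by (subst nn_integral_cmult_indicator) measurable
  also have "\<dots> \<le> (\<Sum>k. ennreal (2 * t powr (1 - p) * W * \<theta> ^ k))"
    by (intro suminf_le level summableI)
  also have "\<dots> = ennreal (2 * t powr (1 - p) * W * (1 / (1 - \<theta>)))"
    using \<theta> W(2) by (intro suminf_ennreal_eq sums_mult geometric_sums) auto
  also have "\<dots> = ennreal (2 / (1 - \<theta>) * t powr (1 - p)) * (ennreal (N powr p * \<phi> r) * ?V)"
    unfolding W(1) using W(2) \<theta> by (simp add: ennreal_mult[symmetric])
  also have "\<dots> = ennreal (((2 / (1 - \<theta>)) powr (1 / p) * N) powr p * t powr (1 - p) * \<phi> r) * ?V"
  proof -
    have "((2 / (1 - \<theta>)) powr (1 / p) * N) powr p * t powr (1 - p) * \<phi> r =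
      (2 / (1 - \<theta>) * t powr (1 - p)) * (N powr p * \<phi> r)"
      using \<theta> p \<open>0 \<le> N\<close> by (simp add: powr_mult powr_powr)
    then show ?thesis
      using \<theta> by (subst ennreal_mult_left_assoc) auto
  qed
  finally show "(\<integral>\<^sup>+y\<in>{y \<in> ?B. t < norm (f y)}. ennreal (norm (f y)) \<partial>lebesgue) \<le>
    ennreal (((2 / (1 - 2 powr (1 - p))) powr (1 / p) * N) powr p * t powr (1 - p) * \<phi> r) * ?V"
    unfolding \<theta>_def .
qed

lemma tail_bound_average:
  fixes f :: "'a::euclidean_space \<Rightarrow> 'b::{real_normed_vector, second_countable_topology}"
  assumes [measurable]: "f \<in> borel_measurable lebesgue" and p: "1 \<le> p" and N: "0 < N"
    and \<phi>: "\<And>r. 0 < r \<Longrightarrow> 0 < \<phi> r"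
    and tail: "tail_bound p \<phi> f N" and r: "0 < r"
  shows "(\<integral>\<^sup>+y\<in>ball a r. ennreal (norm (f y)) \<partial>lebesgue)
    \<le> ennreal (2 * N * \<phi> r powr (1 / p)) * emeasure lebesgue (ball a r)"
proof -
  let ?B = "ball a r" let ?V = "emeasure lebesgue ?B"
  define l where "l = N * \<phi> r powr (1 / p)"
  have l: "0 < l" using N \<phi>[OF r] by (simp add: l_def)
  have lp: "l powr p = N powr p * \<phi> r"
    using N \<phi>[OF r] p by (simp add: l_def powr_mult powr_powr)
  have "(\<integral>\<^sup>+y\<in>?B. ennreal (norm (f y)) \<partial>lebesgue) \<le>
    (\<integral>\<^sup>+y. ennreal l * indicator ?B y + ennreal (norm (f y)) * indicator {y \<in> ?B. l < norm (f y)} y \<partial>lebesgue)"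
    by (intro nn_integral_mono) (auto simp: indicator_def not_less intro: ennreal_leI)
  also have "\<dots> = ennreal l * ?V + (\<integral>\<^sup>+y\<in>{y \<in> ?B. l < norm (f y)}. ennreal (norm (f y)) \<partial>lebesgue)"
    by (subst nn_integral_add) (measurable, simp add: nn_integral_cmult_indicator del: emeasure_completion)
  also have "\<dots> \<le> ennreal l * ?V + ennreal (N powr p * l powr (1 - p) * \<phi> r) * ?V"
    using r l by (intro add_left_mono tail_boundD[OF tail])
  also have "N powr p * l powr (1 - p) * \<phi> r = l powr (1 - p) * l powr p"
    unfolding lp by simp
  also have "\<dots> = l" using l by (rule powr_one_minus)
  also have "ennreal l * ?V + ennreal l * ?V = ennreal (2 * l) * ?V"
    using l by (simp add: distrib_right[symmetric] ennreal_plus[symmetric] del: ennreal_plus)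
  finally show ?thesis by (simp add: l_def mult_ac)
qed

text \<open>Supplies the hypothesis on large balls in \<open>local_maximal_bound\<close>. Balls of
  radius s > r/2 have \<phi>(s) \<le> C \<phi>(r/2) \<le> C D \<phi>(r), so one level proportional
  to \<phi>(r)^(1/p) serves for all of them.\<close>

lemma large_ball_average:
  assumes \<phi>: "\<phi> \<in> G_dec DIM('a::euclidean_space)" and p: "1 \<le> p"
  shows "\<exists>A>0. \<forall>(f :: 'a \<Rightarrow> 'b::{real_normed_vector, second_countable_topology}) N b r s.
      f \<in> borel_measurable lebesgue \<longrightarrow> 0 < N \<longrightarrow> tail_bound p \<phi> f N \<longrightarrow> 0 < r \<longrightarrow> r / 2 < s \<longrightarrow>
      (\<integral>\<^sup>+y\<in>ball b s. ennreal (norm (f y)) \<partial>lebesgue) \<le>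
        ennreal (A * N * \<phi> r powr (1 / p)) * emeasure lebesgue (ball b s)"
proof -
  obtain C where C: "1 \<le> C" "\<And>r s. 0 < r \<Longrightarrow> r \<le> s \<Longrightarrow> \<phi> s \<le> C * \<phi> r"
    "\<And>r s. 0 < r \<Longrightarrow> r \<le> s \<Longrightarrow> \<phi> r * r ^ DIM('a) \<le> C * (\<phi> s * s ^ DIM('a))"
    using G_decE[OF \<phi>] by blast
  have half: "0 < (1 / 2 :: real)" by simp
  obtain D where D: "1 \<le> D" "\<And>t. 0 < t \<Longrightarrow> \<phi> (1 / 2 * t) \<le> D * \<phi> t"
    using G_dec_dilate[OF \<phi> half] by blast
  have pos: "0 < \<phi> r" if "0 < r" for r using \<phi> that by (rule G_dec_pos)
  show ?thesis
  proof (intro exI[of _ "2 * (C * D) powr (1 / p)"] conjI allI impI)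
    fix f :: "'a \<Rightarrow> 'b" and N r s :: real and b :: 'a
    assume f: "f \<in> borel_measurable lebesgue" "0 < N" "tail_bound p \<phi> f N" and r: "0 < r" "r / 2 < s"
    have s: "0 < s" using r by simp
    have "\<phi> s \<le> C * \<phi> (1 / 2 * r)" using C(2)[of "1 / 2 * r" s] r by simp
    also have "\<dots> \<le> C * (D * \<phi> r)" using C(1) D(2)[OF r(1)] by (intro mult_left_mono) auto
    finally have "\<phi> s powr (1 / p) \<le> (C * D * \<phi> r) powr (1 / p)"
      using pos[OF s] p by (intro powr_mono2) auto
    then have "2 * N * \<phi> s powr (1 / p) \<le> 2 * N * ((C * D) powr (1 / p) * \<phi> r powr (1 / p))"
      using f(2) C(1) D(1) pos[OF r(1)] by (intro mult_left_mono) (auto simp: powr_mult)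
    also have "\<dots> = 2 * (C * D) powr (1 / p) * N * \<phi> r powr (1 / p)"
      by simp
    finally have "ennreal (2 * N * \<phi> s powr (1 / p)) * emeasure lebesgue (ball b s) \<le>
        ennreal (2 * (C * D) powr (1 / p) * N * \<phi> r powr (1 / p)) * emeasure lebesgue (ball b s)"
      by (intro mult_right_mono ennreal_leI) auto
    moreover have "(\<integral>\<^sup>+y\<in>ball b s. ennreal (norm (f y)) \<partial>lebesgue)
        \<le> ennreal (2 * N * \<phi> s powr (1 / p)) * emeasure lebesgue (ball b s)"
      using f(1) p f(2) pos f(3) s by (rule tail_bound_average)
    ultimately show "(\<integral>\<^sup>+y\<in>ball b s. ennreal (norm (f y)) \<partial>lebesgue) \<le>
        ennreal (2 * (C * D) powr (1 / p) * N * \<phi> r powr (1 / p)) * emeasure lebesgue (ball b s)"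
      by (rule order_trans[rotated])
  qed (use C(1) D(1) in auto)
qed

section \<open>Maximal inequalities on Morrey spaces\<close>

lemma emeasure_lebesgue_ball_double:
  "0 \<le> r \<Longrightarrow> emeasure lebesgue (ball (a::'a::euclidean_space) (2 * r)) =
    ennreal (2 ^ DIM('a)) * emeasure lebesgue (ball a r)"
  by (simp add: emeasure_ball ennreal_mult[symmetric] power_mult_distrib mult_ac)

text \<open>Up to the level L of \<open>large_ball_average\<close> the trivial estimate by the whole
  ball suffices, as L^p is a multiple of N^p \<phi>(r). Above L the local bound reduces the claim to
  the tail of f at height t/2 on the doubled ball.\<close>

lemma weak_maximal_bound:
  assumes \<phi>: "\<phi> \<in> G_dec DIM('a::euclidean_space)" and p: "1 \<le> p"
  shows "\<exists>K>0. \<forall>(f :: 'a \<Rightarrow> 'b::{real_normed_vector, second_countable_topology}) N a r t.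
      f \<in> borel_measurable lebesgue \<longrightarrow> 0 < N \<longrightarrow> tail_bound p \<phi> f N \<longrightarrow> 0 < r \<longrightarrow> 0 < t \<longrightarrow>
      ennreal (t powr p) * emeasure lebesgue {x \<in> ball a r. ennreal t < maximal_fun f x} \<le>
        ennreal (K * N powr p * \<phi> r) * emeasure lebesgue (ball a r)"
proof -
  obtain C where C: "1 \<le> C" "\<And>r s. 0 < r \<Longrightarrow> r \<le> s \<Longrightarrow> \<phi> s \<le> C * \<phi> r"
    "\<And>r s. 0 < r \<Longrightarrow> r \<le> s \<Longrightarrow> \<phi> r * r ^ DIM('a) \<le> C * (\<phi> s * s ^ DIM('a))"
    using G_decE[OF \<phi>] by blast
  have pos: "0 < \<phi> r" if "0 < r" for r using \<phi> that by (rule G_dec_pos)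
  obtain A where A: "0 < A"
    "\<forall>(f :: 'a \<Rightarrow> 'b) N b r s.
      f \<in> borel_measurable lebesgue \<longrightarrow> 0 < N \<longrightarrow> tail_bound p \<phi> f N \<longrightarrow> 0 < r \<longrightarrow> r / 2 < s \<longrightarrow>
      (\<integral>\<^sup>+y\<in>ball b s. ennreal (norm (f y)) \<partial>lebesgue) \<le>
        ennreal (A * N * \<phi> r powr (1 / p)) * emeasure lebesgue (ball b s)"
    using large_ball_average[OF \<phi> p, where 'b = 'b] by (elim exE conjE)
  let ?n = "DIM('a)"
  \<comment> \<open>\<open>5 ^ n\<close> comes from the covering; \<open>2 powr p\<close> is t^p
    (2/t) (t/2)^(1-p); \<open>2 ^ n\<close> and C come from comparing the volume and
    \<open>\<phi>\<close> at the radii 2r and r.\<close>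
  define K1 where "K1 = 5 ^ ?n * 2 powr p * 2 ^ ?n * C"
  show ?thesis
  proof (intro exI[of _ "A powr p + K1"] conjI allI impI)
    fix f :: "'a \<Rightarrow> 'b" and N r t :: real and a :: 'a
    assume f: "f \<in> borel_measurable lebesgue" and N: "0 < N" and tail: "tail_bound p \<phi> f N"
      and r: "0 < r" and t: "0 < t"
    let ?V = "emeasure lebesgue (ball a r)"
    let ?E = "{x \<in> ball a r. ennreal t < maximal_fun f x}"
    define L where "L = A * N * \<phi> r powr (1 / p)"
    have K: "0 \<le> A powr p" "0 \<le> K1" using C by (auto simp: K1_def)
    have "ennreal (t powr p) * emeasure lebesgue ?E \<le> ennreal (A powr p * N powr p * \<phi> r) * ?V \<or>
      ennreal (t powr p) * emeasure lebesgue ?E \<le> ennreal (K1 * N powr p * \<phi> r) * ?V"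
    proof (cases "t \<le> L")
      case True
      have "L powr p = A powr p * N powr p * \<phi> r"
        using A(1) N pos[OF r] p by (simp add: L_def powr_mult powr_powr)
      moreover have "t powr p \<le> L powr p"
        using True t p by (intro powr_mono2) auto
      moreover have "emeasure lebesgue ?E \<le> ?V"
        by (intro emeasure_mono) auto
      ultimately show ?thesis
        by (intro disjI1 mult_mono) (auto intro: ennreal_leI)
    next
      case False
      have "emeasure lebesgue ?E \<le> ennreal (2 * 5 ^ ?n / t) *
        (\<integral>\<^sup>+y\<in>{y \<in> ball a (2 * r). t / 2 < norm (f y)}. ennreal (norm (f y)) \<partial>lebesgue)"
      proof (rule local_maximal_bound[OF f])
        show "(\<integral>\<^sup>+y\<in>ball b s. ennreal (norm (f y)) \<partial>lebesgue) \<le> ennreal L * emeasure lebesgue (ball b s)"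
          if "r / 2 < s" for b s
          unfolding L_def using A(2)[rule_format, OF f N tail r that] .
      qed (use False t in auto)
      also have "\<dots> \<le> ennreal (2 * 5 ^ ?n / t) *
        (ennreal (N powr p * (t / 2) powr (1 - p) * \<phi> (2 * r)) * emeasure lebesgue (ball a (2 * r)))"
        using r t by (intro mult_left_mono tail_boundD[OF tail]) auto
      also have "\<dots> = ennreal (2 * 5 ^ ?n / t * (N powr p * (t / 2) powr (1 - p) * \<phi> (2 * r)) * 2 ^ ?n) * ?V"
        unfolding emeasure_lebesgue_ball_double[OF less_imp_le[OF r]]
        using t pos[of "2 * r"] r by (subst ennreal_mult_left_assoc, simp)+ (simp add: mult_ac)
      finally have "ennreal (t powr p) * emeasure lebesgue ?E \<le> ennreal (t powr p) *
        (ennreal (2 * 5 ^ ?n / t * (N powr p * (t / 2) powr (1 - p) * \<phi> (2 * r)) * 2 ^ ?n) * ?V)"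
        by (intro mult_left_mono) auto
      also have "\<dots> = ennreal (t powr p *
        (2 * 5 ^ ?n / t * (N powr p * (t / 2) powr (1 - p) * \<phi> (2 * r)) * 2 ^ ?n)) * ?V"
        by (rule ennreal_mult_left_assoc) simp
      also have "t powr p * (2 * 5 ^ ?n / t * (N powr p * (t / 2) powr (1 - p) * \<phi> (2 * r)) * 2 ^ ?n) =
          5 ^ ?n * 2 powr p * 2 ^ ?n * \<phi> (2 * r) * N powr p"
      proof -
        have "(t / 2) powr (1 - p) * (t powr p * (2 / t)) = 2 powr p"
          using t by (simp add: powr_divide powr_diff field_simps)
        moreover have "t powr p * (2 * 5 ^ ?n / t * (N powr p * (t / 2) powr (1 - p) * \<phi> (2 * r)) * 2 ^ ?n) =
            ((t / 2) powr (1 - p) * (t powr p * (2 / t))) * (5 ^ ?n * 2 ^ ?n * \<phi> (2 * r) * N powr p)"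
          by (simp add: mult_ac)
        ultimately show ?thesis by simp
      qed
      also have "\<dots> \<le> 5 ^ ?n * 2 powr p * 2 ^ ?n * (C * \<phi> r) * N powr p"
        using C(2)[of r "2 * r"] r by (intro mult_right_mono mult_left_mono) auto
      also have "\<dots> = K1 * N powr p * \<phi> r" by (simp add: K1_def)
      finally show ?thesis
        by (intro disjI2) (auto simp: ennreal_leI mult_right_mono)
    qed
    moreover have "A powr p * N powr p * \<phi> r \<le> (A powr p + K1) * N powr p * \<phi> r"
      "K1 * N powr p * \<phi> r \<le> (A powr p + K1) * N powr p * \<phi> r"
      using K pos[OF r] by (auto intro!: mult_right_mono)
    ultimately show "ennreal (t powr p) * emeasure lebesgue ?E \<le> ennreal ((A powr p + K1) * N powr p * \<phi> r) * ?V"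
      by (meson ennreal_leI mult_right_mono order_trans zero_le)
  qed (use A(1) C in \<open>auto simp: K1_def intro!: add_pos_nonneg\<close>)
qed

text \<open>A Marcinkiewicz-type argument: the local bound is applied at every level 2^k L, and the
  sum over k is moved under the integral of |f|, where it produces the missing factor |f|^(p-1). The
  real function g below the maximal function avoids powers of a possibly infinite quantity; in the
  application it is a power of the fractional integral.\<close>

lemma strong_maximal_bound:
  assumes \<phi>: "\<phi> \<in> G_dec DIM('a::euclidean_space)" and p: "1 < p"
  shows "\<exists>K>0. \<forall>(f :: 'a \<Rightarrow> 'b::{real_normed_vector, second_countable_topology}) g N a r.
      f \<in> borel_measurable lebesgue \<longrightarrow> 0 < N \<longrightarrow>
      (\<forall>a r. 0 < r \<longrightarrow> (\<integral>\<^sup>+x\<in>ball a r. ennreal (norm (f x) powr p) \<partial>lebesgue)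
        \<le> ennreal (N powr p * \<phi> r) * emeasure lebesgue (ball a r)) \<longrightarrow>
      g \<in> borel_measurable lebesgue \<longrightarrow> (\<forall>x. 0 \<le> g x) \<longrightarrow> (\<forall>x. ennreal (g x) \<le> maximal_fun f x) \<longrightarrow>
      0 < r \<longrightarrow>
      (\<integral>\<^sup>+x\<in>ball a r. ennreal (g x powr p) \<partial>lebesgue) \<le>
        ennreal (K * N powr p * \<phi> r) * emeasure lebesgue (ball a r)"
proof -
  have p1: "1 \<le> p" using p by simp
  obtain C where C: "1 \<le> C" "\<And>r s. 0 < r \<Longrightarrow> r \<le> s \<Longrightarrow> \<phi> s \<le> C * \<phi> r"
    "\<And>r s. 0 < r \<Longrightarrow> r \<le> s \<Longrightarrow> \<phi> r * r ^ DIM('a) \<le> C * (\<phi> s * s ^ DIM('a))"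
    using G_decE[OF \<phi>] by blast
  have pos: "0 < \<phi> r" if "0 < r" for r using \<phi> that by (rule G_dec_pos)
  obtain A where A: "0 < A"
    "\<forall>(f :: 'a \<Rightarrow> 'b) N b r s.
      f \<in> borel_measurable lebesgue \<longrightarrow> 0 < N \<longrightarrow> tail_bound p \<phi> f N \<longrightarrow> 0 < r \<longrightarrow> r / 2 < s \<longrightarrow>
      (\<integral>\<^sup>+y\<in>ball b s. ennreal (norm (f y)) \<partial>lebesgue) \<le>
        ennreal (A * N * \<phi> r powr (1 / p)) * emeasure lebesgue (ball b s)"
    using large_ball_average[OF \<phi> p1, where 'b = 'b] by (elim exE conjE)
  let ?n = "DIM('a)"
  \<comment> \<open>The constant of \<open>dyadic_geometric\<close> for the exponent p - 1; it is
    positive because p > 1.\<close>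
  define G where "G = 2 powr (p - 1) / (2 powr (p - 1) - 1)"
  have G: "0 < G" using p by (simp add: G_def)
  define K1 where "K1 = 2 * 5 ^ ?n * 2 powr p * G * 2 powr (p - 1) * C * 2 ^ ?n"
  have K1: "0 < K1" using G C(1) by (simp add: K1_def)
  show ?thesis
  proof (intro exI[of _ "A powr p + K1"] conjI allI impI)
    fix f :: "'a \<Rightarrow> 'b" and g :: "'a \<Rightarrow> real" and N r :: real and a :: 'a
    assume f[measurable]: "f \<in> borel_measurable lebesgue" and N: "0 < N"
      and strong': "\<forall>a r. 0 < r \<longrightarrow> (\<integral>\<^sup>+x\<in>ball a r. ennreal (norm (f x) powr p) \<partial>lebesgue)
        \<le> ennreal (N powr p * \<phi> r) * emeasure lebesgue (ball a r)"
      and g[measurable]: "g \<in> borel_measurable lebesgue"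
      and g0': "\<forall>x. 0 \<le> g x" and gM': "\<forall>x. ennreal (g x) \<le> maximal_fun f x" and r: "0 < r"
    note strong = strong'[rule_format] and g0 = g0'[rule_format] and gM = gM'[rule_format]
    have tail: "tail_bound p \<phi> f N" using f p1 pos strong by (rule strong_imp_tail_bound)
    let ?V = "emeasure lebesgue (ball a r)"
    define L where "L = A * N * \<phi> r powr (1 / p)"
    have L: "0 < L" using A(1) N pos[OF r] by (simp add: L_def)
    have Lp: "L powr p = A powr p * N powr p * \<phi> r"
      using A(1) N pos[OF r] p by (simp add: L_def powr_mult powr_powr)
    \<comment> \<open>The level t = 2^k L is at least L, as the local bound requires. The weight
      (2t)^p, the upper end of the dyadic interval, and the factor 1/t together leave t^(p-1).
      Writing t/2 < |f| as t < 2|f| prepares \<open>dyadic_geometric\<close> with u = 2|f|.\<close>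
    have level: "ennreal ((2 ^ Suc k * L) powr p) * emeasure lebesgue {x \<in> ball a r. 2 ^ k * L < g x} \<le>
      ennreal (2 * 5 ^ ?n * 2 powr p) * (\<integral>\<^sup>+y\<in>ball a (2 * r). ennreal (norm (f y)) *
        (ennreal ((2 ^ k * L) powr (p - 1)) * (if 2 ^ k * L < 2 * norm (f y) then 1 else 0)) \<partial>lebesgue)" for k
    proof -
      define t where "t = 2 ^ k * L"
      have t: "0 < t" "L \<le> t" using L by (auto simp: t_def)
      have "emeasure lebesgue {x \<in> ball a r. t < g x} \<le> emeasure lebesgue {x \<in> ball a r. ennreal t < maximal_fun f x}"
      proof (rule emeasure_mono)
        show "{x \<in> ball a r. t < g x} \<subseteq> {x \<in> ball a r. ennreal t < maximal_fun f x}"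
        proof safe
          fix x assume "t < g x"
          then have "ennreal t < ennreal (g x)" using t(1) by (intro ennreal_lessI) auto
          then show "ennreal t < maximal_fun f x" using gM[of x] by (rule less_le_trans)
        qed
        note [measurable] = lebesgue_measurable_maximal_fun
        show "{x \<in> ball a r. ennreal t < maximal_fun f x} \<in> sets lebesgue" by measurable
      qed
      also have "\<dots> \<le> ennreal (2 * 5 ^ ?n / t) *
        (\<integral>\<^sup>+y\<in>{y \<in> ball a (2 * r). t / 2 < norm (f y)}. ennreal (norm (f y)) \<partial>lebesgue)"
      proof (rule local_maximal_bound[OF f])
        show "(\<integral>\<^sup>+y\<in>ball b s. ennreal (norm (f y)) \<partial>lebesgue) \<le> ennreal L * emeasure lebesgue (ball b s)"
          if "r / 2 < s" for b s
          unfolding L_def using A(2)[rule_format, OF f N tail r that] .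
      qed (use t in auto)
      finally have "ennreal ((2 * t) powr p) * emeasure lebesgue {x \<in> ball a r. t < g x} \<le> ennreal ((2 * t) powr p) *
        (ennreal (2 * 5 ^ ?n / t) *
        (\<integral>\<^sup>+y\<in>{y \<in> ball a (2 * r). t / 2 < norm (f y)}. ennreal (norm (f y)) \<partial>lebesgue))"
        by (intro mult_left_mono) auto
      also have "\<dots> = ennreal ((2 * t) powr p * (2 * 5 ^ ?n / t)) *
        (\<integral>\<^sup>+y\<in>{y \<in> ball a (2 * r). t / 2 < norm (f y)}. ennreal (norm (f y)) \<partial>lebesgue)"
        by (rule ennreal_mult_left_assoc) simp
      also have "(2 * t) powr p * (2 * 5 ^ ?n / t) = 2 * 5 ^ ?n * 2 powr p * t powr (p - 1)"
        using t by (simp add: powr_mult powr_diff)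
      also have "ennreal (2 * 5 ^ ?n * 2 powr p * t powr (p - 1)) *
        (\<integral>\<^sup>+y\<in>{y \<in> ball a (2 * r). t / 2 < norm (f y)}. ennreal (norm (f y)) \<partial>lebesgue) =
        ennreal (2 * 5 ^ ?n * 2 powr p) * (\<integral>\<^sup>+y. ennreal (t powr (p - 1)) *
          (ennreal (norm (f y)) * indicator {y \<in> ball a (2 * r). t / 2 < norm (f y)} y) \<partial>lebesgue)"
        by (subst nn_integral_cmult) (measurable, simp add: ennreal_mult mult.assoc)
      also have "\<dots> = ennreal (2 * 5 ^ ?n * 2 powr p) * (\<integral>\<^sup>+y\<in>ball a (2 * r). ennreal (norm (f y)) *
        (ennreal (t powr (p - 1)) * (if t < 2 * norm (f y) then 1 else 0)) \<partial>lebesgue)"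
        by (rule arg_cong[where f = "(*) (ennreal (2 * 5 ^ ?n * 2 powr p))"], rule nn_integral_cong)
          (auto simp: indicator_def mult_ac)
      finally show ?thesis by (simp add: t_def mult.assoc)
    qed
    have "(\<integral>\<^sup>+x\<in>ball a r. ennreal (g x powr p) \<partial>lebesgue) \<le>
      (\<integral>\<^sup>+x. ennreal (L powr p) * indicator (ball a r) x +
        (\<Sum>k. ennreal ((2 ^ Suc k * L) powr p) * indicator {x \<in> ball a r. 2 ^ k * L < g x} x) \<partial>lebesgue)"
    proof (intro nn_integral_mono)
      fix x
      show "ennreal (g x powr p) * indicator (ball a r) x \<le> ennreal (L powr p) * indicator (ball a r) x +
        (\<Sum>k. ennreal ((2 ^ Suc k * L) powr p) * indicator {x \<in> ball a r. 2 ^ k * L < g x} x)"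
      proof (cases "x \<in> ball a r")
        case True
        then have ind: "indicator {x \<in> ball a r. s < g x} x = (if s < g x then 1 else 0 :: ennreal)" for s
          by (simp add: indicator_def)
        show ?thesis
        proof (cases "L < g x")
          case True
          then have "ennreal (g x powr p) \<le>
              (\<Sum>k. ennreal ((2 ^ Suc k * L) powr p) * indicator {x \<in> ball a r. 2 ^ k * L < g x} x)"
            using dyadic_majorant[of L p "g x"] L p g0[of x] ind by simp
          then show ?thesis using \<open>x \<in> ball a r\<close> by (simp add: add_increasing del: mem_ball)
        next
          case False
          then have "ennreal (g x powr p) \<le> ennreal (L powr p)"
            using g0[of x] p by (intro ennreal_leI powr_mono2) auto
          then show ?thesis using \<open>x \<in> ball a r\<close> by (simp add: add_increasing2 del: mem_ball)
        qed
      qed simp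
    qed
    also have "\<dots> = ennreal (L powr p) * ?V +
        (\<Sum>k. ennreal ((2 ^ Suc k * L) powr p) * emeasure lebesgue {x \<in> ball a r. 2 ^ k * L < g x})"
    proof -
      let ?h = "\<lambda>k x. ennreal ((2 ^ Suc k * L) powr p) * indicator {x \<in> ball a r. 2 ^ k * L < g x} x"
      have lev: "{x \<in> ball a r. 2 ^ k * L < g x} \<in> sets lebesgue" for k
        by measurable
      then have m: "?h k \<in> borel_measurable lebesgue" for k
        by (intro borel_measurable_times_ennreal borel_measurable_indicator) auto
      have "(\<integral>\<^sup>+x. ennreal (L powr p) * indicator (ball a r) x + (\<Sum>k. ?h k x) \<partial>lebesgue) =
          (\<integral>\<^sup>+x. ennreal (L powr p) * indicator (ball a r) x \<partial>lebesgue) + (\<integral>\<^sup>+x. (\<Sum>k. ?h k x) \<partial>lebesgue)"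
        by (rule nn_integral_add) (simp, rule borel_measurable_suminf_order, rule m)
      also have "(\<integral>\<^sup>+x. (\<Sum>k. ?h k x) \<partial>lebesgue) = (\<Sum>k. \<integral>\<^sup>+x. ?h k x \<partial>lebesgue)"
        using m by (rule nn_integral_suminf)
      also have "(\<Sum>k. \<integral>\<^sup>+x. ?h k x \<partial>lebesgue) =
          (\<Sum>k. ennreal ((2 ^ Suc k * L) powr p) * emeasure lebesgue {x \<in> ball a r. 2 ^ k * L < g x})"
        by (intro suminf_cong nn_integral_cmult_indicator lev)
      also have "(\<integral>\<^sup>+x. ennreal (L powr p) * indicator (ball a r) x \<partial>lebesgue) = ennreal (L powr p) * ?V"
        by (rule nn_integral_cmult_indicator) simp
      finally show ?thesis .
    qed
    also have "\<dots> \<le> ennreal (L powr p) * ?V + (\<Sum>k. ennreal (2 * 5 ^ ?n * 2 powr p) *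
        (\<integral>\<^sup>+y\<in>ball a (2 * r). ennreal (norm (f y)) *
        (ennreal ((2 ^ k * L) powr (p - 1)) * (if 2 ^ k * L < 2 * norm (f y) then 1 else 0)) \<partial>lebesgue))"
      by (intro add_left_mono suminf_le level summableI)
    also have "(\<Sum>k. ennreal (2 * 5 ^ ?n * 2 powr p) *
        (\<integral>\<^sup>+y\<in>ball a (2 * r). ennreal (norm (f y)) *
        (ennreal ((2 ^ k * L) powr (p - 1)) * (if 2 ^ k * L < 2 * norm (f y) then 1 else 0)) \<partial>lebesgue)) =
      ennreal (2 * 5 ^ ?n * 2 powr p) * (\<integral>\<^sup>+y. (\<Sum>k. ennreal (norm (f y)) *
        (ennreal ((2 ^ k * L) powr (p - 1)) * (if 2 ^ k * L < 2 * norm (f y) then 1 else 0)) *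
        indicator (ball a (2 * r)) y) \<partial>lebesgue)"
    proof -
      have "(\<lambda>y. ennreal (norm (f y)) *
        (ennreal ((2 ^ k * L) powr (p - 1)) * (if 2 ^ k * L < 2 * norm (f y) then 1 else 0)) *
        indicator (ball a (2 * r)) y) \<in> borel_measurable lebesgue" for k
        by measurable
      from nn_integral_suminf[OF this] show ?thesis by (simp only: ennreal_suminf_cmult)
    qed
    also have "\<dots> \<le> ennreal (2 * 5 ^ ?n * 2 powr p) *
        (\<integral>\<^sup>+y. ennreal (G * 2 powr (p - 1)) * (ennreal (norm (f y) powr p) * indicator (ball a (2 * r)) y) \<partial>lebesgue)"
    proof (intro mult_left_mono nn_integral_mono)
      fix y
      have "(\<Sum>k. ennreal (norm (f y)) *
        (ennreal ((2 ^ k * L) powr (p - 1)) * (if 2 ^ k * L < 2 * norm (f y) then 1 else 0)) *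
        indicator (ball a (2 * r)) y) = ennreal (norm (f y)) *
        (\<Sum>k. ennreal ((2 ^ k * L) powr (p - 1)) * (if 2 ^ k * L < 2 * norm (f y) then 1 else 0)) *
        indicator (ball a (2 * r)) y"
        by (simp only: ennreal_suminf_cmult ennreal_suminf_multc)
      also have "\<dots> \<le> ennreal (norm (f y)) * ennreal (G * (2 * norm (f y)) powr (p - 1)) *
          indicator (ball a (2 * r)) y"
        unfolding G_def using L p by (intro mult_right_mono mult_left_mono dyadic_geometric) auto
      also have "ennreal (norm (f y)) * ennreal (G * (2 * norm (f y)) powr (p - 1)) =
          ennreal (G * 2 powr (p - 1)) * ennreal (norm (f y) powr p)"
      proof -
        have "norm (f y) * norm (f y) powr (p - 1) = norm (f y) powr p"
          by (cases "f y = 0") (auto simp: powr_diff)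
        then have "norm (f y) * (G * (2 * norm (f y)) powr (p - 1)) =
          G * 2 powr (p - 1) * norm (f y) powr p"
          by (simp add: powr_mult mult_ac)
        then show ?thesis using G by (simp add: ennreal_mult[symmetric])
      qed
      finally show "(\<Sum>k. ennreal (norm (f y)) *
        (ennreal ((2 ^ k * L) powr (p - 1)) * (if 2 ^ k * L < 2 * norm (f y) then 1 else 0)) *
        indicator (ball a (2 * r)) y) \<le>
        ennreal (G * 2 powr (p - 1)) * (ennreal (norm (f y) powr p) * indicator (ball a (2 * r)) y)"
        by (simp add: mult.assoc)
    qed auto
    also have "\<dots> = ennreal (2 * 5 ^ ?n * 2 powr p) * (ennreal (G * 2 powr (p - 1)) *
        (\<integral>\<^sup>+y\<in>ball a (2 * r). ennreal (norm (f y) powr p) \<partial>lebesgue))"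
      by (rule arg_cong[where f = "(*) (ennreal (2 * 5 ^ ?n * 2 powr p))"], rule nn_integral_cmult) measurable
    also have "\<dots> \<le> ennreal (2 * 5 ^ ?n * 2 powr p) * (ennreal (G * 2 powr (p - 1)) *
        (ennreal (N powr p * \<phi> (2 * r)) * emeasure lebesgue (ball a (2 * r))))"
      using r by (intro mult_left_mono strong) auto
    also have "\<dots> \<le> ennreal (2 * 5 ^ ?n * 2 powr p) * (ennreal (G * 2 powr (p - 1)) *
        (ennreal (N powr p * (C * \<phi> r)) * emeasure lebesgue (ball a (2 * r))))"
      using r C(2)[of r "2 * r"] by (intro mult_left_mono mult_right_mono ennreal_leI) auto
    also have "\<dots> = ennreal (K1 * N powr p * \<phi> r) * ?V"
    proof -
      have "K1 * N powr p * \<phi> r = (2 * 5 ^ ?n * 2 powr p) * ((G * 2 powr (p - 1)) * ((N powr p * (C * \<phi> r)) * 2 ^ ?n))"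
        by (simp add: K1_def mult_ac)
      moreover have "0 \<le> (2 * 5 ^ ?n * 2 powr p :: real)" "0 \<le> G * 2 powr (p - 1)" "0 \<le> N powr p * (C * \<phi> r)"
        using G C(1) pos[OF r] by auto
      ultimately show ?thesis
        unfolding emeasure_lebesgue_ball_double[OF less_imp_le[OF r]]
        by (simp only: ennreal_mult_left_assoc)
    qed
    also have "ennreal (L powr p) * ?V + ennreal (K1 * N powr p * \<phi> r) * ?V =
      ennreal ((A powr p + K1) * N powr p * \<phi> r) * ?V"
      unfolding Lp using K1 pos[OF r]
      by (simp add: distrib_right[symmetric] ennreal_plus[symmetric] del: ennreal_plus emeasure_completion)
    finally show "(\<integral>\<^sup>+x\<in>ball a r. ennreal (g x powr p) \<partial>lebesgue) \<le>
      ennreal ((A powr p + K1) * N powr p * \<phi> r) * ?V"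
      by (simp add: add_left_mono)
  qed (use A(1) K1 in \<open>auto intro!: add_nonneg_pos\<close>)
qed

section \<open>Hedberg's inequality\<close>

text \<open>Nothing is known about g at nonpositive arguments; the indicator erases those
  values.\<close>

lemma borel_measurable_indicator_Ioi:
  fixes g :: "real \<Rightarrow> real"
  assumes g: "g \<in> borel_measurable (lebesgue_on {0<..})" and S: "S \<in> sets lebesgue" "S \<subseteq> {0<..}"
  shows "(\<lambda>t. ennreal (g t) * indicator S t) \<in> borel_measurable lebesgue"
proof -
  have [measurable]: "(\<lambda>t. if t \<in> {0<..} then g t else 0) \<in> borel_measurable lebesgue"
    using g by (subst borel_measurable_if) auto
  have "(\<lambda>t. ennreal (if t \<in> {0<..} then g t else 0) * indicator S t) \<in> borel_measurable lebesgue"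
    using S(1) by measurable
  also have "(\<lambda>t. ennreal (if t \<in> {0<..} then g t else 0) * indicator S t) = (\<lambda>t. ennreal (g t) * indicator S t)"
    using S(2) by (auto simp: indicator_def fun_eq_iff)
  finally show ?thesis .
qed

lemma borel_measurable_lebesgue_on_ident:
  "(\<lambda>t. t) \<in> borel_measurable (lebesgue_on (S :: real set))"
  by (intro measurable_restrict_space1 measurable_completion) simp

lemma norm_frac_integrand:
  assumes "\<And>t. 0 < t \<Longrightarrow> 0 < \<rho> t" "x \<noteq> y"
  shows "ennreal (norm (frac_integrand \<rho> f x y)) =
    ennreal (\<rho> (norm (x - y)) / norm (x - y) ^ DIM('a)) * ennreal (norm (f (y::'a::euclidean_space)))"
proof -
  have "0 < norm (x - y)" using assms(2) by simp
  from assms(1)[OF this] show ?thesis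
    by (simp add: frac_integrand_def ennreal_mult[symmetric])
qed

text \<open>With s = |x - y|, the restriction K1 s < t < K2 s on t is read as a restriction on y for
  fixed t: after the exchange of integrals it puts y into the ball of radius t/K1. Borel versions of
  \<open>\<rho>\<close> and |f| make the integrand jointly measurable.\<close>

lemma frac_integrand_tonelli:
  fixes f :: "'a::euclidean_space \<Rightarrow> 'b::{real_normed_vector, second_countable_topology}"
  assumes f: "f \<in> borel_measurable lebesgue"
    and pos: "\<And>t. 0 < t \<Longrightarrow> 0 < \<rho> t"
    and \<rho>: "\<rho> \<in> borel_measurable (lebesgue_on {0<..})"
    and C: "0 < C" "0 < K1" "K1 < K2"
    and growth: "\<And>s. 0 < s \<Longrightarrow>
      ennreal (\<rho> s) \<le> ennreal C * (\<integral>\<^sup>+t\<in>{K1 * s<..<K2 * s}. ennreal (\<rho> t / t) \<partial>lebesgue)"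
  shows "(\<integral>\<^sup>+y. ennreal (norm (frac_integrand \<rho> f x y)) \<partial>lebesgue) \<le>
    (\<integral>\<^sup>+t\<in>{0<..}. ennreal (C * K2 ^ DIM('a) * \<rho> t / t ^ Suc DIM('a)) *
      (\<integral>\<^sup>+y\<in>ball x (t / K1). ennreal (norm (f y)) \<partial>lebesgue) \<partial>lebesgue)"
proof -
  let ?n = "DIM('a)"
  obtain \<rho>1 where \<rho>1: "\<rho>1 \<in> borel_measurable borel" "AE t in lborel. 0 < t \<longrightarrow> \<rho> t = \<rho>1 t"
    using borel_measurable_Ioi_ex_borel[OF \<rho>] by blast
  note [measurable] = \<rho>1(1)
  have "(\<lambda>y. ennreal (norm (f y))) \<in> borel_measurable lebesgue" using f by measurable
  then obtain F where F[measurable]: "F \<in> borel_measurable borel"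
    and F_eq: "AE y in lborel. ennreal (norm (f y)) = F y"
    using lebesgue_measurable_ex_borel by blast
  define c where "c t = ennreal (C * K2 ^ ?n * \<rho>1 t / t ^ Suc ?n) * indicator {0<..} t" for t
  have c[measurable]: "c \<in> borel_measurable borel" unfolding c_def by measurable
  define h where "h y t = c t * (F y * (if norm (x - y) < t / K1 then 1 else 0))" for y :: 'a and t
  have h[measurable]: "(\<lambda>(y, t). h y t) \<in> borel_measurable (lborel \<Otimes>\<^sub>M lborel)"
    unfolding h_def by measurable
  have "(\<integral>\<^sup>+y. ennreal (norm (frac_integrand \<rho> f x y)) \<partial>lborel) \<le> (\<integral>\<^sup>+y. (\<integral>\<^sup>+t. h y t \<partial>lborel) \<partial>lborel)"
  proof (rule nn_integral_mono_AE)
    have "AE y in lborel. y \<noteq> x" by (rule AE_lborel_singleton)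
    then show "AE y in lborel. ennreal (norm (frac_integrand \<rho> f x y)) \<le> (\<integral>\<^sup>+t. h y t \<partial>lborel)"
      using F_eq
    proof eventually_elim
      case (elim y)
      define s where "s = norm (x - y)"
      have s: "0 < s" using elim by (simp add: s_def)
      have "ennreal (norm (frac_integrand \<rho> f x y)) = ennreal (\<rho> s / s ^ ?n) * F y"
        using norm_frac_integrand[of \<rho> x y f] pos elim by (simp add: s_def)
      also have "ennreal (\<rho> s / s ^ ?n) = ennreal (1 / s ^ ?n) * ennreal (\<rho> s)"
        using s pos[OF s] by (simp add: ennreal_mult[symmetric])
      also have "\<dots> \<le> ennreal (1 / s ^ ?n) * (ennreal C * (\<integral>\<^sup>+t\<in>{K1 * s<..<K2 * s}. ennreal (\<rho> t / t) \<partial>lebesgue))"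
        by (intro mult_left_mono growth s) simp
      also have "(\<integral>\<^sup>+t\<in>{K1 * s<..<K2 * s}. ennreal (\<rho> t / t) \<partial>lebesgue) =
          (\<integral>\<^sup>+t\<in>{K1 * s<..<K2 * s}. ennreal (\<rho>1 t / t) \<partial>lborel)"
        unfolding nn_integral_completion
      proof (rule nn_integral_cong_AE)
        show "AE t in lborel. ennreal (\<rho> t / t) * indicator {K1 * s<..<K2 * s} t =
            ennreal (\<rho>1 t / t) * indicator {K1 * s<..<K2 * s} t"
          using \<rho>1(2)
        proof eventually_elim
          case (elim t)
          have "0 < K1 * s" using s C by simp
          then show ?case using elim by (auto simp: indicator_def)
        qed
      qed
      also have "ennreal (1 / s ^ ?n) * (ennreal C * (\<integral>\<^sup>+t\<in>{K1 * s<..<K2 * s}. ennreal (\<rho>1 t / t) \<partial>lborel)) =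
          (\<integral>\<^sup>+t. ennreal (C / s ^ ?n) * (ennreal (\<rho>1 t / t) * indicator {K1 * s<..<K2 * s} t) \<partial>lborel)"
        using C(1) s by (subst nn_integral_cmult) (simp_all add: ennreal_mult_left_assoc)
      \<comment> \<open>The upper limit t < K2 s is spent on replacing 1/s^n by K2^n/t^n; only K1 s
        < t remains as a condition.\<close>
      also have "\<dots> \<le> (\<integral>\<^sup>+t. c t * (if s < t / K1 then 1 else 0) \<partial>lborel)"
      proof (rule nn_integral_mono)
        fix t
        show "ennreal (C / s ^ ?n) * (ennreal (\<rho>1 t / t) * indicator {K1 * s<..<K2 * s} t) \<le>
            c t * (if s < t / K1 then 1 else 0)"
        proof (cases "K1 * s < t \<and> t < K2 * s")
          case True
          have t: "0 < t" using True s C by (meson less_trans mult_pos_pos)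
          have "ennreal (C / s ^ ?n) * ennreal (\<rho>1 t / t) = ennreal (C / s ^ ?n * (\<rho>1 t / t))"
            using C s by (intro ennreal_mult'[symmetric]) simp
          also have "\<dots> \<le> ennreal (C * K2 ^ ?n / t ^ ?n) * ennreal (\<rho>1 t / t)"
          proof -
            have "t ^ ?n \<le> (K2 * s) ^ ?n" using True t by (intro power_mono) auto
            then have "C / s ^ ?n \<le> C * K2 ^ ?n / t ^ ?n"
              using s t C by (simp add: field_simps power_mult_distrib)
            then show ?thesis
              using C s by (subst ennreal_mult') (auto intro!: mult_right_mono ennreal_leI)
          qed
          also have "\<dots> = ennreal (C * K2 ^ ?n * \<rho>1 t / t ^ Suc ?n)"
            using C t by (subst ennreal_mult'[symmetric]) (simp_all add: mult_ac)
          finally show ?thesis using True t C by (simp add: c_def field_simps)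
        qed simp
      qed
      finally have "ennreal (norm (frac_integrand \<rho> f x y)) \<le>
          (\<integral>\<^sup>+t. c t * (if s < t / K1 then 1 else 0) \<partial>lborel) * F y"
        by (simp add: mult_right_mono)
      also have "\<dots> = (\<integral>\<^sup>+t. c t * (if s < t / K1 then 1 else 0) * F y \<partial>lborel)"
        by (rule nn_integral_multc[symmetric]) measurable
      finally show ?case unfolding h_def s_def by (simp only: mult_ac)
    qed
  qed
  also have "\<dots> = (\<integral>\<^sup>+t. (\<integral>\<^sup>+y. h y t \<partial>lborel) \<partial>lborel)"
    using h by (rule lborel_pair.Fubini'[symmetric])
  also have "\<dots> = (\<integral>\<^sup>+t\<in>{0<..}. ennreal (C * K2 ^ DIM('a) * \<rho> t / t ^ Suc DIM('a)) *
      (\<integral>\<^sup>+y\<in>ball x (t / K1). ennreal (norm (f y)) \<partial>lborel) \<partial>lborel)"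
  proof (rule nn_integral_cong_AE)
    show "AE t in lborel. (\<integral>\<^sup>+y. h y t \<partial>lborel) = ennreal (C * K2 ^ DIM('a) * \<rho> t / t ^ Suc DIM('a)) *
      (\<integral>\<^sup>+y\<in>ball x (t / K1). ennreal (norm (f y)) \<partial>lborel) * indicator {0<..} t"
      using \<rho>1(2)
    proof eventually_elim
      case (elim t)
      have "(\<integral>\<^sup>+y. h y t \<partial>lborel) = c t * (\<integral>\<^sup>+y. F y * (if norm (x - y) < t / K1 then 1 else 0) \<partial>lborel)"
        unfolding h_def by (rule nn_integral_cmult) measurable
      also have "(\<integral>\<^sup>+y. F y * (if norm (x - y) < t / K1 then 1 else 0) \<partial>lborel) =
          (\<integral>\<^sup>+y\<in>ball x (t / K1). ennreal (norm (f y)) \<partial>lborel)"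
      proof (rule nn_integral_cong_AE)
        show "AE y in lborel. F y * (if norm (x - y) < t / K1 then 1 else 0) =
            ennreal (norm (f y)) * indicator (ball x (t / K1)) y"
          using F_eq by eventually_elim (auto simp: indicator_def dist_norm)
      qed
      finally show ?case using elim by (auto simp: c_def indicator_def)
    qed
  qed
  finally show ?thesis by (simp only: nn_integral_completion)
qed

text \<open>The criterion for c < Mf(x) is applied with c = Mf(x) itself, where it must fail for
  every ball; this includes an infinite value of Mf(x).\<close>

lemma nn_integral_ball_le_maximal_fun:
  assumes "0 < r"
  shows "(\<integral>\<^sup>+y\<in>ball x r. ennreal (norm (f y)) \<partial>lebesgue) \<le>
    maximal_fun f x * emeasure lebesgue (ball x r)"
  using less_maximal_fun_iff[of "maximal_fun f x" f x] assms by (auto simp: not_less[symmetric])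

text \<open>The integration variable of \<open>frac_integrand_tonelli\<close> is split at an
  arbitrary r. The maximal function controls the averages for small t, the tail bound those for
  large t, and r stays free for later optimisation.\<close>

lemma frac_integrand_split:
  assumes \<phi>: "\<phi> \<in> G_dec DIM('a::euclidean_space)" and p: "1 \<le> p"
    and \<phi>_meas: "\<phi> \<in> borel_measurable (lebesgue_on {0<..})"
    and pos': "\<forall>t>0. 0 < \<rho> t"
    and \<rho>: "\<rho> \<in> borel_measurable (lebesgue_on {0<..})"
    and C: "0 < C" "0 < K1" "K1 < K2"
    and growth': "\<forall>s>0.
      ennreal (\<rho> s) \<le> ennreal C * (\<integral>\<^sup>+t\<in>{K1 * s<..<K2 * s}. ennreal (\<rho> t / t) \<partial>lebesgue)"
  shows "\<exists>K>0. \<forall>(f :: 'a \<Rightarrow> 'b::{real_normed_vector, second_countable_topology}) N m r x.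
    f \<in> borel_measurable lebesgue \<longrightarrow> 0 < N \<longrightarrow> tail_bound p \<phi> f N \<longrightarrow>
    0 < m \<longrightarrow> maximal_fun f x \<le> ennreal m \<longrightarrow> 0 < r \<longrightarrow>
    (\<integral>\<^sup>+y. ennreal (norm (frac_integrand \<rho> f x y)) \<partial>lebesgue) \<le>
      ennreal (K * m) * (\<integral>\<^sup>+t\<in>{0<..<r}. ennreal (\<rho> t / t) \<partial>lebesgue) +
      ennreal (K * N) * (\<integral>\<^sup>+t\<in>{r<..}. ennreal (\<rho> t * \<phi> t powr (1 / p) / t) \<partial>lebesgue)"
proof -
  note pos = pos'[rule_format] and growth = growth'[rule_format]
  note [measurable] = \<rho> \<phi>_meas borel_measurable_lebesgue_on_ident
  let ?n = "DIM('a)"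
  have \<phi>_pos: "0 < \<phi> r" if "0 < r" for r using \<phi> that by (rule G_dec_pos)
  have K1': "0 < 1 / K1" using C by simp
  obtain D where D: "1 \<le> D" "\<And>t. 0 < t \<Longrightarrow> \<phi> (1 / K1 * t) \<le> D * \<phi> t"
    using G_dec_dilate[OF \<phi> K1'] by blast
  \<comment> \<open>The volume of the ball of radius t/K1 cancels the power t^n in the kernel and
    leaves the factor v / K1^n.\<close>
  define c where "c = C * K2 ^ ?n * (unit_ball_vol ?n / K1 ^ ?n)"
  have c: "0 < c" using C by (simp add: c_def)
  \<comment> \<open>The second entry carries the factor 2 of \<open>tail_bound_average\<close> and
    the cost of passing from \<phi>(t/K1) to \<phi>(t).\<close>
  define K where "K = max c (c * (2 * D powr (1 / p)))"
  have K: "0 < K" "c \<le> K" "c * (2 * D powr (1 / p)) \<le> K" using c by (auto simp: K_def)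
  show ?thesis
  proof (intro exI[of _ K] conjI allI impI K(1))
    fix f :: "'a \<Rightarrow> 'b" and N m r :: real and x :: 'a
    assume f: "f \<in> borel_measurable lebesgue" and N: "0 < N" and tail: "tail_bound p \<phi> f N"
      and m: "0 < m" "maximal_fun f x \<le> ennreal m" and r: "0 < r"
    define g1 where "g1 t = ennreal (\<rho> t / t) * indicator {0<..<r} t" for t
    define g2 where "g2 t = ennreal (\<rho> t * \<phi> t powr (1 / p) / t) * indicator {r<..} t" for t
    have g1: "g1 \<in> borel_measurable lebesgue"
      unfolding g1_def by (rule borel_measurable_indicator_Ioi) (measurable, auto)
    have g2: "g2 \<in> borel_measurable lebesgue"
      unfolding g2_def using r by (intro borel_measurable_indicator_Ioi) (measurable, auto)
    have avg: "ennreal (C * K2 ^ ?n * \<rho> t / t ^ Suc ?n) *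
        (\<integral>\<^sup>+y\<in>ball x (t / K1). ennreal (norm (f y)) \<partial>lebesgue) \<le> ennreal (c * M * (\<rho> t / t))"
      if t: "0 < t" and M: "0 \<le> M"
        "(\<integral>\<^sup>+y\<in>ball x (t / K1). ennreal (norm (f y)) \<partial>lebesgue) \<le>
          ennreal M * emeasure lebesgue (ball x (t / K1))" for t M
    proof -
      have "ennreal (C * K2 ^ ?n * \<rho> t / t ^ Suc ?n) *
        (\<integral>\<^sup>+y\<in>ball x (t / K1). ennreal (norm (f y)) \<partial>lebesgue) \<le>
        ennreal (C * K2 ^ ?n * \<rho> t / t ^ Suc ?n) * (ennreal M * emeasure lebesgue (ball x (t / K1)))"
        using M(2) by (intro mult_left_mono) auto
      also have "emeasure lebesgue (ball x (t / K1)) = ennreal (unit_ball_vol ?n * (t / K1) ^ ?n)"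
        using t C by (intro emeasure_lebesgue_ball) auto
      also have "ennreal (C * K2 ^ ?n * \<rho> t / t ^ Suc ?n) * (ennreal M * ennreal (unit_ball_vol ?n * (t / K1) ^ ?n)) =
          ennreal (C * K2 ^ ?n * \<rho> t / t ^ Suc ?n * (M * (unit_ball_vol ?n * (t / K1) ^ ?n)))"
        using M(1) C t pos[OF t] by (subst ennreal_mult'[symmetric], simp)+ simp
      also have "C * K2 ^ ?n * \<rho> t / t ^ Suc ?n * (M * (unit_ball_vol ?n * (t / K1) ^ ?n)) = c * M * (\<rho> t / t)"
        using t C by (simp add: c_def power_divide field_simps)
      finally show ?thesis .
    qed
    have "(\<integral>\<^sup>+y. ennreal (norm (frac_integrand \<rho> f x y)) \<partial>lebesgue) \<le>
      (\<integral>\<^sup>+t\<in>{0<..}. ennreal (C * K2 ^ ?n * \<rho> t / t ^ Suc ?n) *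
        (\<integral>\<^sup>+y\<in>ball x (t / K1). ennreal (norm (f y)) \<partial>lebesgue) \<partial>lebesgue)"
      using f pos \<rho> C growth by (rule frac_integrand_tonelli)
    also have "\<dots> \<le> (\<integral>\<^sup>+t. ennreal (K * m) * g1 t + ennreal (K * N) * g2 t \<partial>lebesgue)"
    proof (rule nn_integral_mono_AE)
      have "AE t in lebesgue. t \<noteq> r"
        by (rule AE_completion, rule AE_lborel_singleton)
      then show "AE t in lebesgue. ennreal (C * K2 ^ ?n * \<rho> t / t ^ Suc ?n) *
          (\<integral>\<^sup>+y\<in>ball x (t / K1). ennreal (norm (f y)) \<partial>lebesgue) * indicator {0<..} t \<le>
          ennreal (K * m) * g1 t + ennreal (K * N) * g2 t"
      proof eventually_elim
        case (elim t)
        consider "t \<le> 0" | "0 < t" "t < r" | "0 < t" "r < t" using elim by linarith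
        then show ?case
        proof cases
          case 1
          then show ?thesis by simp
        next
          case 2
          have tK: "0 < t / K1" using 2 C by simp
          have "(\<integral>\<^sup>+y\<in>ball x (t / K1). ennreal (norm (f y)) \<partial>lebesgue) \<le>
              maximal_fun f x * emeasure lebesgue (ball x (t / K1))"
            using tK by (rule nn_integral_ball_le_maximal_fun)
          also have "\<dots> \<le> ennreal m * emeasure lebesgue (ball x (t / K1))"
            using m(2) by (intro mult_right_mono) auto
          finally have "ennreal (C * K2 ^ ?n * \<rho> t / t ^ Suc ?n) *
              (\<integral>\<^sup>+y\<in>ball x (t / K1). ennreal (norm (f y)) \<partial>lebesgue) \<le> ennreal (c * m * (\<rho> t / t))"
            using m(1) 2 by (intro avg) auto
          also have "\<dots> \<le> ennreal (K * m * (\<rho> t / t))"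
            using K(2) m(1) pos[of t] 2 by (intro ennreal_leI mult_right_mono) auto
          also have "\<dots> = ennreal (K * m) * g1 t + ennreal (K * N) * g2 t"
            using 2 K(1) m(1) pos[of t] by (simp add: g1_def g2_def ennreal_mult[symmetric])
          finally show ?thesis using 2 by simp
        next
          case 3
          have tK: "0 < t / K1" using 3 C by simp
          have "(\<integral>\<^sup>+y\<in>ball x (t / K1). ennreal (norm (f y)) \<partial>lebesgue) \<le>
              ennreal (2 * N * \<phi> (t / K1) powr (1 / p)) * emeasure lebesgue (ball x (t / K1))"
            using f p N \<phi>_pos tail tK by (rule tail_bound_average)
          then have "ennreal (C * K2 ^ ?n * \<rho> t / t ^ Suc ?n) *
              (\<integral>\<^sup>+y\<in>ball x (t / K1). ennreal (norm (f y)) \<partial>lebesgue) \<le>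
              ennreal (c * (2 * N * \<phi> (t / K1) powr (1 / p)) * (\<rho> t / t))"
            using 3 N by (intro avg) auto
          also have "\<dots> \<le> ennreal (K * N * (\<rho> t * \<phi> t powr (1 / p) / t))"
          proof (rule ennreal_leI)
            have "\<phi> (t / K1) powr (1 / p) \<le> (D * \<phi> t) powr (1 / p)"
              using D(2)[of t] \<phi>_pos[OF tK] 3 p by (intro powr_mono2) auto
            also have "\<dots> = D powr (1 / p) * \<phi> t powr (1 / p)"
              using D(1) \<phi>_pos[of t] 3 by (simp add: powr_mult)
            finally have "c * (2 * N * \<phi> (t / K1) powr (1 / p)) * (\<rho> t / t) \<le>
                c * (2 * N * (D powr (1 / p) * \<phi> t powr (1 / p))) * (\<rho> t / t)"
              using c N pos[of t] 3 by (intro mult_right_mono mult_left_mono) auto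
            also have "\<dots> = c * (2 * D powr (1 / p)) * (N * (\<rho> t * \<phi> t powr (1 / p) / t))"
              by simp
            also have "\<dots> \<le> K * (N * (\<rho> t * \<phi> t powr (1 / p) / t))"
              using K(3) N pos[of t] 3 by (intro mult_right_mono) auto
            finally show "c * (2 * N * \<phi> (t / K1) powr (1 / p)) * (\<rho> t / t) \<le> K * N * (\<rho> t * \<phi> t powr (1 / p) / t)"
              by simp
          qed
          also have "\<dots> = ennreal (K * m) * g1 t + ennreal (K * N) * g2 t"
            using 3 K(1) N pos[of t] by (simp add: g1_def g2_def ennreal_mult[symmetric])
          finally show ?thesis using 3 by simp
        qed
      qed
    qed
    also have "\<dots> = (\<integral>\<^sup>+t. ennreal (K * m) * g1 t \<partial>lebesgue) + (\<integral>\<^sup>+t. ennreal (K * N) * g2 t \<partial>lebesgue)"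
      using g1 g2 by (intro nn_integral_add borel_measurable_times_ennreal) simp_all
    also have "\<dots> = ennreal (K * m) * (\<integral>\<^sup>+t. g1 t \<partial>lebesgue) + ennreal (K * N) * (\<integral>\<^sup>+t. g2 t \<partial>lebesgue)"
      using nn_integral_cmult[OF g1] nn_integral_cmult[OF g2] by simp
    finally show "(\<integral>\<^sup>+y. ennreal (norm (frac_integrand \<rho> f x y)) \<partial>lebesgue) \<le>
      ennreal (K * m) * (\<integral>\<^sup>+t\<in>{0<..<r}. ennreal (\<rho> t / t) \<partial>lebesgue) +
      ennreal (K * N) * (\<integral>\<^sup>+t\<in>{r<..}. ennreal (\<rho> t * \<phi> t powr (1 / p) / t) \<partial>lebesgue)"
      unfolding g1_def g2_def .
  qed
qed

text \<open>A discontinuous \<open>\<phi>\<close> may skip the value l. The set where \<phi> \<ge> l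
  is nonempty by the limit at 0 and bounded by the limit at infinity; a member r beyond half its
  supremum has \<phi>(2r) < l, and doubling gives \<phi>(r) \<le> D l.\<close>

lemma G_dec_level:
  assumes \<phi>: "\<phi> \<in> G_dec n" and lim0: "filterlim \<phi> at_top (at_right 0)" and lim1: "(\<phi> \<longlongrightarrow> 0) at_top"
  shows "\<exists>B\<ge>1. \<forall>l>0. \<exists>r>0. l \<le> \<phi> r \<and> \<phi> r \<le> B * l"
proof -
  have half: "0 < (1 / 2 :: real)" by simp
  obtain D where D: "1 \<le> D" "\<And>t. 0 < t \<Longrightarrow> \<phi> (1 / 2 * t) \<le> D * \<phi> t"
    using G_dec_dilate[OF \<phi> half] by blast
  have "\<exists>r>0. l \<le> \<phi> r \<and> \<phi> r \<le> D * l" if l: "0 < l" for l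
  proof -
    define S where "S = {r. 0 < r \<and> l \<le> \<phi> r}"
    have "eventually (\<lambda>r. l \<le> \<phi> r) (at_right 0)"
      using lim0 by (simp add: filterlim_at_top)
    then obtain b where b: "0 < b" "\<And>r. 0 < r \<Longrightarrow> r < b \<Longrightarrow> l \<le> \<phi> r"
      unfolding eventually_at_right_field by blast
    have ne: "b / 2 \<in> S" using b by (simp add: S_def)
    have "eventually (\<lambda>r. \<phi> r < l) at_top"
      using lim1 l by (rule order_tendstoD)
    then obtain u where u: "\<And>r. u \<le> r \<Longrightarrow> \<phi> r < l"
      unfolding eventually_at_top_linorder by blast
    have bdd: "bdd_above S"
    proof (rule bdd_aboveI[of _ u])
      fix r assume "r \<in> S"
      then show "r \<le> u" using u[of r] by (force simp: S_def)
    qed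
    have "0 < Sup S" using cSup_upper[OF ne bdd] b(1) by simp
    then have "Sup S / 2 < Sup S" by simp
    then obtain r where r: "r \<in> S" "Sup S / 2 < r"
      using less_cSup_iff[of S] ne bdd by blast
    have "2 * r \<notin> S"
    proof
      assume "2 * r \<in> S"
      then have "2 * r \<le> Sup S" using bdd by (rule cSup_upper)
      then show False using r(2) by simp
    qed
    then have "\<phi> (2 * r) < l" using r(1) by (auto simp: S_def)
    moreover have "\<phi> r \<le> D * \<phi> (2 * r)" using D(2)[of "2 * r"] r(1) by (simp add: S_def)
    ultimately have "\<phi> r \<le> D * l" using D(1)
      by (meson less_imp_le mult_left_mono order_trans zero_le_one)
    then show ?thesis using r(1) by (auto simp: S_def)
  qed
  then show ?thesis using D(1) by blast
qed

text \<open>For l = (m/N)^p the two competing terms balance exactly: m l^(1/q-1/p) and N l^(1/q)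
  both equal m^(p/q) N^(1-p/q). Positivity of both majorants m and N keeps this choice
  meaningful.\<close>

lemma hedberg_inequality:
  assumes \<phi>: "\<phi> \<in> G_dec DIM('a::euclidean_space)" and p: "1 \<le> p" "p < q"
    and \<phi>_meas: "\<phi> \<in> borel_measurable (lebesgue_on {0<..})"
    and pos: "\<forall>t>0. 0 < \<rho> t"
    and \<rho>: "\<rho> \<in> borel_measurable (lebesgue_on {0<..})"
    and C: "0 < C" "0 < K1" "K1 < K2"
    and growth: "\<forall>s>0.
      ennreal (\<rho> s) \<le> ennreal C * (\<integral>\<^sup>+t\<in>{K1 * s<..<K2 * s}. ennreal (\<rho> t / t) \<partial>lebesgue)"
    and lim0: "filterlim \<phi> at_top (at_right 0)" and lim1: "(\<phi> \<longlongrightarrow> 0) at_top"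
    and A: "0 < A" "full_cond \<rho> \<phi> p q A"
  shows "\<exists>K>0. \<forall>(f :: 'a \<Rightarrow> 'b::{real_normed_vector, second_countable_topology}) N m x.
    f \<in> borel_measurable lebesgue \<longrightarrow> 0 < N \<longrightarrow> tail_bound p \<phi> f N \<longrightarrow>
    0 < m \<longrightarrow> maximal_fun f x \<le> ennreal m \<longrightarrow>
    (\<integral>\<^sup>+y. ennreal (norm (frac_integrand \<rho> f x y)) \<partial>lebesgue) \<le>
      ennreal (K * m powr (p / q) * N powr (1 - p / q))"
proof -
  obtain K0 where K0: "0 < K0" "\<forall>(f :: 'a \<Rightarrow> 'b) N m r x.
    f \<in> borel_measurable lebesgue \<longrightarrow> 0 < N \<longrightarrow> tail_bound p \<phi> f N \<longrightarrow>
    0 < m \<longrightarrow> maximal_fun f x \<le> ennreal m \<longrightarrow> 0 < r \<longrightarrow>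
    (\<integral>\<^sup>+y. ennreal (norm (frac_integrand \<rho> f x y)) \<partial>lebesgue) \<le>
      ennreal (K0 * m) * (\<integral>\<^sup>+t\<in>{0<..<r}. ennreal (\<rho> t / t) \<partial>lebesgue) +
      ennreal (K0 * N) * (\<integral>\<^sup>+t\<in>{r<..}. ennreal (\<rho> t * \<phi> t powr (1 / p) / t) \<partial>lebesgue)"
    using frac_integrand_split[OF \<phi> p(1) \<phi>_meas pos \<rho> C growth, where 'b = 'b] by (elim exE conjE)
  obtain B where B: "1 \<le> B" "\<And>l. 0 < l \<Longrightarrow> \<exists>r>0. l \<le> \<phi> r \<and> \<phi> r \<le> B * l"
    using G_dec_level[OF \<phi> lim0 lim1] by blast
  show ?thesis
  proof (intro exI[of _ "K0 * A * (1 + B powr (1 / q))"] conjI allI impI)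
    show "0 < K0 * A * (1 + B powr (1 / q))"
      using K0(1) A(1) by (auto intro!: mult_pos_pos add_pos_nonneg)
    fix f :: "'a \<Rightarrow> 'b" and N m :: real and x :: 'a
    assume f: "f \<in> borel_measurable lebesgue" and N: "0 < N" and tail: "tail_bound p \<phi> f N"
      and m: "0 < m" "maximal_fun f x \<le> ennreal m"
    define l where "l = (m / N) powr p"
    have l: "0 < l" using m N by (simp add: l_def)
    obtain r where r: "0 < r" "l \<le> \<phi> r" "\<phi> r \<le> B * l"
      using B(2)[OF l] by blast
    define I1 where "I1 = (\<integral>\<^sup>+t\<in>{0<..<r}. ennreal (\<rho> t / t) \<partial>lebesgue)"
    define I2 where "I2 = (\<integral>\<^sup>+t\<in>{r<..}. ennreal (\<rho> t * \<phi> t powr (1 / p) / t) \<partial>lebesgue)"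
    have fc: "I1 * ennreal (\<phi> r powr (1 / p)) + I2 \<le> ennreal (A * \<phi> r powr (1 / q))"
      using A(2) r(1) unfolding full_cond_def I1_def I2_def by blast
    have \<phi>r: "0 < \<phi> r" using l r(2) by simp
    \<comment> \<open>Multiplying by \<phi>(r)^(-1/p) isolates the local integral. The resulting
      exponent 1/q - 1/p is negative, so this term uses l \<le> \<phi>(r), while the global integral
      below uses \<phi>(r) \<le> B l.\<close>
    have "I1 = I1 * ennreal (\<phi> r powr (1 / p)) * ennreal (\<phi> r powr (- (1 / p)))"
      using \<phi>r by (simp add: mult.assoc ennreal_mult[symmetric] powr_add[symmetric])
    also have "\<dots> \<le> ennreal (A * \<phi> r powr (1 / q)) * ennreal (\<phi> r powr (- (1 / p)))"
      using fc by (intro mult_right_mono order_trans[OF _ fc]) auto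
    also have "\<dots> = ennreal (A * \<phi> r powr (1 / q - 1 / p))"
      using A(1) \<phi>r by (simp add: ennreal_mult[symmetric] powr_add[symmetric] mult.assoc)
    also have "\<dots> \<le> ennreal (A * l powr (1 / q - 1 / p))"
      using A(1) l r(2) p by (intro ennreal_leI mult_left_mono powr_mono2') (auto simp: field_simps)
    finally have I1: "I1 \<le> ennreal (A * l powr (1 / q - 1 / p))" .
    have "I2 \<le> ennreal (A * \<phi> r powr (1 / q))"
      by (rule order_trans[OF _ fc]) (simp add: add_increasing)
    also have "\<dots> \<le> ennreal (A * (B * l) powr (1 / q))"
      using A(1) \<phi>r r(3) p by (intro ennreal_leI mult_left_mono powr_mono2) auto
    finally have I2: "I2 \<le> ennreal (A * (B * l) powr (1 / q))" .
    have e1: "m * l powr (1 / q - 1 / p) = m powr (p / q) * N powr (1 - p / q)"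
    proof -
      have "l powr (1 / q - 1 / p) = (m / N) powr (p / q - 1)"
        using p by (simp add: l_def powr_powr right_diff_distrib)
      also have "\<dots> = m powr (p / q) / m * (N powr (1 - p / q))"
        using m(1) N by (simp add: powr_divide powr_diff)
      finally show ?thesis using m(1) by simp
    qed
    have e2: "N * (B * l) powr (1 / q) = B powr (1 / q) * (m powr (p / q) * N powr (1 - p / q))"
      using m(1) N B(1) p by (simp add: l_def powr_mult powr_powr powr_divide powr_diff)
    have "(\<integral>\<^sup>+y. ennreal (norm (frac_integrand \<rho> f x y)) \<partial>lebesgue) \<le> ennreal (K0 * m) * I1 + ennreal (K0 * N) * I2"
      unfolding I1_def I2_def using K0(2)[rule_format, OF f N tail m r(1)] .
    also have "\<dots> \<le> ennreal (K0 * m) * ennreal (A * l powr (1 / q - 1 / p)) +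
        ennreal (K0 * N) * ennreal (A * (B * l) powr (1 / q))"
      by (intro add_mono mult_left_mono I1 I2) auto
    also have "\<dots> = ennreal (K0 * m * (A * l powr (1 / q - 1 / p)) + K0 * N * (A * (B * l) powr (1 / q)))"
      using K0(1) m(1) N A(1) by (simp add: ennreal_mult[symmetric] ennreal_plus[symmetric] del: ennreal_plus)
    also have "K0 * m * (A * l powr (1 / q - 1 / p)) + K0 * N * (A * (B * l) powr (1 / q)) =
      K0 * A * (m * l powr (1 / q - 1 / p)) + K0 * A * (N * (B * l) powr (1 / q))"
      by simp
    also have "\<dots> = K0 * A * (1 + B powr (1 / q)) * m powr (p / q) * N powr (1 - p / q)"
      unfolding e1 e2 by (simp add: algebra_simps)
    finally show "(\<integral>\<^sup>+y. ennreal (norm (frac_integrand \<rho> f x y)) \<partial>lebesgue) \<le>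
      ennreal (K0 * A * (1 + B powr (1 / q)) * m powr (p / q) * N powr (1 - p / q))" .
  qed
qed

section \<open>Powers on [0,\<infinity>]; norm bounds as inequalities on balls\<close>

lemma enn_powr_ennreal: "0 \<le> x \<Longrightarrow> enn_powr (ennreal x) a = ennreal (x powr a)"
  by (simp add: enn_powr_def)

lemma enn_powr_top [simp]: "enn_powr top a = top"
  by (simp add: enn_powr_def)

lemma enn_powr_zero [simp]: "enn_powr 0 a = 0"
  by (simp add: enn_powr_def)

lemma enn_powr_le_iff:
  assumes "0 < p" "0 \<le> N"
  shows "enn_powr x (1 / p) \<le> ennreal N \<longleftrightarrow> x \<le> ennreal (N powr p)"
proof (cases x)
  case (real u)
  have "u powr (1 / p) \<le> N \<longleftrightarrow> u \<le> N powr p"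
  proof
    assume "u powr (1 / p) \<le> N"
    then have "(u powr (1 / p)) powr p \<le> N powr p" using assms by (intro powr_mono2) auto
    then show "u \<le> N powr p" using assms real by (simp add: powr_powr)
  next
    assume "u \<le> N powr p"
    then have "u powr (1 / p) \<le> (N powr p) powr (1 / p)" using assms real by (intro powr_mono2) auto
    then show "u powr (1 / p) \<le> N" using assms by (simp add: powr_powr)
  qed
  then show ?thesis using real assms by (simp add: enn_powr_ennreal)
qed (simp add: top_unique)

lemma normalized_enn_powr_le_iff:
  assumes "0 < p" "0 \<le> N" and \<phi>: "\<forall>r>0. 0 < \<phi> r" and r: "0 < r"
  shows "enn_powr (I / (ennreal (\<phi> r) * emeasure lebesgue (ball (a::'a::euclidean_space) r))) (1 / p) \<le> ennreal N \<longleftrightarrow>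
      I \<le> ennreal (N powr p * \<phi> r) * emeasure lebesgue (ball a r)"
  unfolding enn_powr_le_iff[OF assms(1,2)]
  using \<phi>[rule_format, OF r] emeasure_lebesgue_ball_pos[OF r, of a] emeasure_lebesgue_ball_finite[of a r]
  by (subst divide_le_iff_ennreal)
     (auto simp: ennreal_mult_eq_top_iff ennreal_mult' mult.assoc simp del: emeasure_completion)

lemma morrey_norm_le_iff:
  fixes f :: "'a::euclidean_space \<Rightarrow> 'b::real_normed_vector"
  assumes "0 < p" "0 \<le> N" and \<phi>: "\<forall>r>0. 0 < \<phi> r"
  shows "morrey_norm p \<phi> f \<le> ennreal N \<longleftrightarrow>
    (\<forall>a r. 0 < r \<longrightarrow> (\<integral>\<^sup>+x\<in>ball a r. ennreal (norm (f x) powr p) \<partial>lebesgue)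
       \<le> ennreal (N powr p * \<phi> r) * emeasure lebesgue (ball a r))"
proof -
  note * = normalized_enn_powr_le_iff[where 'a = 'a, OF assms(1,2) \<phi>]
  show ?thesis
    unfolding morrey_norm_def SUP_le_iff using * by auto
qed

lemma weak_morrey_norm_le_iff:
  fixes f :: "'a::euclidean_space \<Rightarrow> 'b::real_normed_vector"
  assumes "0 < p" "0 \<le> N" and \<phi>: "\<forall>r>0. 0 < \<phi> r"
  shows "weak_morrey_norm p \<phi> f \<le> ennreal N \<longleftrightarrow>
    (\<forall>a r t. 0 < r \<longrightarrow> 0 < t \<longrightarrow> ennreal (t powr p) * distr_fun (ball a r) f t
       \<le> ennreal (N powr p * \<phi> r) * emeasure lebesgue (ball a r))"
proof -
  note * = normalized_enn_powr_le_iff[where 'a = 'a, OF assms(1,2) \<phi>]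
  show ?thesis
    unfolding weak_morrey_norm_def SUP_le_iff using * by auto
qed

section \<open>Measurability and convergence of the fractional integral\<close>

lemma frac_integrand_borel_version:
  fixes f :: "'a::euclidean_space \<Rightarrow> 'b::{real_normed_vector, second_countable_topology}"
  assumes "f \<in> borel_measurable lebesgue" "\<rho> \<in> borel_measurable (lebesgue_on {0<..})"
  obtains \<rho>1 g where "\<rho>1 \<in> borel_measurable borel" "g \<in> borel_measurable borel"
    "\<And>x. AE y in lborel. frac_integrand \<rho> f x y = frac_integrand \<rho>1 g x y"
proof -
  obtain \<rho>1 where \<rho>1: "\<rho>1 \<in> borel_measurable borel" "AE t in lborel. 0 < t \<longrightarrow> \<rho> t = \<rho>1 t"
    using borel_measurable_Ioi_ex_borel[OF assms(2)] by blast
  obtain g where g: "g \<in> borel_measurable borel" "AE y in lborel. f y = g y"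
    using lebesgue_measurable_ex_borel[OF assms(1)] by blast
  have "AE y in lborel. frac_integrand \<rho> f x y = frac_integrand \<rho>1 g x y" for x
    using AE_lborel_norm_diff[OF \<rho>1(2), of x] g(2)
    by eventually_elim (simp add: frac_integrand_def)
  with \<rho>1(1) g(1) show ?thesis by (rule that)
qed

lemma borel_measurable_frac_integrand:
  fixes f :: "'a::euclidean_space \<Rightarrow> 'b::{real_normed_vector, second_countable_topology}"
  assumes "f \<in> borel_measurable lebesgue" "\<rho> \<in> borel_measurable (lebesgue_on {0<..})"
  shows "frac_integrand \<rho> f x \<in> borel_measurable lebesgue"
proof -
  obtain \<rho>1 g where [measurable]: "\<rho>1 \<in> borel_measurable borel" "g \<in> borel_measurable borel"
    and eq: "\<And>x. AE y in lborel. frac_integrand \<rho> f x y = frac_integrand \<rho>1 g x y"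
    using frac_integrand_borel_version[OF assms] by blast
  have "frac_integrand \<rho>1 g x \<in> borel_measurable lborel"
    unfolding frac_integrand_def by measurable
  then have "frac_integrand \<rho>1 g x \<in> borel_measurable lebesgue"
    by (rule measurable_completion)
  then show ?thesis
    by (rule borel_measurable_lebesgue_cong_AE) (use eq[of x] in eventually_elim, simp)
qed

text \<open>One pair of Borel functions represents the integrand for every x, up to a null set of y
  depending on x. At every x the integral therefore equals that of a jointly Borel kernel, also
  where both are 0 by the convention for non-integrable functions.\<close>

lemma borel_measurable_frac_integral:
  fixes f :: "'a::euclidean_space \<Rightarrow> 'b::{banach, second_countable_topology}"
  assumes "f \<in> borel_measurable lebesgue" "\<rho> \<in> borel_measurable (lebesgue_on {0<..})"
  shows "frac_integral \<rho> f \<in> borel_measurable lebesgue"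
proof -
  obtain \<rho>1 g where [measurable]: "\<rho>1 \<in> borel_measurable borel" "g \<in> borel_measurable borel"
    and eq: "\<And>x. AE y in lborel. frac_integrand \<rho> f x y = frac_integrand \<rho>1 g x y"
    using frac_integrand_borel_version[OF assms] by blast
  have meas: "(\<lambda>(x, y). frac_integrand \<rho>1 g x y) \<in> borel_measurable (lborel \<Otimes>\<^sub>M lborel)"
    unfolding frac_integrand_def by measurable
  have "frac_integral \<rho> f x = (\<integral>y. frac_integrand \<rho>1 g x y \<partial>lborel)" for x
  proof -
    have m: "frac_integrand \<rho>1 g x \<in> borel_measurable lborel"
      unfolding frac_integrand_def by measurable
    have "frac_integral \<rho> f x = (\<integral>y. frac_integrand \<rho>1 g x y \<partial>lebesgue)"
      unfolding frac_integral_def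
      using borel_measurable_frac_integrand[OF assms] measurable_completion[OF m]
      by (intro integral_cong_AE AE_completion eq)
    also have "\<dots> = (\<integral>y. frac_integrand \<rho>1 g x y \<partial>lborel)"
      using m by (rule integral_completion)
    finally show ?thesis .
  qed
  moreover have "(\<lambda>x. \<integral>y. frac_integrand \<rho>1 g x y \<partial>lborel) \<in> borel_measurable lborel"
    using meas by (rule lborel.borel_measurable_lebesgue_integral)
  ultimately have "frac_integral \<rho> f \<in> borel_measurable lborel"
    by (simp add: fun_eq_iff[symmetric] cong: measurable_cong)
  then show ?thesis by (rule measurable_completion)
qed

lemma frac_integral_leI:
  fixes f :: "'a::euclidean_space \<Rightarrow> 'b::{banach, second_countable_topology}"
  assumes "f \<in> borel_measurable lebesgue" "\<rho> \<in> borel_measurable (lebesgue_on {0<..})"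
    and le: "(\<integral>\<^sup>+y. ennreal (norm (frac_integrand \<rho> f x y)) \<partial>lebesgue) \<le> R"
  shows "frac_integral_le \<rho> f x R"
proof (cases "R < \<infinity>")
  case True
  have int: "integrable lebesgue (frac_integrand \<rho> f x)"
    using borel_measurable_frac_integrand[OF assms(1,2)] le_less_trans[OF le True]
    by (rule integrableI_bounded)
  have "ennreal (norm (frac_integral \<rho> f x)) \<le> R"
    unfolding frac_integral_def by (rule order_trans[OF integral_norm_bound_ennreal[OF int] le])
  then show ?thesis using int by (simp add: frac_integral_le_def frac_integral_defined_def)
next
  case False
  then have "R = top" by (simp add: less_top[symmetric])
  then show ?thesis by (simp add: frac_integral_le_def)
qed

section \<open>Degenerate values in Hedberg's inequality\<close>

lemma ennreal_powr_vanishing: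
  assumes "0 < a" "0 < K" and le: "\<And>m. 0 < m \<Longrightarrow> J \<le> ennreal (K * m powr a)"
  shows "J = 0"
proof -
  have "J \<le> 0 + ennreal e" if "0 < e" for e
    using le[of "(e / K) powr (1 / a)"] assms(1,2) that by (simp add: powr_powr)
  then have "J \<le> 0" by (rule ennreal_le_epsilon)
  then show ?thesis by simp
qed

text \<open>Averages over balls are bounded by a multiple of N for every N > 0, so they vanish. This
  is the case of norm zero.\<close>

lemma maximal_fun_eq_0:
  fixes f :: "'a::euclidean_space \<Rightarrow> 'b::{real_normed_vector, second_countable_topology}"
  assumes f: "f \<in> borel_measurable lebesgue" and p: "1 \<le> p" and \<phi>: "\<And>r. 0 < r \<Longrightarrow> 0 < \<phi> r"
    and tail: "\<And>N. 0 < N \<Longrightarrow> tail_bound p \<phi> f N"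
  shows "maximal_fun f x = 0"
proof (rule ccontr)
  assume "maximal_fun f x \<noteq> 0"
  then have "0 < maximal_fun f x" by (simp add: zero_less_iff_neq_zero)
  then obtain a r where r: "0 < r" "0 < (\<integral>\<^sup>+y\<in>ball a r. ennreal (norm (f y)) \<partial>lebesgue)"
    unfolding less_maximal_fun_iff by auto
  obtain V where V: "emeasure lebesgue (ball a r) = ennreal V" "0 < V"
    using emeasure_lebesgue_ball[of r a] r(1) by (metis less_imp_le mult_pos_pos of_nat_0_le_iff unit_ball_vol_pos zero_less_power)
  have "(\<integral>\<^sup>+y\<in>ball a r. ennreal (norm (f y)) \<partial>lebesgue) = 0"
  proof (rule ennreal_powr_vanishing)
    fix N :: real assume N: "0 < N"
    have "(\<integral>\<^sup>+y\<in>ball a r. ennreal (norm (f y)) \<partial>lebesgue) \<le>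
        ennreal (2 * N * \<phi> r powr (1 / p)) * emeasure lebesgue (ball a r)"
      using f p N \<phi> tail[OF N] r(1) by (rule tail_bound_average)
    also have "\<dots> = ennreal (2 * \<phi> r powr (1 / p) * V * N powr 1)"
      unfolding V(1) using N V(2) by (simp add: ennreal_mult[symmetric] mult_ac)
    finally show "(\<integral>\<^sup>+y\<in>ball a r. ennreal (norm (f y)) \<partial>lebesgue) \<le>
        ennreal (2 * \<phi> r powr (1 / p) * V * N powr 1)" .
  qed (use V \<phi>[OF r(1)] in auto)
  with r(2) show False by simp
qed

text \<open>Passes from majorants to the exact values M and X. For M = 0 the majorant m tends to 0.
  Otherwise \<open>Z\<close> excludes X = 0, so M = \<infinity> makes the right-hand side infinite
  instead of \<infinity> * 0 = 0.\<close>

lemma hedberg_ennreal: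
  assumes "0 < \<alpha>" "\<alpha> < 1" "0 < K" "X < \<infinity>"
    and H: "\<And>N m. 0 < N \<Longrightarrow> X \<le> ennreal N \<Longrightarrow> 0 < m \<Longrightarrow> M \<le> ennreal m \<Longrightarrow>
      J \<le> ennreal (K * m powr \<alpha> * N powr (1 - \<alpha>))"
    and Z: "X = 0 \<Longrightarrow> M = 0"
  shows "J \<le> ennreal K * enn_powr M \<alpha> * enn_powr X (1 - \<alpha>)"
proof -
  obtain N where N: "X = ennreal N" "0 \<le> N" using assms(4) by (cases X) auto
  show ?thesis
  proof (cases "M = 0")
    case True
    have "J \<le> ennreal (K * (N + 1) powr (1 - \<alpha>) * m powr \<alpha>)" if "0 < m" for m
      using H[of "N + 1" m] that N True by (simp add: mult_ac)
    then have "J = 0"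
      using ennreal_powr_vanishing[of \<alpha> "K * (N + 1) powr (1 - \<alpha>)" J] assms(1,3) N(2) by simp
    then show ?thesis by simp
  next
    case False
    then have N0: "0 < N" using Z N by (cases "N = 0") auto
    show ?thesis
    proof (cases M)
      case (real m)
      then have m: "0 < m" using False by (cases "m = 0") auto
      have "J \<le> ennreal (K * m powr \<alpha> * N powr (1 - \<alpha>))"
        using H[of N m] N0 N(1) m real by simp
      also have "\<dots> = ennreal K * enn_powr M \<alpha> * enn_powr X (1 - \<alpha>)"
        using real N N0 m assms(3) by (simp add: enn_powr_ennreal ennreal_mult)
      finally show ?thesis .
    next
      case top
      then have "ennreal K * enn_powr M \<alpha> * enn_powr X (1 - \<alpha>) = top"
        using N N0 assms(3) by (simp add: enn_powr_ennreal ennreal_mult_top ennreal_top_mult)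
      then show ?thesis by simp
    qed
  qed
qed

text \<open>X stands for either the strong or the weak norm, and c for the loss in passing from that
  norm to a tail bound; it enters the estimate with the power 1 - p/q of the norm.\<close>

lemma hedberg_frac_integral_le:
  fixes p q :: real
  assumes \<phi>: "\<phi> \<in> G_dec DIM('a::euclidean_space)" and p: "1 \<le> p" "p < q"
    and \<phi>_meas: "\<phi> \<in> borel_measurable (lebesgue_on {0<..})"
    and pos: "\<forall>t>0. 0 < \<rho> t"
    and \<rho>: "\<rho> \<in> borel_measurable (lebesgue_on {0<..})"
    and C: "0 < C" "0 < K1" "K1 < K2"
    and growth: "\<forall>s>0.
      ennreal (\<rho> s) \<le> ennreal C * (\<integral>\<^sup>+t\<in>{K1 * s<..<K2 * s}. ennreal (\<rho> t / t) \<partial>lebesgue)"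
    and lim0: "filterlim \<phi> at_top (at_right 0)" and lim1: "(\<phi> \<longlongrightarrow> 0) at_top"
    and A: "0 < A" "full_cond \<rho> \<phi> p q A"
  shows "\<exists>K>0. \<forall>(f :: 'a \<Rightarrow> 'b::{banach, second_countable_topology}) X c.
    f \<in> borel_measurable lebesgue \<longrightarrow> X < \<infinity> \<longrightarrow> 0 < c \<longrightarrow>
    (\<forall>N>0. X \<le> ennreal N \<longrightarrow> tail_bound p \<phi> f (c * N)) \<longrightarrow>
    (\<forall>x. frac_integral_le \<rho> f x (ennreal (K * c powr (1 - p / q)) * enn_powr (maximal_fun f x) (p / q) *
      enn_powr X (1 - p / q)))"
proof -
  obtain K where K: "0 < K" "\<forall>(f :: 'a \<Rightarrow> 'b) N m x.
    f \<in> borel_measurable lebesgue \<longrightarrow> 0 < N \<longrightarrow> tail_bound p \<phi> f N \<longrightarrow>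
    0 < m \<longrightarrow> maximal_fun f x \<le> ennreal m \<longrightarrow>
    (\<integral>\<^sup>+y. ennreal (norm (frac_integrand \<rho> f x y)) \<partial>lebesgue) \<le>
      ennreal (K * m powr (p / q) * N powr (1 - p / q))"
    using hedberg_inequality[OF \<phi> p \<phi>_meas pos \<rho> C growth lim0 lim1 A, where 'b = 'b] by (elim exE conjE)
  show ?thesis
  proof (intro exI[of _ K] conjI allI impI K(1))
    fix f :: "'a \<Rightarrow> 'b" and X c x
    assume f: "f \<in> borel_measurable lebesgue" and X: "X < \<infinity>" and c: "0 < c"
      and tail: "\<forall>N>0. X \<le> ennreal N \<longrightarrow> tail_bound p \<phi> f (c * N)"
    show "frac_integral_le \<rho> f x (ennreal (K * c powr (1 - p / q)) * enn_powr (maximal_fun f x) (p / q) *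
        enn_powr X (1 - p / q))"
    proof (rule frac_integral_leI[OF f \<rho>], rule hedberg_ennreal)
      show "(\<integral>\<^sup>+y. ennreal (norm (frac_integrand \<rho> f x y)) \<partial>lebesgue) \<le>
          ennreal (K * c powr (1 - p / q) * m powr (p / q) * N powr (1 - p / q))"
        if N: "0 < N" "X \<le> ennreal N" and m: "0 < m" "maximal_fun f x \<le> ennreal m" for N m
      proof -
        have "(\<integral>\<^sup>+y. ennreal (norm (frac_integrand \<rho> f x y)) \<partial>lebesgue) \<le>
            ennreal (K * m powr (p / q) * (c * N) powr (1 - p / q))"
          using f N m c tail by (intro K(2)[rule_format]) auto
        then show ?thesis using c N(1) by (simp add: powr_mult mult_ac)
      qed
      show "maximal_fun f x = 0" if "X = 0"
      proof (rule maximal_fun_eq_0[OF f p(1)])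
        show "tail_bound p \<phi> f N" if N: "0 < N" for N
          using tail[rule_format, of "N / c"] N c \<open>X = 0\<close> by simp
        show "0 < \<phi> r" if "0 < r" for r using \<phi> that by (rule G_dec_pos)
      qed
    qed (use p K(1) c X in auto)
  qed
qed

section \<open>Boundedness of the fractional integral\<close>

text \<open>On a ball the weak bound estimates the measure of {Mf > 1/m} by a multiple of m^p, and
  {Mf = \<infinity>} lies in all these sets. Balls of integer radius exhaust the space.\<close>

lemma AE_maximal_fun_finite:
  fixes f :: "'a::euclidean_space \<Rightarrow> 'b::{real_normed_vector, second_countable_topology}"
  assumes \<phi>: "\<phi> \<in> G_dec DIM('a)" and p: "1 \<le> p"
    and f: "f \<in> borel_measurable lebesgue" "0 < N" "tail_bound p \<phi> f N"
  shows "AE x in lebesgue. maximal_fun f x < \<infinity>"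
proof -
  obtain K where K: "0 < K"
    "\<forall>(f :: 'a \<Rightarrow> 'b) N a r t.
      f \<in> borel_measurable lebesgue \<longrightarrow> 0 < N \<longrightarrow> tail_bound p \<phi> f N \<longrightarrow> 0 < r \<longrightarrow> 0 < t \<longrightarrow>
      ennreal (t powr p) * emeasure lebesgue {x \<in> ball a r. ennreal t < maximal_fun f x} \<le>
        ennreal (K * N powr p * \<phi> r) * emeasure lebesgue (ball a r)"
    using weak_maximal_bound[OF \<phi> p, where 'b = 'b] by (elim exE conjE)
  note [measurable] = lebesgue_measurable_maximal_fun[of f]
  have "{x \<in> ball 0 (real (Suc k)). maximal_fun f x = \<infinity>} \<in> null_sets lebesgue" for k
  proof -
    let ?r = "real (Suc k)" let ?E = "{x \<in> ball (0::'a) ?r. maximal_fun f x = \<infinity>}"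
    have E: "?E \<in> sets lebesgue" by measurable
    have level: "{x \<in> ball (0::'a) ?r. ennreal t < maximal_fun f x} \<in> sets lebesgue" for t by measurable
    obtain W where W: "ennreal (K * N powr p * \<phi> ?r) * emeasure lebesgue (ball (0::'a) ?r) = ennreal W" "0 \<le> W"
      using emeasure_lebesgue_ball_finite[of "0::'a" ?r]
      by (cases "ennreal (K * N powr p * \<phi> ?r) * emeasure lebesgue (ball (0::'a) ?r)")
         (auto simp: ennreal_mult_eq_top_iff)
    have "emeasure lebesgue ?E = 0"
    \<comment> \<open>\<open>W\<close> may be 0, whereas the vanishing lemma asks for a positive
      constant. The variable m is the reciprocal of the level.\<close>
    proof (rule ennreal_powr_vanishing[of p "W + 1"])
      fix m :: real assume m: "0 < m"
      have "ennreal ((1 / m) powr p) * emeasure lebesgue ?E \<le>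
          ennreal ((1 / m) powr p) * emeasure lebesgue {x \<in> ball 0 ?r. ennreal (1 / m) < maximal_fun f x}"
        by (intro mult_left_mono emeasure_mono level) auto
      also have "\<dots> \<le> ennreal W"
        unfolding W(1)[symmetric] using m by (intro K(2)[rule_format] f) auto
      finally have "ennreal (m powr p) * (ennreal ((1 / m) powr p) * emeasure lebesgue ?E) \<le> ennreal (m powr p) * ennreal W"
        by (rule mult_left_mono) simp
      also have "ennreal (m powr p) * (ennreal ((1 / m) powr p) * emeasure lebesgue ?E) = emeasure lebesgue ?E"
        using m by (subst ennreal_mult_left_assoc) (simp_all add: powr_divide)
      also have "ennreal (m powr p) * ennreal W \<le> ennreal ((W + 1) * m powr p)"
        using W(2) by (subst ennreal_mult[symmetric]) (auto intro!: ennreal_leI simp: algebra_simps)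
      finally show "emeasure lebesgue ?E \<le> ennreal ((W + 1) * m powr p)" .
    qed (use p W in auto)
    then show ?thesis using E by (simp add: null_setsI)
  qed
  then have "(\<Union>k. {x \<in> ball 0 (real (Suc k)). maximal_fun f x = \<infinity>}) \<in> null_sets lebesgue"
    by (rule null_sets_UN)
  moreover have "(\<Union>k. {x \<in> ball 0 (real (Suc k)). maximal_fun f x = \<infinity>}) = {x. maximal_fun f x = \<infinity>}"
  proof -
    have "\<exists>k. x \<in> ball 0 (real (Suc k))" for x :: 'a
    proof -
      obtain n where "norm x < real n" using reals_Archimedean2 by blast
      then have "x \<in> ball 0 (real (Suc n))" by simp
      then show ?thesis by blast
    qed
    then show ?thesis by auto
  qed
  ultimately have "{x. maximal_fun f x = \<infinity>} \<in> null_sets lebesgue" by simp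
  then show ?thesis
    by (rule AE_I') (auto simp: less_top[symmetric])
qed

text \<open>The pointwise inequality asserts convergence only where its right-hand side is finite;
  this fails at most where the maximal function is infinite.\<close>

lemma frac_integral_defined_AE:
  fixes f :: "'a::euclidean_space \<Rightarrow> 'b::{banach, second_countable_topology}"
  assumes \<phi>: "\<phi> \<in> G_dec DIM('a)" and p: "1 \<le> p"
    and f: "f \<in> borel_measurable lebesgue" "0 < N" "tail_bound p \<phi> f N"
    and X: "X < \<infinity>"
    and le: "\<And>x. frac_integral_le \<rho> f x (ennreal K * enn_powr (maximal_fun f x) \<alpha> * enn_powr X \<beta>)"
  shows "AE x in lebesgue. frac_integral_defined \<rho> f x"
  using AE_maximal_fun_finite[OF \<phi> p f]
proof eventually_elim
  case (elim x)
  then have "ennreal K * enn_powr (maximal_fun f x) \<alpha> * enn_powr X \<beta> < \<infinity>"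
    using X by (auto simp: enn_powr_def ennreal_mult_less_top)
  then show ?case using le[of x] by (simp add: frac_integral_le_def)
qed

text \<open>Hedberg's inequality solved for the maximal function. In this form it carries level sets
  and powers of the fractional integral over to those of Mf.\<close>

lemma maximal_fun_lower_bound:
  fixes f :: "'a::euclidean_space \<Rightarrow> 'b::{banach, second_countable_topology}"
  assumes "0 < \<alpha>" "0 < K" "0 < N"
    and le: "frac_integral_le \<rho> f x (ennreal K * enn_powr (maximal_fun f x) \<alpha> * enn_powr (ennreal N) \<beta>)"
  shows "ennreal ((norm (frac_integral \<rho> f x) / (K * N powr \<beta>)) powr (1 / \<alpha>)) \<le> maximal_fun f x"
proof (cases "maximal_fun f x")
  case (real m)
  have "ennreal (norm (frac_integral \<rho> f x)) \<le> ennreal (K * m powr \<alpha> * N powr \<beta>)"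
    using le real assms by (simp add: frac_integral_le_def enn_powr_ennreal ennreal_mult)
  then have "norm (frac_integral \<rho> f x) \<le> K * m powr \<alpha> * N powr \<beta>"
    using assms by (simp add: ennreal_le_iff)
  then have "norm (frac_integral \<rho> f x) / (K * N powr \<beta>) \<le> m powr \<alpha>"
    using assms by (simp add: field_simps)
  then have "(norm (frac_integral \<rho> f x) / (K * N powr \<beta>)) powr (1 / \<alpha>) \<le> (m powr \<alpha>) powr (1 / \<alpha>)"
    using assms by (intro powr_mono2) auto
  also have "\<dots> = m" using assms real by (simp add: powr_powr)
  finally show ?thesis using real by (simp add: ennreal_leI)
qed simp

text \<open>Since \<infinity> * 0 = 0, the inequality forces the value 0 even at points where M is
  infinite.\<close>

lemma frac_integral_zero:
  assumes "0 < \<beta>" "frac_integral_le \<rho> f x (ennreal K * M * enn_powr 0 \<beta>)"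
  shows "frac_integral \<rho> f x = 0"
  using assms(2) by (simp add: frac_integral_le_def)

text \<open>The level t of the fractional integral corresponds to a level s of Mf with t^q = (K
  N^\<beta>)^q s^p, so the weak bound with exponent p for Mf is the desired one with exponent q.
  Homogeneity is restored by \<beta> q + p = q.\<close>

lemma weak_norm_frac_integral:
  assumes \<phi>: "\<phi> \<in> G_dec DIM('a::euclidean_space)" and p: "1 \<le> p" "p < q" and K: "0 < K" and c: "0 < c"
  shows "\<exists>K'>0. \<forall>(f :: 'a \<Rightarrow> 'b::{banach, second_countable_topology}) X.
    f \<in> borel_measurable lebesgue \<longrightarrow> X < \<infinity> \<longrightarrow>
    (\<forall>N>0. X \<le> ennreal N \<longrightarrow> tail_bound p \<phi> f (c * N)) \<longrightarrow>
    (\<forall>x. frac_integral_le \<rho> f x (ennreal K * enn_powr (maximal_fun f x) (p / q) * enn_powr X (1 - p / q))) \<longrightarrow>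
    weak_morrey_norm q \<phi> (frac_integral \<rho> f) \<le> ennreal K' * X"
proof -
  obtain L where L: "0 < L"
    "\<forall>(f :: 'a \<Rightarrow> 'b) N a r t.
      f \<in> borel_measurable lebesgue \<longrightarrow> 0 < N \<longrightarrow> tail_bound p \<phi> f N \<longrightarrow> 0 < r \<longrightarrow> 0 < t \<longrightarrow>
      ennreal (t powr p) * emeasure lebesgue {x \<in> ball a r. ennreal t < maximal_fun f x} \<le>
        ennreal (L * N powr p * \<phi> r) * emeasure lebesgue (ball a r)"
    using weak_maximal_bound[OF \<phi> p(1), where 'b = 'b] by (elim exE conjE)
  have \<phi>_pos: "0 < \<phi> r" if "0 < r" for r using \<phi> that by (rule G_dec_pos)
  have \<phi>_all: "\<forall>r>0. 0 < \<phi> r" using \<phi>_pos by blast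
  \<comment> \<open>K'^q is K^q from Hedberg's inequality times L c^p from the weak maximal bound
    with majorant c N.\<close>
  define K' where "K' = K * (L * c powr p) powr (1 / q)"
  have K': "0 < K'" using K L(1) c by (simp add: K'_def)
  define \<beta> where "\<beta> = 1 - p / q"
  have q: "0 < q" "0 < \<beta>" using p by (auto simp: \<beta>_def)
  show ?thesis
  proof (intro exI[of _ K'] conjI allI impI K')
    fix f :: "'a \<Rightarrow> 'b" and X
    assume f: "f \<in> borel_measurable lebesgue" and X: "X < \<infinity>"
      and tail: "\<forall>N>0. X \<le> ennreal N \<longrightarrow> tail_bound p \<phi> f (c * N)"
      and le: "\<forall>x. frac_integral_le \<rho> f x (ennreal K * enn_powr (maximal_fun f x) (p / q) * enn_powr X (1 - p / q))"
    obtain N where N: "X = ennreal N" "0 \<le> N" using X by (cases X) auto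
    have "weak_morrey_norm q \<phi> (frac_integral \<rho> f) \<le> ennreal (K' * N)"
      unfolding weak_morrey_norm_le_iff[OF q(1) mult_nonneg_nonneg[OF less_imp_le[OF K'] N(2)] \<phi>_all]
    proof (intro allI impI)
      fix a :: 'a and r t :: real assume r: "0 < r" and t: "0 < t"
      show "ennreal (t powr q) * distr_fun (ball a r) (frac_integral \<rho> f) t \<le>
          ennreal ((K' * N) powr q * \<phi> r) * emeasure lebesgue (ball a r)"
      proof (cases "N = 0")
        case True
        have "frac_integral \<rho> f x = 0" for x
          using frac_integral_zero[OF q(2), of \<rho> f x K "enn_powr (maximal_fun f x) (p / q)"] le N(1) True
          by (simp add: \<beta>_def)
        then show ?thesis using t by (simp add: distr_fun_def)
      next
        case False
        then have N0: "0 < N" using N(2) by simp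
        define s where "s = (t / (K * N powr \<beta>)) powr (1 / (p / q))"
        have s: "0 < s" using t K N0 by (simp add: s_def)
        have "distr_fun (ball a r) (frac_integral \<rho> f) t \<le>
            emeasure lebesgue {x \<in> ball a r. ennreal s < maximal_fun f x}"
          unfolding distr_fun_def
        proof (rule emeasure_mono)
          note [measurable] = lebesgue_measurable_maximal_fun[of f]
          show "{x \<in> ball a r. ennreal s < maximal_fun f x} \<in> sets lebesgue" by measurable
          show "{x \<in> ball a r. t < norm (frac_integral \<rho> f x)} \<subseteq> {x \<in> ball a r. ennreal s < maximal_fun f x}"
          proof safe
            fix x assume x: "t < norm (frac_integral \<rho> f x)"
            have "s < (norm (frac_integral \<rho> f x) / (K * N powr \<beta>)) powr (1 / (p / q))"
              unfolding s_def using x t K N0 p by (intro powr_less_mono2 divide_strict_right_mono) auto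
            then have "ennreal s < ennreal ((norm (frac_integral \<rho> f x) / (K * N powr \<beta>)) powr (1 / (p / q)))"
              using s by (intro ennreal_lessI) auto
            also have "\<dots> \<le> maximal_fun f x"
              using le N(1) K N0 p by (intro maximal_fun_lower_bound) (auto simp: \<beta>_def)
            finally show "ennreal s < maximal_fun f x" .
          qed
        qed
        then have "ennreal (t powr q) * distr_fun (ball a r) (frac_integral \<rho> f) t \<le>
            ennreal (t powr q) * emeasure lebesgue {x \<in> ball a r. ennreal s < maximal_fun f x}"
          by (rule mult_left_mono) simp
        also have "\<dots> = ennreal ((K * N powr \<beta>) powr q) * (ennreal (s powr p) * emeasure lebesgue {x \<in> ball a r. ennreal s < maximal_fun f x})"
        proof -
          have "t powr q = (K * N powr \<beta>) powr q * s powr p"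
            using t K N0 p by (simp add: s_def powr_powr powr_mult powr_divide)
          then show ?thesis by (simp add: ennreal_mult_left_assoc)
        qed
        also have "\<dots> \<le> ennreal ((K * N powr \<beta>) powr q) * (ennreal (L * (c * N) powr p * \<phi> r) * emeasure lebesgue (ball a r))"
          using N(1) N0 c r s tail f by (intro mult_left_mono L(2)[rule_format]) auto
        also have "\<dots> = ennreal ((K * N powr \<beta>) powr q * (L * (c * N) powr p * \<phi> r)) * emeasure lebesgue (ball a r)"
          by (rule ennreal_mult_left_assoc) simp
        also have "(K * N powr \<beta>) powr q * (L * (c * N) powr p * \<phi> r) = (K' * N) powr q * \<phi> r"
        proof -
          have "N powr (\<beta> * q) * N powr p = N powr q"
            using q p N0 by (simp add: \<beta>_def powr_add[symmetric] algebra_simps)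
          moreover have "(K * N powr \<beta>) powr q * (L * (c * N) powr p * \<phi> r) =
              K powr q * (L * c powr p) * (N powr (\<beta> * q) * N powr p) * \<phi> r"
            using K N0 c by (simp add: powr_mult powr_powr)
          moreover have "(K' * N) powr q = K powr q * (L * c powr p) * N powr q"
            using K N0 c L(1) q by (simp add: K'_def powr_mult powr_powr)
          ultimately show ?thesis by simp
        qed
        finally show ?thesis .
      qed
    qed
    then show "weak_morrey_norm q \<phi> (frac_integral \<rho> f) \<le> ennreal K' * X"
      using K' N by (simp add: ennreal_mult)
  qed
qed

text \<open>After division by K N^\<beta>, the power q/p of the norm of the fractional integral is a
  real function g below Mf, and its p-th power is the q-th power to be integrated. This is the
  situation of \<open>strong_maximal_bound\<close>.\<close>

lemma strong_norm_frac_integral: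
  assumes \<phi>: "\<phi> \<in> G_dec DIM('a::euclidean_space)" and p: "1 < p" "p < q" and K: "0 < K"
    and \<rho>: "\<rho> \<in> borel_measurable (lebesgue_on {0<..})"
  shows "\<exists>K'>0. \<forall>f :: 'a \<Rightarrow> 'b::{banach, second_countable_topology}.
    f \<in> borel_measurable lebesgue \<longrightarrow> morrey_norm p \<phi> f < \<infinity> \<longrightarrow>
    (\<forall>x. frac_integral_le \<rho> f x (ennreal K * enn_powr (maximal_fun f x) (p / q) *
      enn_powr (morrey_norm p \<phi> f) (1 - p / q))) \<longrightarrow>
    morrey_norm q \<phi> (frac_integral \<rho> f) \<le> ennreal K' * morrey_norm p \<phi> f"
proof -
  obtain L where L: "0 < L"
    "\<forall>(f :: 'a \<Rightarrow> 'b) g N a r.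
      f \<in> borel_measurable lebesgue \<longrightarrow> 0 < N \<longrightarrow>
      (\<forall>a r. 0 < r \<longrightarrow> (\<integral>\<^sup>+x\<in>ball a r. ennreal (norm (f x) powr p) \<partial>lebesgue)
        \<le> ennreal (N powr p * \<phi> r) * emeasure lebesgue (ball a r)) \<longrightarrow>
      g \<in> borel_measurable lebesgue \<longrightarrow> (\<forall>x. 0 \<le> g x) \<longrightarrow> (\<forall>x. ennreal (g x) \<le> maximal_fun f x) \<longrightarrow>
      0 < r \<longrightarrow>
      (\<integral>\<^sup>+x\<in>ball a r. ennreal (g x powr p) \<partial>lebesgue) \<le>
        ennreal (L * N powr p * \<phi> r) * emeasure lebesgue (ball a r)"
    using strong_maximal_bound[OF \<phi> p(1), where 'b = 'b] by (elim exE conjE)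
  have \<phi>_pos: "0 < \<phi> r" if "0 < r" for r using \<phi> that by (rule G_dec_pos)
  have \<phi>_all: "\<forall>r>0. 0 < \<phi> r" using \<phi>_pos by blast
  define K' where "K' = K * L powr (1 / q)"
  have K': "0 < K'" using K L(1) by (simp add: K'_def)
  define \<beta> where "\<beta> = 1 - p / q"
  have q: "0 < q" "0 < \<beta>" "0 < p" using p by (auto simp: \<beta>_def)
  show ?thesis
  proof (intro exI[of _ K'] conjI allI impI K')
    fix f :: "'a \<Rightarrow> 'b"
    assume f: "f \<in> borel_measurable lebesgue" and X: "morrey_norm p \<phi> f < \<infinity>"
      and le: "\<forall>x. frac_integral_le \<rho> f x (ennreal K * enn_powr (maximal_fun f x) (p / q) *
        enn_powr (morrey_norm p \<phi> f) (1 - p / q))"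
    obtain N where N: "morrey_norm p \<phi> f = ennreal N" "0 \<le> N" using X by (cases "morrey_norm p \<phi> f") auto
    have "morrey_norm q \<phi> (frac_integral \<rho> f) \<le> ennreal (K' * N)"
      unfolding morrey_norm_le_iff[OF q(1) mult_nonneg_nonneg[OF less_imp_le[OF K'] N(2)] \<phi>_all]
    proof (intro allI impI)
      fix a :: 'a and r :: real assume r: "0 < r"
      show "(\<integral>\<^sup>+x\<in>ball a r. ennreal (norm (frac_integral \<rho> f x) powr q) \<partial>lebesgue) \<le>
          ennreal ((K' * N) powr q * \<phi> r) * emeasure lebesgue (ball a r)"
      proof (cases "N = 0")
        case True
        have "frac_integral \<rho> f x = 0" for x
          using frac_integral_zero[OF q(2), of \<rho> f x K "enn_powr (maximal_fun f x) (p / q)"] le N(1) True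
          by (simp add: \<beta>_def)
        then show ?thesis using q by simp
      next
        case False
        then have N0: "0 < N" using N(2) by simp
        define g where "g x = (norm (frac_integral \<rho> f x) / (K * N powr \<beta>)) powr (1 / (p / q))" for x
        have If: "frac_integral \<rho> f \<in> borel_measurable lebesgue"
          using f \<rho> by (rule borel_measurable_frac_integral)
        note [measurable] = this
        have g[measurable]: "g \<in> borel_measurable lebesgue" unfolding g_def by measurable
        have g_eq: "norm (frac_integral \<rho> f x) powr q = (K * N powr \<beta>) powr q * g x powr p" for x
          using K N0 p by (simp add: g_def powr_powr powr_mult powr_divide)
        have "(\<integral>\<^sup>+x\<in>ball a r. ennreal (norm (frac_integral \<rho> f x) powr q) \<partial>lebesgue) =
            (\<integral>\<^sup>+x. ennreal ((K * N powr \<beta>) powr q) * (ennreal (g x powr p) * indicator (ball a r) x) \<partial>lebesgue)"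
          unfolding g_eq by (simp add: ennreal_mult mult.assoc)
        also have "\<dots> = ennreal ((K * N powr \<beta>) powr q) * (\<integral>\<^sup>+x\<in>ball a r. ennreal (g x powr p) \<partial>lebesgue)"
          by (rule nn_integral_cmult) measurable
        also have "\<dots> \<le> ennreal ((K * N powr \<beta>) powr q) * (ennreal (L * N powr p * \<phi> r) * emeasure lebesgue (ball a r))"
        proof (intro mult_left_mono)
          have "\<forall>a r. 0 < r \<longrightarrow> (\<integral>\<^sup>+x\<in>ball a r. ennreal (norm (f x) powr p) \<partial>lebesgue)
              \<le> ennreal (N powr p * \<phi> r) * emeasure lebesgue (ball a r)"
            using morrey_norm_le_iff[OF q(3) N(2) \<phi>_all, of f] N(1) by simp
          moreover have "\<forall>x. ennreal (g x) \<le> maximal_fun f x"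
            using le N(1) K N0 p unfolding g_def by (intro allI maximal_fun_lower_bound) (auto simp: \<beta>_def)
          moreover have "\<forall>x. 0 \<le> g x" by (simp add: g_def)
          ultimately show "(\<integral>\<^sup>+x\<in>ball a r. ennreal (g x powr p) \<partial>lebesgue) \<le>
              ennreal (L * N powr p * \<phi> r) * emeasure lebesgue (ball a r)"
            using L(2) f g N0 r by blast
        qed simp
        also have "\<dots> = ennreal ((K * N powr \<beta>) powr q * (L * N powr p * \<phi> r)) * emeasure lebesgue (ball a r)"
          by (rule ennreal_mult_left_assoc) simp
        also have "(K * N powr \<beta>) powr q * (L * N powr p * \<phi> r) = (K' * N) powr q * \<phi> r"
        proof -
          have "N powr (\<beta> * q) * N powr p = N powr q"
            using q p N0 by (simp add: \<beta>_def powr_add[symmetric] algebra_simps)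
          moreover have "(K * N powr \<beta>) powr q * (L * N powr p * \<phi> r) =
              K powr q * L * (N powr (\<beta> * q) * N powr p) * \<phi> r"
            using K N0 by (simp add: powr_mult powr_powr)
          moreover have "(K' * N) powr q = K powr q * L * N powr q"
            using K N0 L(1) q by (simp add: K'_def powr_mult powr_powr)
          ultimately show ?thesis by simp
        qed
        finally show ?thesis .
      qed
    qed
    then show "morrey_norm q \<phi> (frac_integral \<rho> f) \<le> ennreal K' * morrey_norm p \<phi> f"
      using K' N by (simp add: ennreal_mult)
  qed
qed

section \<open>Necessity of the conditions\<close>

lemma borel_measurable_lebesgue_on_indicator:
  "S \<in> sets borel \<Longrightarrow> (\<lambda>t. indicator S t :: real) \<in> borel_measurable (lebesgue_on T)"
  by (intro measurable_restrict_space1 measurable_completion) simp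

lemma nn_integral_radial:
  fixes g :: "real \<Rightarrow> real" and x :: "'a::euclidean_space"
  assumes "g \<in> borel_measurable (lebesgue_on {0<..})"
  shows "(\<integral>\<^sup>+y. ennreal (g (norm (x - y))) \<partial>lebesgue) =
    ennreal (DIM('a) * unit_ball_vol DIM('a)) *
      (\<integral>\<^sup>+t\<in>{0<..}. ennreal (g t * t ^ (DIM('a) - 1)) \<partial>lebesgue)"
proof -
  obtain h where h[measurable]: "h \<in> borel_measurable borel" and eq: "AE t in lborel. 0 < t \<longrightarrow> g t = h t"
    using borel_measurable_Ioi_ex_borel[OF assms] by blast
  have "(\<integral>\<^sup>+y. ennreal (g (norm (x - y))) \<partial>lborel) = (\<integral>\<^sup>+y. ennreal (h (norm (x - y))) \<partial>lborel)"
    by (rule nn_integral_cong_AE) (use AE_lborel_norm_diff[OF eq, of x] in eventually_elim, simp)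
  also have "\<dots> = (\<integral>\<^sup>+y. ennreal (h (norm (y::'a))) \<partial>lborel)"
    by (rule nn_integral_lborel_reflect) measurable
  also have "\<dots> = ennreal (DIM('a) * unit_ball_vol DIM('a)) *
      (\<integral>\<^sup>+t\<in>{0<..}. ennreal (h t) * ennreal (t ^ (DIM('a) - 1)) \<partial>lborel)"
    by (rule nn_integral_norm_lborel) measurable
  also have "(\<integral>\<^sup>+t\<in>{0<..}. ennreal (h t) * ennreal (t ^ (DIM('a) - 1)) \<partial>lborel) =
      (\<integral>\<^sup>+t\<in>{0<..}. ennreal (g t * t ^ (DIM('a) - 1)) \<partial>lborel)"
  proof (rule nn_integral_cong_AE)
    show "AE t in lborel. ennreal (h t) * ennreal (t ^ (DIM('a) - 1)) * indicator {0<..} t =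
        ennreal (g t * t ^ (DIM('a) - 1)) * indicator {0<..} t"
      using eq by eventually_elim (auto simp: indicator_def ennreal_mult'')
  qed
  finally show ?thesis by (simp only: nn_integral_completion)
qed

text \<open>A Borel version of g composed with \<open>norm\<close> is Borel, and the composition
  changes only on a null set because null sets of radii have null preimages.\<close>

lemma borel_measurable_radial:
  fixes g :: "real \<Rightarrow> real"
  assumes "g \<in> borel_measurable (lebesgue_on {0<..})"
  shows "(\<lambda>y. g (norm (y::'a::euclidean_space))) \<in> borel_measurable lebesgue"
proof -
  obtain h where h[measurable]: "h \<in> borel_measurable borel" and eq: "AE t in lborel. 0 < t \<longrightarrow> g t = h t"
    using borel_measurable_Ioi_ex_borel[OF assms] by blast
  have "(\<lambda>y. h (norm (y::'a))) \<in> borel_measurable lborel" by measurable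
  then have "(\<lambda>y. h (norm (y::'a))) \<in> borel_measurable lebesgue" by (rule measurable_completion)
  then show ?thesis
    by (rule borel_measurable_lebesgue_cong_AE)
      (use AE_lborel_norm_diff[OF eq, of "0::'a"] in eventually_elim, simp)
qed

text \<open>Nonnegative multiples of the unit admit no cancellation, and the unit has norm 1; the
  norm of the Bochner integral is then the nonnegative integral, provided the former
  converges.\<close>

lemma frac_integral_scaleR_one:
  fixes g :: "'a::euclidean_space \<Rightarrow> real"
  assumes pos: "\<And>t. 0 < t \<Longrightarrow> 0 < \<rho> t" and g: "\<And>y. 0 \<le> g y"
    and def: "frac_integral_defined \<rho> (\<lambda>y. g y *\<^sub>R (1::'b::{real_normed_field, banach, second_countable_topology})) x"
  shows "ennreal (norm (frac_integral \<rho> (\<lambda>y. g y *\<^sub>R (1::'b)) x)) =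
    (\<integral>\<^sup>+y. ennreal (\<rho> (norm (x - y)) / norm (x - y) ^ DIM('a) * g y) \<partial>lebesgue)"
proof -
  define h where "h y = \<rho> (norm (x - y)) / norm (x - y) ^ DIM('a) * g y" for y
  \<comment> \<open>At y = x the sign of \<open>\<rho> 0\<close> is unknown, but the quotient is 0
    there because division by 0 yields 0.\<close>
  have h: "0 \<le> h y" for y
    using pos[of "norm (x - y)"] g[of y] by (cases "x = y") (auto simp: h_def zero_power)
  have eq: "frac_integrand \<rho> (\<lambda>y. g y *\<^sub>R (1::'b)) x = (\<lambda>y. h y *\<^sub>R 1)"
    by (simp add: frac_integrand_def h_def fun_eq_iff)
  have "integrable lebesgue (\<lambda>y. norm (h y *\<^sub>R (1::'b)))"
    using def unfolding frac_integral_defined_def eq by (rule integrable_norm)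
  then have int: "integrable lebesgue h" using h by simp
  have "frac_integral \<rho> (\<lambda>y. g y *\<^sub>R (1::'b)) x = (\<integral>y. h y \<partial>lebesgue) *\<^sub>R 1"
    unfolding frac_integral_def eq using int by simp
  then have "ennreal (norm (frac_integral \<rho> (\<lambda>y. g y *\<^sub>R (1::'b)) x)) = ennreal (\<integral>y. h y \<partial>lebesgue)"
    using h by simp
  also have "\<dots> = (\<integral>\<^sup>+y. ennreal (h y) \<partial>lebesgue)"
    using int h by (intro nn_integral_eq_integral[symmetric]) auto
  finally show ?thesis unfolding h_def .
qed

text \<open>For x in the ball of radius r, the ball of radius r about x lies in the ball of radius
  2r about 0. Keeping only that smaller ball and using polar coordinates about x gives a lower bound
  independent of x.\<close>

lemma local_test_lower_bound:
  fixes x :: "'a::euclidean_space"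
  assumes pos: "\<And>t. 0 < t \<Longrightarrow> 0 < \<rho> t" and \<rho>: "\<rho> \<in> borel_measurable (lebesgue_on {0<..})"
    and x: "x \<in> ball 0 r"
  shows "ennreal (DIM('a) * unit_ball_vol DIM('a)) * (\<integral>\<^sup>+t\<in>{0<..<r}. ennreal (\<rho> t / t) \<partial>lebesgue) \<le>
    (\<integral>\<^sup>+y. ennreal (\<rho> (norm (x - y)) / norm (x - y) ^ DIM('a) * indicator (ball 0 (2 * r)) y) \<partial>lebesgue)"
proof -
  let ?n = "DIM('a)"
  note [measurable] = \<rho> borel_measurable_lebesgue_on_ident
  define h where "h t = \<rho> t / t ^ ?n * indicator {0<..<r} t" for t
  have "(\<lambda>t. indicator {0<..<r} t :: real) \<in> borel_measurable (lebesgue_on {0<..})"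
    by (rule borel_measurable_lebesgue_on_indicator) simp
  note [measurable] = this
  have h: "h \<in> borel_measurable (lebesgue_on {0<..})" unfolding h_def by measurable
  have "(\<integral>\<^sup>+t\<in>{0<..<r}. ennreal (\<rho> t / t) \<partial>lebesgue) = (\<integral>\<^sup>+t\<in>{0<..}. ennreal (h t * t ^ (?n - 1)) \<partial>lebesgue)"
  proof (intro nn_integral_cong)
    fix t :: real
    have "t ^ ?n = t * t ^ (?n - 1)" by (simp add: power_eq_if)
    then show "ennreal (\<rho> t / t) * indicator {0<..<r} t = ennreal (h t * t ^ (?n - 1)) * indicator {0<..} t"
      by (auto simp: h_def indicator_def)
  qed
  then have "ennreal (?n * unit_ball_vol ?n) * (\<integral>\<^sup>+t\<in>{0<..<r}. ennreal (\<rho> t / t) \<partial>lebesgue) =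
      (\<integral>\<^sup>+y. ennreal (h (norm (x - y))) \<partial>lebesgue)"
    using nn_integral_radial[OF h, of x] by simp
  also have "\<dots> \<le> (\<integral>\<^sup>+y. ennreal (\<rho> (norm (x - y)) / norm (x - y) ^ ?n * indicator (ball 0 (2 * r)) y) \<partial>lebesgue)"
  proof (intro nn_integral_mono ennreal_leI)
    fix y
    show "h (norm (x - y)) \<le> \<rho> (norm (x - y)) / norm (x - y) ^ ?n * indicator (ball 0 (2 * r)) y"
    proof (cases "0 < norm (x - y) \<and> norm (x - y) < r")
      case True
      have "norm y \<le> norm x + norm (x - y)" using norm_triangle_ineq4[of x "x - y"] by simp
      then have "y \<in> ball 0 (2 * r)" using True x by simp
      then show ?thesis using True by (simp add: h_def)
    next
      case False
      then show ?thesis using pos[of "norm (x - y)"] by (cases "x = y") (auto simp: h_def zero_power)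
    qed
  qed
  finally show ?thesis .
qed

text \<open>If |x| < r < s = |x - y|, then |y| \<le> 2s, whence \<phi>(s) \<le> D \<phi>(2s) \<le> C
  D \<phi>(|y|). The test function is thus at least a multiple of \<phi>(s)^(1/p), which is radial
  about x, and the bound is uniform in x.\<close>

lemma global_test_lower_bound:
  assumes \<phi>: "\<phi> \<in> G_dec DIM('a::euclidean_space)" and p: "1 \<le> p"
    and \<phi>_meas: "\<phi> \<in> borel_measurable (lebesgue_on {0<..})"
    and pos: "\<And>t. 0 < t \<Longrightarrow> 0 < \<rho> t" and \<rho>: "\<rho> \<in> borel_measurable (lebesgue_on {0<..})"
  shows "\<exists>c>0. \<forall>r (x::'a). x \<in> ball 0 r \<longrightarrow>
    ennreal c * (\<integral>\<^sup>+t\<in>{r<..}. ennreal (\<rho> t * \<phi> t powr (1 / p) / t) \<partial>lebesgue) \<le>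
    (\<integral>\<^sup>+y. ennreal (\<rho> (norm (x - y)) / norm (x - y) ^ DIM('a) * \<phi> (norm y) powr (1 / p)) \<partial>lebesgue)"
proof -
  let ?n = "DIM('a)"
  note [measurable] = \<rho> \<phi>_meas borel_measurable_lebesgue_on_ident
  have \<phi>_pos: "0 < \<phi> r" if "0 < r" for r using \<phi> that by (rule G_dec_pos)
  obtain C where C: "1 \<le> C" "\<And>r s. 0 < r \<Longrightarrow> r \<le> s \<Longrightarrow> \<phi> s \<le> C * \<phi> r"
    "\<And>r s. 0 < r \<Longrightarrow> r \<le> s \<Longrightarrow> \<phi> r * r ^ ?n \<le> C * (\<phi> s * s ^ ?n)"
    using G_decE[OF \<phi>] by blast
  have half: "0 < (1 / 2 :: real)" by simp
  obtain D where D: "1 \<le> D" "\<And>t. 0 < t \<Longrightarrow> \<phi> (1 / 2 * t) \<le> D * \<phi> t"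
    using G_dec_dilate[OF \<phi> half] by blast
  define E where "E = (C * D) powr (1 / p)"
  have E: "0 < E" using C(1) D(1) by (simp add: E_def)
  show ?thesis
  proof (intro exI[of _ "?n * unit_ball_vol ?n / E"] conjI allI impI)
    show "0 < ?n * unit_ball_vol ?n / E" using E by simp
    fix r and x :: 'a assume x: "x \<in> ball 0 r"
    have r: "0 < r" using x by (metis ball_eq_empty empty_iff not_le)
    define h where "h t = \<rho> t / t ^ ?n * (\<phi> t powr (1 / p) / E) * indicator {r<..} t" for t
    have "(\<lambda>t. indicator {r<..} t :: real) \<in> borel_measurable (lebesgue_on {0<..})"
      by (rule borel_measurable_lebesgue_on_indicator) simp
    note [measurable] = this
    have h: "h \<in> borel_measurable (lebesgue_on {0<..})" unfolding h_def by measurable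
    define I where "I t = ennreal (\<rho> t * \<phi> t powr (1 / p) / t) * indicator {r<..} t" for t
    have I: "I \<in> borel_measurable lebesgue"
      unfolding I_def using r by (intro borel_measurable_indicator_Ioi) (measurable, auto)
    have "ennreal (?n * unit_ball_vol ?n / E) * (\<integral>\<^sup>+t. I t \<partial>lebesgue) =
        ennreal (?n * unit_ball_vol ?n) * (ennreal (1 / E) * (\<integral>\<^sup>+t. I t \<partial>lebesgue))"
      using E by (subst ennreal_mult_left_assoc) auto
    also have "ennreal (1 / E) * (\<integral>\<^sup>+t. I t \<partial>lebesgue) = (\<integral>\<^sup>+t. ennreal (1 / E) * I t \<partial>lebesgue)"
      by (rule nn_integral_cmult[OF I, symmetric])
    also have "\<dots> = (\<integral>\<^sup>+t\<in>{0<..}. ennreal (h t * t ^ (?n - 1)) \<partial>lebesgue)"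
    proof (intro nn_integral_cong)
      fix t :: real
      have "t ^ ?n = t * t ^ (?n - 1)" by (simp add: power_eq_if)
      then show "ennreal (1 / E) * I t = ennreal (h t * t ^ (?n - 1)) * indicator {0<..} t"
        using E r by (auto simp: I_def h_def indicator_def ennreal_mult'[symmetric] mult_ac)
    qed
    also have "ennreal (?n * unit_ball_vol ?n) * \<dots> = (\<integral>\<^sup>+y. ennreal (h (norm (x - y))) \<partial>lebesgue)"
      by (rule nn_integral_radial[OF h, of x, symmetric])
    also have "\<dots> \<le> (\<integral>\<^sup>+y. ennreal (\<rho> (norm (x - y)) / norm (x - y) ^ ?n * \<phi> (norm y) powr (1 / p)) \<partial>lebesgue)"
    proof (rule nn_integral_mono_AE)
      have "AE y in lebesgue. y \<noteq> (0::'a)"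
        by (rule AE_completion, rule AE_lborel_singleton)
      then show "AE y in lebesgue. ennreal (h (norm (x - y))) \<le>
          ennreal (\<rho> (norm (x - y)) / norm (x - y) ^ ?n * \<phi> (norm y) powr (1 / p))"
      proof eventually_elim
        case (elim y)
        define s where "s = norm (x - y)"
        show ?case
        proof (cases "r < s")
          case True
          then have s: "0 < s" using r by simp
          have y: "0 < norm y" using elim by simp
          have "norm y \<le> norm x + norm (x - y)" using norm_triangle_ineq4[of x "x - y"] by simp
          then have "norm y \<le> 2 * s" using x True by (simp add: s_def)
          then have "\<phi> (2 * s) \<le> C * \<phi> (norm y)" using C(2) y by blast
          moreover have "\<phi> s \<le> D * \<phi> (2 * s)" using D(2)[of "2 * s"] s by simp
          ultimately have "\<phi> s \<le> D * (C * \<phi> (norm y))"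
            using D(1) mult_left_mono[of "\<phi> (2 * s)" "C * \<phi> (norm y)" D] by linarith
          then have "\<phi> s \<le> C * D * \<phi> (norm y)" by (simp add: mult_ac)
          then have "\<phi> s powr (1 / p) \<le> (C * D * \<phi> (norm y)) powr (1 / p)"
            using \<phi>_pos[OF s] p by (intro powr_mono2) auto
          also have "\<dots> = E * \<phi> (norm y) powr (1 / p)"
            using C(1) D(1) \<phi>_pos[OF y] by (simp add: E_def powr_mult)
          finally have "\<phi> s powr (1 / p) / E \<le> \<phi> (norm y) powr (1 / p)"
            using E by (simp add: field_simps)
          then have "\<rho> s / s ^ ?n * (\<phi> s powr (1 / p) / E) \<le> \<rho> s / s ^ ?n * \<phi> (norm y) powr (1 / p)"
            using pos[OF s] s by (intro mult_left_mono) auto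
          then show ?thesis using True by (auto simp: h_def s_def[symmetric] intro: ennreal_leI)
        qed (simp add: h_def s_def)
      qed
    qed
    finally show "ennreal (?n * unit_ball_vol ?n / E) *
        (\<integral>\<^sup>+t\<in>{r<..}. ennreal (\<rho> t * \<phi> t powr (1 / p) / t) \<partial>lebesgue) \<le>
      (\<integral>\<^sup>+y. ennreal (\<rho> (norm (x - y)) / norm (x - y) ^ ?n * \<phi> (norm y) powr (1 / p)) \<partial>lebesgue)"
      unfolding I_def .
  qed
qed

text \<open>Balls of radius s \<le> R are handled by almost monotonicity of \<open>\<phi>\<close>;
  for s > R the intersection has at most the volume of the R-ball, and almost monotonicity of
  \<open>\<phi> r * r ^ n\<close> applies.\<close>

lemma morrey_norm_indicator_ball:
  assumes \<phi>: "\<phi> \<in> G_dec DIM('a::euclidean_space)" and p: "1 \<le> p"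
  shows "\<exists>C>0. \<forall>R>0. morrey_norm p \<phi> (\<lambda>y::'a. indicator (ball 0 R) y *\<^sub>R (1::'b::real_normed_field)) \<le>
    ennreal (C * \<phi> R powr (- (1 / p)))"
proof -
  let ?n = "DIM('a)" let ?v = "unit_ball_vol ?n"
  obtain C where C: "1 \<le> C" "\<And>r s. 0 < r \<Longrightarrow> r \<le> s \<Longrightarrow> \<phi> s \<le> C * \<phi> r"
    "\<And>r s. 0 < r \<Longrightarrow> r \<le> s \<Longrightarrow> \<phi> r * r ^ ?n \<le> C * (\<phi> s * s ^ ?n)"
    using G_decE[OF \<phi>] by blast
  have \<phi>_pos: "\<forall>r>0. 0 < \<phi> r" using \<phi> by (simp add: G_dec_def)
  have p0: "0 < p" using p by simp
  show ?thesis
  proof (intro exI[of _ "C powr (1 / p)"] conjI allI impI)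
    show "0 < C powr (1 / p)" using C(1) by simp
    fix R :: real assume R: "0 < R"
    have \<phi>R: "0 < \<phi> R" using \<phi>_pos R by simp
    have "0 \<le> C powr (1 / p) * \<phi> R powr (- (1 / p))" by simp
    from morrey_norm_le_iff[OF p0 this \<phi>_pos]
    show "morrey_norm p \<phi> (\<lambda>y::'a. indicator (ball 0 R) y *\<^sub>R (1::'b)) \<le> ennreal (C powr (1 / p) * \<phi> R powr (- (1 / p)))"
    proof (rule iffD2, intro allI impI)
      fix a :: 'a and s :: real assume s: "0 < s"
      have N: "(C powr (1 / p) * \<phi> R powr (- (1 / p))) powr p * \<phi> s = C * \<phi> s / \<phi> R"
      proof -
        have "(C powr (1 / p) * \<phi> R powr (- (1 / p))) powr p = C * \<phi> R powr (- 1)"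
          using C(1) p0 by (simp add: powr_mult powr_powr)
        then show ?thesis using \<phi>R by (simp add: powr_minus divide_inverse)
      qed
      have "(\<integral>\<^sup>+x\<in>ball a s. ennreal (norm (indicator (ball 0 R) x *\<^sub>R (1::'b)) powr p) \<partial>lebesgue) =
          (\<integral>\<^sup>+x. indicator (ball a s \<inter> ball 0 R) x \<partial>lebesgue)"
        using p0 by (intro nn_integral_cong) (auto simp: indicator_def)
      also have "\<dots> = emeasure lebesgue (ball a s \<inter> ball 0 R)"
        by (intro nn_integral_indicator sets.Int) auto
      also have "\<dots> \<le> ennreal (C * \<phi> s / \<phi> R) * emeasure lebesgue (ball a s)"
      proof (cases "s \<le> R")
        case True
        then have "1 \<le> C * \<phi> s / \<phi> R" using C(2)[of s R] s \<phi>R by simp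
        then have "ennreal 1 * emeasure lebesgue (ball a s) \<le> ennreal (C * \<phi> s / \<phi> R) * emeasure lebesgue (ball a s)"
          by (intro mult_right_mono ennreal_leI) auto
        moreover have "emeasure lebesgue (ball a s \<inter> ball 0 R) \<le> emeasure lebesgue (ball a s)"
          by (intro emeasure_mono) auto
        ultimately show ?thesis by (auto intro: order_trans)
      next
        case False
        have "emeasure lebesgue (ball a s \<inter> ball 0 R) \<le> emeasure lebesgue (ball (0::'a) R)"
          by (intro emeasure_mono) auto
        also have "\<dots> = ennreal (?v * R ^ ?n)" using R by (intro emeasure_lebesgue_ball) auto
        also have "\<dots> \<le> ennreal (C * \<phi> s / \<phi> R * (?v * s ^ ?n))"
        proof (rule ennreal_leI)
          have "R ^ ?n \<le> C * \<phi> s / \<phi> R * s ^ ?n"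
            using C(3)[of R s] False R \<phi>R by (simp add: field_simps)
          then have "?v * R ^ ?n \<le> ?v * (C * \<phi> s / \<phi> R * s ^ ?n)"
            by (rule mult_left_mono) simp
          then show "?v * R ^ ?n \<le> C * \<phi> s / \<phi> R * (?v * s ^ ?n)" by (simp add: mult_ac)
        qed
        also have "\<dots> = ennreal (C * \<phi> s / \<phi> R) * emeasure lebesgue (ball a s)"
        proof -
          have "emeasure lebesgue (ball a s) = ennreal (?v * s ^ ?n)"
            using s by (intro emeasure_lebesgue_ball) auto
          moreover have "0 \<le> C * \<phi> s / \<phi> R" using C(1) \<phi>R \<phi>_pos[rule_format, OF s] by simp
          ultimately show ?thesis using ennreal_mult'[of "C * \<phi> s / \<phi> R" "?v * s ^ ?n"] by simp
        qed
        finally show ?thesis .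
      qed
      finally show "(\<integral>\<^sup>+x\<in>ball a s. ennreal (norm (indicator (ball 0 R) x *\<^sub>R (1::'b)) powr p) \<partial>lebesgue) \<le>
          ennreal ((C powr (1 / p) * \<phi> R powr (- (1 / p))) powr p * \<phi> s) * emeasure lebesgue (ball a s)"
        unfolding N .
    qed
  qed
qed

text \<open>On a ball of radius s with |a| \<ge> 2s one has |x| \<ge> s, so \<phi>(|x|) \<le> C
  \<phi>(s). Any other ball lies in the ball of radius 3s about 0, where the radial condition bounds
  the integral; this explains the two summands of \<open>K\<close>.\<close>

lemma morrey_norm_radial_power:
  assumes \<phi>: "\<phi> \<in> G_dec DIM('a::euclidean_space)" and p: "1 \<le> p"
    and \<phi>_meas: "\<phi> \<in> borel_measurable (lebesgue_on {0<..})"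
    and rad: "radial_cond DIM('a) \<phi>"
  shows "\<exists>C>0. morrey_norm p \<phi> (\<lambda>y::'a. \<phi> (norm y) powr (1 / p) *\<^sub>R (1::'b::real_normed_field)) \<le> ennreal C"
proof -
  let ?n = "DIM('a)" let ?v = "unit_ball_vol ?n"
  note [measurable] = \<phi>_meas borel_measurable_lebesgue_on_ident
  obtain C where C: "1 \<le> C" "\<And>r s. 0 < r \<Longrightarrow> r \<le> s \<Longrightarrow> \<phi> s \<le> C * \<phi> r"
    "\<And>r s. 0 < r \<Longrightarrow> r \<le> s \<Longrightarrow> \<phi> r * r ^ ?n \<le> C * (\<phi> s * s ^ ?n)"
    using G_decE[OF \<phi>] by blast
  have \<phi>_pos: "\<forall>r>0. 0 < \<phi> r" using \<phi> by (simp add: G_dec_def)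
  have p0: "0 < p" using p by simp
  obtain C1 where C1: "0 < C1" "\<And>r. 0 < r \<Longrightarrow>
      (\<integral>\<^sup>+t\<in>{0<..<r}. ennreal (\<phi> t * t ^ (?n - 1)) \<partial>lebesgue) \<le> ennreal (C1 * (\<phi> r * r ^ ?n))"
    using rad unfolding radial_cond_def by blast
  define K where "K = C + ?n * C1 * C * 3 ^ ?n"
  have K: "C \<le> K" "?n * C1 * C * 3 ^ ?n \<le> K" "0 < K"
    using C(1) C1(1) by (auto simp: K_def intro!: add_pos_nonneg)
  have N: "0 \<le> K powr (1 / p)" by simp
  have "morrey_norm p \<phi> (\<lambda>y::'a. \<phi> (norm y) powr (1 / p) *\<^sub>R (1::'b)) \<le> ennreal (K powr (1 / p))"
    unfolding morrey_norm_le_iff[OF p0 N \<phi>_pos]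
  proof (intro allI impI)
    fix a :: 'a and s :: real assume s: "0 < s"
    have \<phi>s: "0 < \<phi> s" using \<phi>_pos s by simp
    have nz: "AE y in lebesgue. y \<noteq> (0::'a)"
      by (rule AE_completion, rule AE_lborel_singleton)
    have "(\<integral>\<^sup>+x\<in>ball a s. ennreal (norm (\<phi> (norm x) powr (1 / p) *\<^sub>R (1::'b)) powr p) \<partial>lebesgue) =
        (\<integral>\<^sup>+x\<in>ball a s. ennreal (\<phi> (norm x)) \<partial>lebesgue)"
    proof (rule nn_integral_cong_AE, use nz in eventually_elim)
      fix x :: 'a assume "x \<noteq> 0"
      then have "0 < \<phi> (norm x)" using \<phi>_pos by simp
      then show "ennreal (norm (\<phi> (norm x) powr (1 / p) *\<^sub>R (1::'b)) powr p) * indicator (ball a s) x =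
          ennreal (\<phi> (norm x)) * indicator (ball a s) x"
        using p0 by (simp add: powr_powr)
    qed
    also have "\<dots> \<le> ennreal (K * \<phi> s) * emeasure lebesgue (ball a s)"
    proof (cases "2 * s \<le> norm a")
      case True
      have "(\<integral>\<^sup>+x\<in>ball a s. ennreal (\<phi> (norm x)) \<partial>lebesgue) \<le> (\<integral>\<^sup>+x\<in>ball a s. ennreal (K * \<phi> s) \<partial>lebesgue)"
      proof (intro nn_integral_mono)
        fix x
        show "ennreal (\<phi> (norm x)) * indicator (ball a s) x \<le> ennreal (K * \<phi> s) * indicator (ball a s) x"
        proof (cases "x \<in> ball a s")
          case x: True
          have "norm a \<le> norm x + norm (a - x)" using norm_triangle_ineq[of x "a - x"] by simp
          then have "s \<le> norm x" using x True by (simp add: dist_norm)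
          then have "\<phi> (norm x) \<le> C * \<phi> s" using C(2) s by blast
          also have "\<dots> \<le> K * \<phi> s" using K(1) \<phi>s by (intro mult_right_mono) auto
          finally show ?thesis using x by (simp add: ennreal_leI)
        qed simp
      qed
      also have "\<dots> = ennreal (K * \<phi> s) * emeasure lebesgue (ball a s)"
        by (rule nn_integral_cmult_indicator) simp
      finally show ?thesis .
    next
      case False
      define h where "h t = \<phi> t * indicator {0<..<3 * s} t" for t
      have "(\<lambda>t. indicator {0<..<3 * s} t :: real) \<in> borel_measurable (lebesgue_on {0<..})"
        by (rule borel_measurable_lebesgue_on_indicator) simp
      note [measurable] = this
      have h: "h \<in> borel_measurable (lebesgue_on {0<..})" unfolding h_def by measurable
      have "(\<integral>\<^sup>+x\<in>ball a s. ennreal (\<phi> (norm x)) \<partial>lebesgue) \<le> (\<integral>\<^sup>+x. ennreal (h (norm (0 - x :: 'a))) \<partial>lebesgue)"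
      proof (rule nn_integral_mono_AE)
        show "AE x in lebesgue. ennreal (\<phi> (norm x)) * indicator (ball a s) x \<le> ennreal (h (norm (0 - x)))"
          using nz
        proof eventually_elim
          case (elim x)
          show ?case
          proof (cases "x \<in> ball a s")
            case x: True
            have "norm x \<le> norm a + norm (a - x)" using norm_triangle_ineq4[of a "a - x"] by simp
            then have "norm x < 3 * s" using x False by (simp add: dist_norm)
            then show ?thesis using elim x by (simp add: h_def)
          qed simp
        qed
      qed
      also have "\<dots> = ennreal (?n * ?v) * (\<integral>\<^sup>+t\<in>{0<..}. ennreal (h t * t ^ (?n - 1)) \<partial>lebesgue)"
        by (rule nn_integral_radial[OF h])
      also have "(\<integral>\<^sup>+t\<in>{0<..}. ennreal (h t * t ^ (?n - 1)) \<partial>lebesgue) =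
          (\<integral>\<^sup>+t\<in>{0<..<3 * s}. ennreal (\<phi> t * t ^ (?n - 1)) \<partial>lebesgue)"
        by (intro nn_integral_cong) (auto simp: h_def indicator_def)
      also have "ennreal (?n * ?v) * \<dots> \<le> ennreal (?n * ?v) * ennreal (C1 * (\<phi> (3 * s) * (3 * s) ^ ?n))"
        using s by (intro mult_left_mono C1(2)) auto
      also have "\<dots> = ennreal (?n * ?v * (C1 * (\<phi> (3 * s) * (3 * s) ^ ?n)))"
        by (subst ennreal_mult') auto
      also have "\<dots> \<le> ennreal (K * \<phi> s * (?v * s ^ ?n))"
      proof (rule ennreal_leI)
        have "?n * ?v * (C1 * (\<phi> (3 * s) * (3 * s) ^ ?n)) \<le> ?n * ?v * (C1 * (C * \<phi> s * (3 * s) ^ ?n))"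
          using C(2)[of s "3 * s"] s C1(1) by (intro mult_left_mono mult_right_mono) auto
        also have "\<dots> = (?n * C1 * C * 3 ^ ?n) * (\<phi> s * (?v * s ^ ?n))"
          by (simp add: power_mult_distrib mult_ac)
        also have "\<dots> \<le> K * (\<phi> s * (?v * s ^ ?n))"
          using K(2) \<phi>s s by (intro mult_right_mono) auto
        finally show "?n * ?v * (C1 * (\<phi> (3 * s) * (3 * s) ^ ?n)) \<le> K * \<phi> s * (?v * s ^ ?n)"
          by (simp add: mult_ac)
      qed
      also have "\<dots> = ennreal (K * \<phi> s) * emeasure lebesgue (ball a s)"
      proof -
        have "emeasure lebesgue (ball a s) = ennreal (?v * s ^ ?n)"
          using s by (intro emeasure_lebesgue_ball) auto
        then show ?thesis using ennreal_mult'[of "K * \<phi> s" "?v * s ^ ?n"] K(3) \<phi>s by simp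
      qed
      finally show ?thesis .
    qed
    finally show "(\<integral>\<^sup>+x\<in>ball a s. ennreal (norm (\<phi> (norm x) powr (1 / p) *\<^sub>R (1::'b)) powr p) \<partial>lebesgue) \<le>
        ennreal ((K powr (1 / p)) powr p * \<phi> s) * emeasure lebesgue (ball a s)"
      using K(3) p0 by (simp add: powr_powr)
  qed
  then show ?thesis using K(3) by (intro exI[of _ "K powr (1 / p)"]) auto
qed

text \<open>For a level t below T, almost the whole ball lies in {|g| > t}, so the weak norm bounds
  t from above. The function need not be radial; only the constant lower bound on the ball
  matters.\<close>

lemma weak_morrey_lower_bound:
  fixes g :: "'a::euclidean_space \<Rightarrow> 'b::real_normed_vector"
  assumes q: "0 < q" and M: "0 \<le> M" and \<phi>: "\<forall>r>0. 0 < \<phi> r" and r: "0 < r"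
    and le: "weak_morrey_norm q \<phi> g \<le> ennreal M"
    and T: "AE x in lebesgue. x \<in> ball 0 r \<longrightarrow> T \<le> ennreal (norm (g x))"
    and g: "g \<in> borel_measurable lebesgue"
  shows "T \<le> ennreal (M * \<phi> r powr (1 / q))"
proof (rule ccontr)
  note [measurable] = g
  let ?V = "emeasure lebesgue (ball (0::'a) r)"
  assume "\<not> T \<le> ennreal (M * \<phi> r powr (1 / q))"
  \<comment> \<open>A finite level strictly between is needed: T may be \<infinity>, and the
    distribution function is defined by a strict inequality.\<close>
  then obtain u where u: "ennreal (M * \<phi> r powr (1 / q)) < u" "u < T"
    using dense[of "ennreal (M * \<phi> r powr (1 / q))" T] by (auto simp: not_le)
  obtain t where t: "u = ennreal t" "0 \<le> t" using u(2) by (cases u) auto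
  have Mt: "M * \<phi> r powr (1 / q) < t"
    using u(1) M unfolding t(1) by (subst (asm) ennreal_less_iff) auto
  then have t0: "0 < t" using M by (meson le_less_trans mult_nonneg_nonneg powr_ge_zero)
  have "ennreal (t powr q) * ?V \<le> ennreal (t powr q) * distr_fun (ball 0 r) g t"
  proof (intro mult_left_mono)
    show "?V \<le> distr_fun (ball 0 r) g t"
      unfolding distr_fun_def
    proof (rule emeasure_mono_AE)
      show "AE x in lebesgue. x \<in> ball 0 r \<longrightarrow> x \<in> {x \<in> ball 0 r. t < norm (g x)}"
        using T
      proof eventually_elim
        case (elim x)
        show ?case
        proof
          assume x: "x \<in> ball 0 r"
          then have "ennreal t < ennreal (norm (g x))" using elim u(2) t(1) by auto
          then have "t < norm (g x)" using t(2) by (subst (asm) ennreal_less_iff) auto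
          then show "x \<in> {x \<in> ball 0 r. t < norm (g x)}" using x by simp
        qed
      qed
    qed measurable
  qed simp
  also have "\<dots> \<le> ennreal (M powr q * \<phi> r) * ?V"
    using le t0 r unfolding weak_morrey_norm_le_iff[OF q M \<phi>] by blast
  finally have "ennreal (t powr q) \<le> ennreal (M powr q * \<phi> r)"
    using emeasure_lebesgue_ball_pos[OF r, of "0::'a"] emeasure_lebesgue_ball_finite[of "0::'a" r]
    by (subst (asm) (1 2) mult.commute, subst (asm) ennreal_mult_le_mult_iff) auto
  then have "t powr q \<le> M powr q * \<phi> r"
    using \<phi> r by (subst (asm) ennreal_le_iff) (auto intro: mult_nonneg_nonneg less_imp_le)
  also have "\<dots> = (M * \<phi> r powr (1 / q)) powr q"
    using \<phi> r M q by (simp add: powr_mult powr_powr less_imp_le)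
  also have "\<dots> < t powr q"
    using Mt M q by (intro powr_less_mono2) auto
  finally show False by simp
qed

text \<open>Averaging over the ball takes the place of the choice of a level; T may again be
  \<infinity>.\<close>

lemma morrey_one_lower_bound:
  fixes g :: "'a::euclidean_space \<Rightarrow> 'b::real_normed_vector"
  assumes M: "0 \<le> M" and \<psi>: "\<forall>r>0. 0 < \<psi> r" and r: "0 < r"
    and le: "morrey_norm 1 \<psi> g \<le> ennreal M"
    and T: "AE x in lebesgue. x \<in> ball 0 r \<longrightarrow> T \<le> ennreal (norm (g x))"
  shows "T \<le> ennreal (M * \<psi> r)"
proof -
  let ?V = "emeasure lebesgue (ball (0::'a) r)"
  have "T * ?V = (\<integral>\<^sup>+x\<in>ball (0::'a) r. T \<partial>lebesgue)"
    by (rule nn_integral_cmult_indicator[symmetric]) simp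
  also have "\<dots> \<le> (\<integral>\<^sup>+x\<in>ball 0 r. ennreal (norm (g x) powr 1) \<partial>lebesgue)"
  proof (rule nn_integral_mono_AE)
    show "AE x in lebesgue. T * indicator (ball 0 r) x \<le> ennreal (norm (g x) powr 1) * indicator (ball 0 r) x"
      using T by eventually_elim (auto simp: indicator_def)
  qed
  also have "\<dots> \<le> ennreal (M powr 1 * \<psi> r) * ?V"
    using le r unfolding morrey_norm_le_iff[OF zero_less_one M \<psi>] by blast
  finally have "T \<le> ennreal (M powr 1 * \<psi> r)"
    using emeasure_lebesgue_ball_pos[OF r, of "0::'a"] emeasure_lebesgue_ball_finite[of "0::'a" r]
    by (subst (asm) (1 2) mult.commute, subst (asm) ennreal_mult_le_mult_iff) auto
  then show ?thesis using M by simp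
qed

lemma norm_space_if_le: "f \<in> borel_measurable lebesgue \<Longrightarrow> N f \<le> ennreal M \<Longrightarrow> f \<in> norm_space N"
  by (auto simp: norm_space_def less_top[symmetric] top_unique intro: le_less_trans)

text \<open>
  The growth condition does not prevent \<open>\<rho>(t)/t\<close> from having infinite integral near a positive point.
  Finiteness of the integrals below comes from the convergence of \<open>I\<^sub>\<rho> f\<close> at some point.
\<close>

lemma frac_integral_bounded_imp_conditions:
  fixes NY :: "('a::euclidean_space \<Rightarrow> 'b::{real_normed_field, banach, second_countable_topology}) \<Rightarrow> ennreal"
  assumes \<phi>: "\<phi> \<in> G_dec DIM('a)" and p: "1 \<le> p"
    and \<phi>_meas: "\<phi> \<in> borel_measurable (lebesgue_on {0<..})"
    and pos: "\<forall>t>0. 0 < \<rho> t"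
    and \<rho>: "\<rho> \<in> borel_measurable (lebesgue_on {0<..})"
    and lower: "\<And>g M r T. g \<in> borel_measurable lebesgue \<Longrightarrow> 0 \<le> M \<Longrightarrow> 0 < r \<Longrightarrow> NY g \<le> ennreal M \<Longrightarrow>
      (AE x in lebesgue. x \<in> ball 0 r \<longrightarrow> T \<le> ennreal (norm (g x))) \<Longrightarrow> T \<le> ennreal (M * \<phi> r powr (1 / q))"
    and bdd: "frac_integral_bounded \<rho> (morrey_norm p \<phi> :: ('a \<Rightarrow> 'b) \<Rightarrow> ennreal) NY"
  shows "(\<exists>A>0. local_cond \<rho> \<phi> p q A) \<and> (radial_cond DIM('a) \<phi> \<longrightarrow> (\<exists>A>0. full_cond \<rho> \<phi> p q A))"
proof -
  let ?n = "DIM('a)" let ?v = "unit_ball_vol DIM('a)"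
  have \<phi>_pos: "0 < \<phi> r" if "0 < r" for r using \<phi> that by (rule G_dec_pos)
  note pos' = pos[rule_format]
  obtain C0 where C0: "0 < C0" "\<And>f. f \<in> norm_space (morrey_norm p \<phi> :: ('a \<Rightarrow> 'b) \<Rightarrow> ennreal) \<Longrightarrow>
      (AE x in lebesgue. frac_integral_defined \<rho> f x) \<and> frac_integral \<rho> f \<in> norm_space NY \<and>
      NY (frac_integral \<rho> f) \<le> ennreal C0 * morrey_norm p \<phi> f"
    using bdd unfolding frac_integral_bounded_def by blast
  \<comment> \<open>Common to both test functions: a lower bound T for the nonnegative integral at
    every point of the ball holds for the norm of the fractional integral at almost every one, and
    \<open>lower\<close> converts it into a bound on T.\<close>
  have test: "T \<le> ennreal (C0 * N * \<phi> r powr (1 / q))"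
    if u: "u \<in> borel_measurable lebesgue" "\<And>y. 0 \<le> u y"
      and N: "0 \<le> N" "morrey_norm p \<phi> (\<lambda>y. u y *\<^sub>R (1::'b)) \<le> ennreal N" and r: "0 < r"
      and T: "\<And>x. x \<in> ball 0 r \<Longrightarrow>
        T \<le> (\<integral>\<^sup>+y. ennreal (\<rho> (norm (x - y)) / norm (x - y) ^ ?n * u y) \<partial>lebesgue)"
    for u :: "'a \<Rightarrow> real" and N r T
  proof -
    let ?f = "\<lambda>y. u y *\<^sub>R (1::'b)"
    have "?f \<in> borel_measurable lebesgue" using u(1) by measurable
    then have "?f \<in> norm_space (morrey_norm p \<phi>)" using N(2) by (rule norm_space_if_le)
    from C0(2)[OF this] have *: "AE x in lebesgue. frac_integral_defined \<rho> ?f x"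
      "frac_integral \<rho> ?f \<in> borel_measurable lebesgue"
      "NY (frac_integral \<rho> ?f) \<le> ennreal C0 * morrey_norm p \<phi> ?f"
      by (auto simp: norm_space_def)
    have "NY (frac_integral \<rho> ?f) \<le> ennreal C0 * ennreal N"
      by (rule order_trans[OF *(3) mult_left_mono[OF N(2)]]) simp
    then have NY: "NY (frac_integral \<rho> ?f) \<le> ennreal (C0 * N)"
      using C0(1) N(1) by (simp add: ennreal_mult)
    show ?thesis
    proof (rule lower[OF *(2) _ r NY])
      show "0 \<le> C0 * N" using C0(1) N(1) by simp
      show "AE x in lebesgue. x \<in> ball 0 r \<longrightarrow> T \<le> ennreal (norm (frac_integral \<rho> ?f x))"
        using *(1)
      proof eventually_elim
        case (elim x)
        then show ?case
          using frac_integral_scaleR_one[OF pos' u(2) elim] T[of x] by simp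
      qed
    qed
  qed
  obtain C1 where C1: "0 < C1" "\<And>R. 0 < R \<Longrightarrow>
      morrey_norm p \<phi> (\<lambda>y::'a. indicator (ball 0 R) y *\<^sub>R (1::'b)) \<le> ennreal (C1 * \<phi> R powr (- (1 / p)))"
    using morrey_norm_indicator_ball[OF \<phi> p, where 'b = 'b] by blast
  have half: "0 < (1 / 2 :: real)" by simp
  obtain D where D: "1 \<le> D" "\<And>t. 0 < t \<Longrightarrow> \<phi> (1 / 2 * t) \<le> D * \<phi> t"
    using G_dec_dilate[OF \<phi> half] by blast
  define nv where "nv = ?n * ?v"
  have nv: "0 < nv" by (simp add: nv_def)
  \<comment> \<open>C0 is the operator bound and C1 the constant in the norm of the indicator;
    \<open>D powr (1 / p)\<close> replaces \<phi>(2r) by \<phi>(r), and nv is the factor from polar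
    coordinates.\<close>
  define A1 where "A1 = C0 * C1 * D powr (1 / p) / nv"
  have A1: "0 < A1" using C0(1) C1(1) D(1) nv by (simp add: A1_def)
  have local: "local_cond \<rho> \<phi> p q A1"
    unfolding local_cond_def
  proof (intro allI impI)
    fix r :: real assume r: "0 < r"
    let ?I = "\<integral>\<^sup>+t\<in>{0<..<r}. ennreal (\<rho> t / t) \<partial>lebesgue"
    have "ennreal nv * ?I \<le> ennreal (C0 * (C1 * \<phi> (2 * r) powr (- (1 / p))) * \<phi> r powr (1 / q))"
    proof (rule test)
      show "(\<lambda>y. indicator (ball 0 (2 * r)) y :: real) \<in> borel_measurable lebesgue" by simp
      show "morrey_norm p \<phi> (\<lambda>y::'a. indicator (ball 0 (2 * r)) y *\<^sub>R (1::'b)) \<le>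
          ennreal (C1 * \<phi> (2 * r) powr (- (1 / p)))"
        using r by (intro C1(2)) simp
      show "ennreal nv * ?I \<le>
          (\<integral>\<^sup>+y. ennreal (\<rho> (norm (x - y)) / norm (x - y) ^ ?n * indicator (ball 0 (2 * r)) y) \<partial>lebesgue)"
        if "x \<in> ball 0 r" for x :: 'a
        unfolding nv_def using pos' \<rho> that by (rule local_test_lower_bound)
    qed (use C1(1) r in auto)
    also have "\<dots> \<le> ennreal (nv * (A1 * \<phi> r powr (1 / q) * \<phi> r powr (- (1 / p))))"
    proof (rule ennreal_leI)
      have "\<phi> r \<le> D * \<phi> (2 * r)" using D(2)[of "2 * r"] r by simp
      then have "(D * \<phi> (2 * r)) powr (- (1 / p)) \<le> \<phi> r powr (- (1 / p))"
        using \<phi>_pos[OF r] p by (intro powr_mono2') auto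
      then have "D powr (1 / p) * (D * \<phi> (2 * r)) powr (- (1 / p)) \<le> D powr (1 / p) * \<phi> r powr (- (1 / p))"
        by (rule mult_left_mono) simp
      also have "D powr (1 / p) * (D * \<phi> (2 * r)) powr (- (1 / p)) = \<phi> (2 * r) powr (- (1 / p))"
        using D(1) \<phi>_pos[of "2 * r"] r by (simp add: powr_mult powr_minus)
      finally have "C0 * C1 * \<phi> r powr (1 / q) * \<phi> (2 * r) powr (- (1 / p)) \<le>
          C0 * C1 * \<phi> r powr (1 / q) * (D powr (1 / p) * \<phi> r powr (- (1 / p)))"
        using C0(1) C1(1) by (intro mult_left_mono) auto
      also have "\<dots> = nv * (A1 * \<phi> r powr (1 / q) * \<phi> r powr (- (1 / p)))"
        using nv by (simp add: A1_def)
      finally show "C0 * (C1 * \<phi> (2 * r) powr (- (1 / p))) * \<phi> r powr (1 / q) \<le>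
          nv * (A1 * \<phi> r powr (1 / q) * \<phi> r powr (- (1 / p)))"
        by (simp add: mult_ac)
    qed
    also have "\<dots> = ennreal nv * ennreal (A1 * \<phi> r powr (1 / q) * \<phi> r powr (- (1 / p)))"
      using nv by (intro ennreal_mult') simp
    finally have "?I \<le> ennreal (A1 * \<phi> r powr (1 / q) * \<phi> r powr (- (1 / p)))"
      using nv by (subst (asm) ennreal_mult_le_mult_iff) auto
    then have "?I * ennreal (\<phi> r powr (1 / p)) \<le>
        ennreal (A1 * \<phi> r powr (1 / q) * \<phi> r powr (- (1 / p))) * ennreal (\<phi> r powr (1 / p))"
      by (rule mult_right_mono) simp
    also have "\<dots> = ennreal (A1 * \<phi> r powr (1 / q))"
      using \<phi>_pos[OF r] A1 by (simp add: ennreal_mult[symmetric] powr_minus)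
    finally show "?I * ennreal (\<phi> r powr (1 / p)) \<le> ennreal (A1 * \<phi> r powr (1 / q))" .
  qed
  moreover have "\<exists>A>0. full_cond \<rho> \<phi> p q A" if rad: "radial_cond ?n \<phi>"
  proof -
    obtain C2 where C2: "0 < C2" "morrey_norm p \<phi> (\<lambda>y::'a. \<phi> (norm y) powr (1 / p) *\<^sub>R (1::'b)) \<le> ennreal C2"
      using morrey_norm_radial_power[OF \<phi> p \<phi>_meas rad, where 'b = 'b] by blast
    obtain c where c: "0 < c" "\<And>r (x::'a). x \<in> ball 0 r \<Longrightarrow>
        ennreal c * (\<integral>\<^sup>+t\<in>{r<..}. ennreal (\<rho> t * \<phi> t powr (1 / p) / t) \<partial>lebesgue) \<le>
        (\<integral>\<^sup>+y. ennreal (\<rho> (norm (x - y)) / norm (x - y) ^ ?n * \<phi> (norm y) powr (1 / p)) \<partial>lebesgue)"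
      using global_test_lower_bound[OF \<phi> p \<phi>_meas _ \<rho>] pos by blast
    have "full_cond \<rho> \<phi> p q (A1 + C0 * C2 / c)"
      unfolding full_cond_def
    proof (intro allI impI)
      fix r :: real assume r: "0 < r"
      let ?J = "\<integral>\<^sup>+t\<in>{r<..}. ennreal (\<rho> t * \<phi> t powr (1 / p) / t) \<partial>lebesgue"
      have "ennreal c * ?J \<le> ennreal (C0 * C2 * \<phi> r powr (1 / q))"
      proof (rule test[OF _ _ _ C2(2) r])
        have "(\<lambda>t. \<phi> t powr (1 / p)) \<in> borel_measurable (lebesgue_on {0<..})"
          using \<phi>_meas by measurable
        then show "(\<lambda>y::'a. \<phi> (norm y) powr (1 / p)) \<in> borel_measurable lebesgue"
          by (rule borel_measurable_radial)
      qed (use C2(1) c(2) in auto)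
      also have "\<dots> = ennreal c * ennreal (C0 * C2 / c * \<phi> r powr (1 / q))"
        using c(1) by (subst ennreal_mult'[symmetric]) auto
      finally have J: "?J \<le> ennreal (C0 * C2 / c * \<phi> r powr (1 / q))"
        using c(1) by (subst (asm) ennreal_mult_le_mult_iff) auto
      have "(\<integral>\<^sup>+t\<in>{0<..<r}. ennreal (\<rho> t / t) \<partial>lebesgue) * ennreal (\<phi> r powr (1 / p)) + ?J \<le>
          ennreal (A1 * \<phi> r powr (1 / q)) + ennreal (C0 * C2 / c * \<phi> r powr (1 / q))"
        using local r J unfolding local_cond_def by (intro add_mono) auto
      also have "\<dots> = ennreal ((A1 + C0 * C2 / c) * \<phi> r powr (1 / q))"
        using A1 C0(1) C2(1) c(1) by (subst ennreal_plus[symmetric]) (auto simp: distrib_right)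
      finally show "(\<integral>\<^sup>+t\<in>{0<..<r}. ennreal (\<rho> t / t) \<partial>lebesgue) * ennreal (\<phi> r powr (1 / p)) + ?J \<le>
          ennreal ((A1 + C0 * C2 / c) * \<phi> r powr (1 / q))" .
    qed
    moreover have "0 < A1 + C0 * C2 / c" using A1 C0(1) C2(1) c(1) by (intro add_pos_pos) auto
    ultimately show ?thesis by blast
  qed
  ultimately show ?thesis using A1 by blast
qed

theorem corollary3p11:
  fixes p q :: real and \<phi> \<rho> :: "real \<Rightarrow> real"
  assumes "1 \<le> p" and "p < q"
    and "\<phi> \<in> G_dec CARD('n::finite)"
    and "\<forall>t>0. 0 < \<rho> t"
    and "\<phi> \<in> borel_measurable (lebesgue_on {0<..})"
    and "\<rho> \<in> borel_measurable (lebesgue_on {0<..})"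
    and "(\<integral>\<^sup>+t\<in>{0<..<1}. ennreal (\<rho> t / t) \<partial>lebesgue) < \<infinity>"
    and "\<exists>C K1 K2. 0 < C \<and> 0 < K1 \<and> K1 < K2 \<and>
           (\<forall>r>0. (SUP t\<in>{r..2 * r}. ennreal (\<rho> t))
                    \<le> ennreal C * (\<integral>\<^sup>+t\<in>{K1 * r<..<K2 * r}. ennreal (\<rho> t / t) \<partial>lebesgue))"
  shows
    "(filterlim \<phi> at_top (at_right 0) \<and> (\<phi> \<longlongrightarrow> 0) at_top \<and> (\<exists>A>0. full_cond \<rho> \<phi> p q A)
        \<longrightarrow>
        (\<exists>C>0.
          (\<forall>f \<in> (morrey p \<phi> ::
               (real ^ 'n \<Rightarrow> 'b::{real_normed_field, banach, second_countable_topology}) set).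
             \<forall>x. frac_integral_le \<rho> f x
                   (ennreal C * enn_powr (maximal_fun f x) (p / q)
                      * enn_powr (morrey_norm p \<phi> f) (1 - p / q))) \<and>
          (1 < p \<longrightarrow>
            (\<forall>f \<in> (weak_morrey p \<phi> :: (real ^ 'n \<Rightarrow> 'b) set).
               \<forall>x. frac_integral_le \<rho> f x
                     (ennreal C * enn_powr (maximal_fun f x) (p / q)
                        * enn_powr (weak_morrey_norm p \<phi> f) (1 - p / q))))) \<and>
        frac_integral_bounded \<rho> (morrey_norm p \<phi> :: (real ^ 'n \<Rightarrow> 'b) \<Rightarrow> ennreal)
          (weak_morrey_norm q \<phi>) \<and>
        (1 < p \<longrightarrow>
          frac_integral_bounded \<rho> (morrey_norm p \<phi> :: (real ^ 'n \<Rightarrow> 'b) \<Rightarrow> ennreal)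
            (morrey_norm q \<phi>) \<and>
          frac_integral_bounded \<rho> (weak_morrey_norm p \<phi> :: (real ^ 'n \<Rightarrow> 'b) \<Rightarrow> ennreal)
            (weak_morrey_norm q \<phi>)))
     \<and>
     (frac_integral_bounded \<rho> (morrey_norm p \<phi> :: (real ^ 'n \<Rightarrow> 'b) \<Rightarrow> ennreal)
        (weak_morrey_norm q \<phi>)
        \<longrightarrow>
        (\<exists>A'>0. local_cond \<rho> \<phi> p q A') \<and>
        (radial_cond CARD('n) \<phi> \<longrightarrow> (\<exists>A>0. full_cond \<rho> \<phi> p q A)))
     \<and>
     (frac_integral_bounded \<rho> (morrey_norm p \<phi> :: (real ^ 'n \<Rightarrow> 'b) \<Rightarrow> ennreal)
        (morrey_norm 1 (\<lambda>r. \<phi> r powr (1 / q)))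
        \<longrightarrow>
        (\<exists>A'>0. local_cond \<rho> \<phi> p q A') \<and>
        (radial_cond CARD('n) \<phi> \<longrightarrow> (\<exists>A>0. full_cond \<rho> \<phi> p q A)))"
proof -
  have \<phi>: "\<phi> \<in> G_dec DIM(real ^ 'n)" using assms(3) by simp
  have \<phi>_pos: "0 < \<phi> r" if "0 < r" for r using \<phi> that by (rule G_dec_pos)
  have \<phi>_all: "\<forall>r>0. 0 < \<phi> r" using \<phi>_pos by blast
  have p0: "0 < p" and q0: "0 < q" using assms(1,2) by auto
  obtain C K1 K2 where C: "0 < C" "0 < K1" "K1 < K2"
    and growth: "\<forall>s>0. ennreal (\<rho> s) \<le> ennreal C * (\<integral>\<^sup>+t\<in>{K1 * s<..<K2 * s}. ennreal (\<rho> t / t) \<partial>lebesgue)"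
  proof -
    obtain C K1 K2 where K: "0 < C" "0 < K1" "K1 < K2"
      and le: "\<And>r. 0 < r \<Longrightarrow> (SUP t\<in>{r..2 * r}. ennreal (\<rho> t))
        \<le> ennreal C * (\<integral>\<^sup>+t\<in>{K1 * r<..<K2 * r}. ennreal (\<rho> t / t) \<partial>lebesgue)"
      using assms(8) by blast
    \<comment> \<open>Only the value t = s of the supremum is retained.\<close>
    have "ennreal (\<rho> s) \<le> ennreal C * (\<integral>\<^sup>+t\<in>{K1 * s<..<K2 * s}. ennreal (\<rho> t / t) \<partial>lebesgue)" if "0 < s" for s
      by (rule order_trans[OF SUP_upper le[OF that]]) (use that in simp)
    with K show ?thesis using that by blast
  qed
  \<comment> \<open>The two necessity statements differ only in the target norm, whose lower bound
    on a ball is the one remaining premise besides boundedness.\<close>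
  note nec = frac_integral_bounded_imp_conditions[OF \<phi> assms(1,5,4,6), where 'b = 'b and q = q]
  show ?thesis
  proof (intro conjI)
    show "filterlim \<phi> at_top (at_right 0) \<and> (\<phi> \<longlongrightarrow> 0) at_top \<and> (\<exists>A>0. full_cond \<rho> \<phi> p q A)
        \<longrightarrow>
        (\<exists>C>0.
          (\<forall>f \<in> (morrey p \<phi> :: (real ^ 'n \<Rightarrow> 'b) set).
             \<forall>x. frac_integral_le \<rho> f x
                   (ennreal C * enn_powr (maximal_fun f x) (p / q)
                      * enn_powr (morrey_norm p \<phi> f) (1 - p / q))) \<and>
          (1 < p \<longrightarrow>
            (\<forall>f \<in> (weak_morrey p \<phi> :: (real ^ 'n \<Rightarrow> 'b) set).
               \<forall>x. frac_integral_le \<rho> f x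
                     (ennreal C * enn_powr (maximal_fun f x) (p / q)
                        * enn_powr (weak_morrey_norm p \<phi> f) (1 - p / q))))) \<and>
        frac_integral_bounded \<rho> (morrey_norm p \<phi> :: (real ^ 'n \<Rightarrow> 'b) \<Rightarrow> ennreal)
          (weak_morrey_norm q \<phi>) \<and>
        (1 < p \<longrightarrow>
          frac_integral_bounded \<rho> (morrey_norm p \<phi> :: (real ^ 'n \<Rightarrow> 'b) \<Rightarrow> ennreal)
            (morrey_norm q \<phi>) \<and>
          frac_integral_bounded \<rho> (weak_morrey_norm p \<phi> :: (real ^ 'n \<Rightarrow> 'b) \<Rightarrow> ennreal)
            (weak_morrey_norm q \<phi>))" (is "?hyp \<longrightarrow> ?concl")
    proof
      assume ?hyp
      then obtain A where lim: "filterlim \<phi> at_top (at_right 0)" "(\<phi> \<longlongrightarrow> 0) at_top"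
        and A: "0 < A" "full_cond \<rho> \<phi> p q A" by blast
      obtain K0 where K0: "0 < K0" "\<forall>(f :: real ^ 'n \<Rightarrow> 'b) X c.
        f \<in> borel_measurable lebesgue \<longrightarrow> X < \<infinity> \<longrightarrow> 0 < c \<longrightarrow>
        (\<forall>N>0. X \<le> ennreal N \<longrightarrow> tail_bound p \<phi> f (c * N)) \<longrightarrow>
        (\<forall>x. frac_integral_le \<rho> f x (ennreal (K0 * c powr (1 - p / q)) * enn_powr (maximal_fun f x) (p / q) *
          enn_powr X (1 - p / q)))"
        using hedberg_frac_integral_le[OF \<phi> assms(1,2,5,4,6) C growth lim A, where 'b = 'b] by (elim exE conjE)
      \<comment> \<open>One c serves both kinds of norm: 1 for the strong one, the constant of
        \<open>weak_imp_tail_bound\<close> for the weak one. For p = 1 the second entry is 0, since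
        2/0 = 0, and c = 1.\<close>
      define c where "c = max 1 ((2 / (1 - 2 powr (1 - p))) powr (1 / p))"
      have c: "0 < c" "1 \<le> c" by (auto simp: c_def)
      define K where "K = K0 * c powr (1 - p / q)"
      have K: "0 < K" using K0(1) c by (simp add: K_def)
      have strong_tail: "\<forall>N>0. morrey_norm p \<phi> f \<le> ennreal N \<longrightarrow> tail_bound p \<phi> f (c * N)"
        if f: "f \<in> borel_measurable lebesgue" for f :: "real ^ 'n \<Rightarrow> 'b"
      proof (intro allI impI)
        fix N :: real assume N: "0 < N" "morrey_norm p \<phi> f \<le> ennreal N"
        have "tail_bound p \<phi> f N"
          using f assms(1) \<phi>_pos
        proof (rule strong_imp_tail_bound)
          show "(\<integral>\<^sup>+x\<in>ball a r. ennreal (norm (f x) powr p) \<partial>lebesgue)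
              \<le> ennreal (N powr p * \<phi> r) * emeasure lebesgue (ball a r)" if "0 < r" for a r
            using N(2) that unfolding morrey_norm_le_iff[OF p0 less_imp_le[OF N(1)] \<phi>_all] by blast
        qed
        then show "tail_bound p \<phi> f (c * N)"
          using N(1) c p0 \<phi>_pos by (intro tail_bound_mono[of p \<phi> f N "c * N"]) auto
      qed
      have weak_tail: "\<forall>N>0. weak_morrey_norm p \<phi> f \<le> ennreal N \<longrightarrow> tail_bound p \<phi> f (c * N)"
        if f: "f \<in> borel_measurable lebesgue" and p: "1 < p" for f :: "real ^ 'n \<Rightarrow> 'b"
      proof (intro allI impI)
        fix N :: real assume N: "0 < N" "weak_morrey_norm p \<phi> f \<le> ennreal N"
        have "tail_bound p \<phi> f ((2 / (1 - 2 powr (1 - p))) powr (1 / p) * N)"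
          using f p less_imp_le[OF N(1)] \<phi>_pos
        proof (rule weak_imp_tail_bound)
          show "ennreal (t powr p) * distr_fun (ball a r) f t
              \<le> ennreal (N powr p * \<phi> r) * emeasure lebesgue (ball a r)" if "0 < r" "0 < t" for a r t
            using N(2) that unfolding weak_morrey_norm_le_iff[OF p0 less_imp_le[OF N(1)] \<phi>_all] by blast
        qed
        then show "tail_bound p \<phi> f (c * N)"
          using N(1) p0 \<phi>_pos
          by (intro tail_bound_mono[of p \<phi> f "(2 / (1 - 2 powr (1 - p))) powr (1 / p) * N" "c * N"])
            (auto simp: c_def intro!: mult_right_mono)
      qed
      have strong_le: "\<forall>x. frac_integral_le \<rho> f x (ennreal K * enn_powr (maximal_fun f x) (p / q) *
          enn_powr (morrey_norm p \<phi> f) (1 - p / q))"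
        if f: "f \<in> norm_space (morrey_norm p \<phi>)" for f :: "real ^ 'n \<Rightarrow> 'b"
      proof -
        have "f \<in> borel_measurable lebesgue" "morrey_norm p \<phi> f < \<infinity>"
          using f by (auto simp: norm_space_def)
        then show ?thesis
          using K0(2)[THEN spec, of f, THEN spec, of "morrey_norm p \<phi> f", THEN spec, of c] c(1) strong_tail[of f]
          unfolding K_def by blast
      qed
      have weak_le: "\<forall>x. frac_integral_le \<rho> f x (ennreal K * enn_powr (maximal_fun f x) (p / q) *
          enn_powr (weak_morrey_norm p \<phi> f) (1 - p / q))"
        if f: "f \<in> norm_space (weak_morrey_norm p \<phi>)" and p: "1 < p" for f :: "real ^ 'n \<Rightarrow> 'b"
      proof -
        have "f \<in> borel_measurable lebesgue" "weak_morrey_norm p \<phi> f < \<infinity>"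
          using f by (auto simp: norm_space_def)
        then show ?thesis
          using K0(2)[THEN spec, of f, THEN spec, of "weak_morrey_norm p \<phi> f", THEN spec, of c] c(1) weak_tail[of f] p
          unfolding K_def by blast
      qed
      obtain L where L: "0 < L" "\<forall>(f :: real ^ 'n \<Rightarrow> 'b) X.
        f \<in> borel_measurable lebesgue \<longrightarrow> X < \<infinity> \<longrightarrow>
        (\<forall>N>0. X \<le> ennreal N \<longrightarrow> tail_bound p \<phi> f (c * N)) \<longrightarrow>
        (\<forall>x. frac_integral_le \<rho> f x (ennreal K * enn_powr (maximal_fun f x) (p / q) * enn_powr X (1 - p / q))) \<longrightarrow>
        weak_morrey_norm q \<phi> (frac_integral \<rho> f) \<le> ennreal L * X"
        using weak_norm_frac_integral[OF \<phi> assms(1,2) K c(1), where 'b = 'b and \<rho> = \<rho>] by (elim exE conjE)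
      have L': "weak_morrey_norm q \<phi> (frac_integral \<rho> f) \<le> ennreal L * X"
        if "f \<in> borel_measurable lebesgue" "X < \<infinity>"
          "\<forall>N>0. X \<le> ennreal N \<longrightarrow> tail_bound p \<phi> f (c * N)"
          "\<forall>x. frac_integral_le \<rho> f x (ennreal K * enn_powr (maximal_fun f x) (p / q) * enn_powr X (1 - p / q))"
        for f :: "real ^ 'n \<Rightarrow> 'b" and X
        using L(2)[THEN spec, of f, THEN spec, of X] that by blast
      \<comment> \<open>What boundedness demands besides the norm estimate, namely convergence
        almost everywhere and membership in the target space, is settled here for all three pairs of
        spaces.\<close>
      have target: "(AE x in lebesgue. frac_integral_defined \<rho> f x) \<and>
          frac_integral \<rho> f \<in> norm_space NY \<and> NY (frac_integral \<rho> f) \<le> ennreal L' * X"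
        if f: "f \<in> borel_measurable lebesgue" and X: "X < \<infinity>"
          and tail: "\<forall>N>0. X \<le> ennreal N \<longrightarrow> tail_bound p \<phi> f (c * N)"
          and le: "\<forall>x. frac_integral_le \<rho> f x (ennreal K * enn_powr (maximal_fun f x) (p / q) * enn_powr X (1 - p / q))"
          and NY: "NY (frac_integral \<rho> f) \<le> ennreal L' * X"
        for f :: "real ^ 'n \<Rightarrow> 'b" and X NY L'
      proof -
        obtain N where N: "X = ennreal N" "0 \<le> N" using X by (cases X) auto
        \<comment> \<open>N + 1 is used because N may be 0 and the tail bounds are available for
          positive majorants only.\<close>
        have "tail_bound p \<phi> f (c * (N + 1))" using tail N by (simp add: ennreal_leI)
        moreover have "0 < c * (N + 1)" using c N(2) by simp
        ultimately have "AE x in lebesgue. frac_integral_defined \<rho> f x"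
          using frac_integral_defined_AE[OF \<phi> assms(1) f _ _ X] le by blast
        moreover have "frac_integral \<rho> f \<in> norm_space NY"
          using borel_measurable_frac_integral[OF f assms(6)] le_less_trans[OF NY] X
          by (simp add: norm_space_def ennreal_mult_less_top)
        ultimately show ?thesis using NY by blast
      qed
      have b1: "frac_integral_bounded \<rho> (morrey_norm p \<phi> :: (real ^ 'n \<Rightarrow> 'b) \<Rightarrow> ennreal) (weak_morrey_norm q \<phi>)"
        unfolding frac_integral_bounded_def
      proof (intro exI[of _ L] conjI ballI L(1))
        fix f :: "real ^ 'n \<Rightarrow> 'b" assume f: "f \<in> norm_space (morrey_norm p \<phi>)"
        then have f': "f \<in> borel_measurable lebesgue" "morrey_norm p \<phi> f < \<infinity>" by (auto simp: norm_space_def)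
        note t = target[where NY = "weak_morrey_norm q \<phi>", OF f' strong_tail[OF f'(1)] strong_le[OF f]
          L'[OF f' strong_tail[OF f'(1)] strong_le[OF f]]]
        show "AE x in lebesgue. frac_integral_defined \<rho> f x"
          and "frac_integral \<rho> f \<in> norm_space (weak_morrey_norm q \<phi>)"
          and "weak_morrey_norm q \<phi> (frac_integral \<rho> f) \<le> ennreal L * morrey_norm p \<phi> f"
          using t by blast+
      qed
      have b2: "frac_integral_bounded \<rho> (morrey_norm p \<phi> :: (real ^ 'n \<Rightarrow> 'b) \<Rightarrow> ennreal) (morrey_norm q \<phi>)"
        if p: "1 < p"
      proof -
        obtain L2 where L2: "0 < L2" "\<forall>f :: real ^ 'n \<Rightarrow> 'b.
          f \<in> borel_measurable lebesgue \<longrightarrow> morrey_norm p \<phi> f < \<infinity> \<longrightarrow>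
          (\<forall>x. frac_integral_le \<rho> f x (ennreal K * enn_powr (maximal_fun f x) (p / q) *
            enn_powr (morrey_norm p \<phi> f) (1 - p / q))) \<longrightarrow>
          morrey_norm q \<phi> (frac_integral \<rho> f) \<le> ennreal L2 * morrey_norm p \<phi> f"
          using strong_norm_frac_integral[OF \<phi> p assms(2) K assms(6), where 'b = 'b] by (elim exE conjE)
        show ?thesis
          unfolding frac_integral_bounded_def
        proof (intro exI[of _ L2] conjI ballI L2(1))
          fix f :: "real ^ 'n \<Rightarrow> 'b" assume f: "f \<in> norm_space (morrey_norm p \<phi>)"
          then have f': "f \<in> borel_measurable lebesgue" "morrey_norm p \<phi> f < \<infinity>" by (auto simp: norm_space_def)
          note t = target[where NY = "morrey_norm q \<phi>", OF f' strong_tail[OF f'(1)] strong_le[OF f]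
            L2(2)[THEN spec, THEN mp, OF f'(1), THEN mp, OF f'(2), THEN mp, OF strong_le[OF f]]]
          show "AE x in lebesgue. frac_integral_defined \<rho> f x"
            and "frac_integral \<rho> f \<in> norm_space (morrey_norm q \<phi>)"
            and "morrey_norm q \<phi> (frac_integral \<rho> f) \<le> ennreal L2 * morrey_norm p \<phi> f"
            using t by blast+
        qed
      qed
      have b3: "frac_integral_bounded \<rho> (weak_morrey_norm p \<phi> :: (real ^ 'n \<Rightarrow> 'b) \<Rightarrow> ennreal) (weak_morrey_norm q \<phi>)"
        if p: "1 < p"
        unfolding frac_integral_bounded_def
      proof (intro exI[of _ L] conjI ballI L(1))
        fix f :: "real ^ 'n \<Rightarrow> 'b" assume f: "f \<in> norm_space (weak_morrey_norm p \<phi>)"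
        then have f': "f \<in> borel_measurable lebesgue" "weak_morrey_norm p \<phi> f < \<infinity>" by (auto simp: norm_space_def)
        note t = target[where NY = "weak_morrey_norm q \<phi>", OF f' weak_tail[OF f'(1) p] weak_le[OF f p]
          L'[OF f' weak_tail[OF f'(1) p] weak_le[OF f p]]]
        show "AE x in lebesgue. frac_integral_defined \<rho> f x"
          and "frac_integral \<rho> f \<in> norm_space (weak_morrey_norm q \<phi>)"
          and "weak_morrey_norm q \<phi> (frac_integral \<rho> f) \<le> ennreal L * weak_morrey_norm p \<phi> f"
          using t by blast+
      qed
      show ?concl
        using K strong_le weak_le b1 b2 b3 unfolding morrey_def weak_morrey_def by blast
    qed
    let ?cond = "\<lambda>n. (\<exists>A'>0. local_cond \<rho> \<phi> p q A') \<and>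
        (radial_cond n \<phi> \<longrightarrow> (\<exists>A>0. full_cond \<rho> \<phi> p q A))"
    show "frac_integral_bounded \<rho> (morrey_norm p \<phi> :: (real ^ 'n \<Rightarrow> 'b) \<Rightarrow> ennreal) (weak_morrey_norm q \<phi>) \<longrightarrow>
        ?cond CARD('n)"
    proof
      assume bdd: "frac_integral_bounded \<rho> (morrey_norm p \<phi> :: (real ^ 'n \<Rightarrow> 'b) \<Rightarrow> ennreal) (weak_morrey_norm q \<phi>)"
      have "?cond DIM(real ^ 'n)"
        by (rule nec[OF _ bdd]) (rule weak_morrey_lower_bound[OF q0 _ \<phi>_all])
      then show "?cond CARD('n)" by simp
    qed
    show "frac_integral_bounded \<rho> (morrey_norm p \<phi> :: (real ^ 'n \<Rightarrow> 'b) \<Rightarrow> ennreal)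
          (morrey_norm 1 (\<lambda>r. \<phi> r powr (1 / q))) \<longrightarrow> ?cond CARD('n)"
    proof
      assume bdd: "frac_integral_bounded \<rho> (morrey_norm p \<phi> :: (real ^ 'n \<Rightarrow> 'b) \<Rightarrow> ennreal)
          (morrey_norm 1 (\<lambda>r. \<phi> r powr (1 / q)))"
      have \<psi>: "\<forall>r>0. 0 < \<phi> r powr (1 / q)" using \<phi>_all by (auto simp: less_imp_neq[symmetric])
      have "?cond DIM(real ^ 'n)"
        by (rule nec[OF _ bdd]) (rule morrey_one_lower_bound[OF _ \<psi>])
      then show "?cond CARD('n)" by simp
    qed
  qed
qed

end
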